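(* If $F:\mathbb T^2\to\mathbb T^2$ is a $\mathcal C^1$ uniformly expanding map of degree larger than $16$ that is not homotopic to a homothety, then $F$ is a factor of a smooth conservative map $f:\mathbb T^2\to\mathbb T^2$ (that is, $f$ is semi-conjugate to $F$) that is non-uniformly hyperbolic with one positive and one negative Lyapunov exponent.
   Context: $\mathbb T^2=\mathbb R^2/\mathbb Z^2$. Any continuous map of $\mathbb T^2$ is homotopic to the linear endomorphism induced by an integer matrix $E$; the degree here is the topological degree $|\det E|$ (number of preimages). A homothety is the endomorphism induced by $k\cdot\mathrm{Id}$, $k\in\mathbb Z$. Conservative means preserving the Lebesgue (Haar) probability measure $\mu$. $F$ is a factor of $f$ if there is a continuous surjection $h:\mathbb T^2\to\mathbb T^2$ with $h\circ f=F\circ h$. The Lyapunov exponents of $f$ are $\chi^+(x)=\lim_n\frac1n\log\|D_xf^n\|$ and $\chi^-(x)=\lim_n\frac1n\log \mathrm m(D_xf^n)$, with $\mathrm m(A)=\inf\{\|Av\|:\|v\|=1\}$, which exist for $\mu$-a.e. $x$; $f$ is non-uniformly hyperbolic if $\chi^-<0<\chi^+$ $\mu$-almost everywhere. *)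

theory Defs
  imports "HOL-Analysis.Analysis"
begin

definition torus_rel :: "real^2 \<Rightarrow> real^2 \<Rightarrow> bool" where
  "torus_rel p q \<longleftrightarrow> (\<forall>i. p $ i - q $ i \<in> \<int>)"

lemma equivp_torus_rel: "equivp torus_rel"
proof (rule equivpI)
  show "reflp torus_rel"
    by (auto simp: reflp_def torus_rel_def)
  show "symp torus_rel"
    unfolding symp_def torus_rel_def by (metis Ints_minus minus_diff_eq)
  show "transp torus_rel"
    unfolding transp_def torus_rel_def
    by (metis Ints_add add_diff_eq diff_add_cancel)
qed

quotient_type torus = "real^2" / torus_rel
  by (rule equivp_torus_rel)

definition to_torus :: "real^2 \<Rightarrow> torus" where
  "to_torus = abs_torus"

lemma to_torus_eq_iff: "to_torus p = to_torus q \<longleftrightarrow> (\<forall>i. p $ i - q $ i \<in> \<int>)"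
  unfolding to_torus_def using torus.abs_eq_iff torus_rel_def by auto

lemma surj_to_torus: "surj to_torus"
  unfolding to_torus_def surj_def
  by (metis Quotient3_torus Quotient3_abs_rep)

instantiation torus :: topological_space
begin

definition open_torus_def: "open U \<longleftrightarrow> open (to_torus -` U)"

instance
  by standard (auto simp: open_torus_def vimage_Union)

end

lemma continuous_on_to_torus: "continuous_on UNIV to_torus"
  by (simp add: continuous_on_open_vimage open_torus_def)

definition torus_haar :: "torus measure" where
  "torus_haar = distr (restrict_space lborel {p. \<forall>i. 0 \<le> p $ i \<and> p $ i < 1}) borel to_torus"

lemma emeasure_torus_haar_UNIV: "emeasure torus_haar UNIV = 1"
proof -
  let ?S = "{p :: real^2. \<forall>i. 0 \<le> p $ i \<and> p $ i < 1}"
  have S: "?S \<in> sets borel"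
    by measurable
  have "box 0 1 \<subseteq> ?S" "?S \<subseteq> cbox 0 1"
    by (auto simp: mem_box_cart less_imp_le)
  moreover have "emeasure lborel (box 0 (1::real^2)) = 1" "emeasure lborel (cbox 0 (1::real^2)) = 1"
    by (subst emeasure_lborel_box_eq emeasure_lborel_cbox_eq; auto simp: Basis_vec_def inner_axis prod.neutral)+
  ultimately have 1: "emeasure lborel ?S = 1"
    using S emeasure_mono[of "box 0 1" ?S lborel] emeasure_mono[of ?S "cbox 0 1" lborel]
    by (simp add: antisym)
  have "to_torus \<in> borel_measurable (restrict_space lborel ?S)"
    by (intro measurable_restrict_space1) (simp add: borel_measurable_continuous_onI continuous_on_to_torus)
  then have "emeasure torus_haar UNIV = emeasure (restrict_space lborel ?S) ?S"
    unfolding torus_haar_def by (simp add: emeasure_distr space_restrict_space)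
  also have "\<dots> = 1"
    using S 1 by (simp add: emeasure_restrict_space)
  finally show ?thesis .
qed

lift_definition torus_endo :: "int^2^2 \<Rightarrow> torus \<Rightarrow> torus" is
  "\<lambda>E p. (\<chi> i j. of_int (E $ i $ j)) *v p"
  unfolding torus_rel_def
proof
  fix E :: "int^2^2" and p q :: "real^2" and i :: 2
  assume *: "\<forall>i. p $ i - q $ i \<in> \<int>"
  have "((\<chi> i j. of_int (E $ i $ j)) *v p) $ i - ((\<chi> i j. of_int (E $ i $ j)) *v q) $ i
      = (\<Sum>j\<in>UNIV. of_int (E $ i $ j) * (p $ j - q $ j))"
    by (simp add: matrix_vector_mult_def sum_subtractf right_diff_distrib)
  also have "\<dots> \<in> \<int>"
    using * by (intro Ints_sum Ints_mult) auto
  finally show "((\<chi> i j. of_int (E $ i $ j)) *v p) $ i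
      - ((\<chi> i j. of_int (E $ i $ j)) *v q) $ i \<in> \<int>" .
qed

lemma torus_endo_to_torus:
  "torus_endo E (to_torus p) = to_torus ((\<chi> i j. of_int (E $ i $ j)) *v p)"
  unfolding to_torus_def by (rule torus_endo.abs_eq)

abbreviation torus_homotopic :: "(torus \<Rightarrow> torus) \<Rightarrow> (torus \<Rightarrow> torus) \<Rightarrow> bool" where
  "torus_homotopic \<equiv> homotopic_with_canon (\<lambda>_. True) UNIV UNIV"

definition homotopic_to_homothety :: "(torus \<Rightarrow> torus) \<Rightarrow> bool" where
  "homotopic_to_homothety F \<longleftrightarrow> (\<exists>k::int. torus_homotopic F (torus_endo (mat k)))"

text \<open>Every continuous self-map of the torus is homotopic to \<^term>\<open>torus_endo E\<close> for exactly one
  integer matrix \<^term>\<open>E\<close>.\<close>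

definition torus_linear_part :: "(torus \<Rightarrow> torus) \<Rightarrow> int^2^2" where
  "torus_linear_part F = (THE E. torus_homotopic F (torus_endo E))"

definition torus_degree :: "(torus \<Rightarrow> torus) \<Rightarrow> int" where
  "torus_degree F = \<bar>det (torus_linear_part F)\<bar>"

text \<open>The tangent bundle of the torus is identified with torus \<open>\<times>\<close> plane through the covering
  \<^term>\<open>to_torus\<close>, so derivatives are those of lifts to the plane.\<close>

definition torus_lift :: "(real^2 \<Rightarrow> real^2) \<Rightarrow> (torus \<Rightarrow> torus) \<Rightarrow> bool" where
  "torus_lift G F \<longleftrightarrow> continuous_on UNIV G \<and> (\<forall>p. to_torus (G p) = F (to_torus p))"

text \<open>In finite dimension, being \<open>C\<^sup>k\<^sup>+\<^sup>1\<close> is equivalent to being differentiable with every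
  directional derivative of class \<open>C\<^sup>k\<close>.\<close>

primrec C_k :: "nat \<Rightarrow> ('a::euclidean_space \<Rightarrow> 'b::real_normed_vector) \<Rightarrow> bool" where
  "C_k 0 G \<longleftrightarrow> continuous_on UNIV G"
| "C_k (Suc k) G \<longleftrightarrow> (\<forall>p. G differentiable (at p)) \<and>
     (\<forall>v. C_k k (\<lambda>p. frechet_derivative G (at p) v))"

definition torus_C_k :: "nat \<Rightarrow> (torus \<Rightarrow> torus) \<Rightarrow> bool" where
  "torus_C_k k F \<longleftrightarrow> (\<exists>G. torus_lift G F \<and> C_k k G)"

definition torus_smooth :: "(torus \<Rightarrow> torus) \<Rightarrow> bool" where
  "torus_smooth F \<longleftrightarrow> (\<exists>G. torus_lift G F \<and> (\<forall>k. C_k k G))"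

definition torus_has_derivative ::
    "(torus \<Rightarrow> torus) \<Rightarrow> (real^2 \<Rightarrow> real^2) \<Rightarrow> torus \<Rightarrow> bool" where
  "torus_has_derivative F A x \<longleftrightarrow>
     (\<exists>G p. torus_lift G F \<and> to_torus p = x \<and> (G has_derivative A) (at p))"

lemma torus_has_derivative_unique:
  assumes "torus_has_derivative F A x" and "torus_has_derivative F B x"
  shows "A = B"
proof -
  obtain G p where G: "torus_lift G F" "to_torus p = x" "(G has_derivative A) (at p)"
    using assms(1) unfolding torus_has_derivative_def by blast
  obtain H q where H: "torus_lift H F" "to_torus q = x" "(H has_derivative B) (at q)"
    using assms(2) unfolding torus_has_derivative_def by blast
  define m where "m = q - p"
  have m: "m $ i \<in> \<int>" for i
    using G(2) H(2) to_torus_eq_iff[of q p] by (simp add: m_def)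
  define D where "D = (\<lambda>r. H (m + r) - G r)"
  have cH: "continuous_on UNIV (\<lambda>r. H (m + r))"
    by (rule continuous_on_compose2[of UNIV H])
       (use H(1) in \<open>auto simp: torus_lift_def intro!: continuous_intros\<close>)
  have contD: "continuous_on UNIV D"
    unfolding D_def using cH G(1) by (auto simp: torus_lift_def intro!: continuous_intros)
  have intD: "D r $ i \<in> \<int>" for r i
  proof -
    have "to_torus (m + r) = to_torus r"
      using m by (simp add: to_torus_eq_iff)
    then have "to_torus (H (m + r)) = to_torus (G r)"
      using G(1) H(1) by (simp add: torus_lift_def)
    then show ?thesis
      by (simp add: to_torus_eq_iff D_def)
  qed
  have const: "(\<lambda>r. D r $ i) constant_on UNIV" for i
  proof (rule continuous_discrete_range_constant)
    show "connected (UNIV :: (real^2) set)"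
      by (simp add: convex_connected)
    show "continuous_on UNIV (\<lambda>r. D r $ i)"
      using contD by (intro continuous_intros)
    fix r :: "real^2"
    show "\<exists>e>0. \<forall>y. y \<in> UNIV \<and> D y $ i \<noteq> D r $ i \<longrightarrow> e \<le> norm (D y $ i - D r $ i)"
    proof (intro exI[of _ 1] conjI allI impI)
      fix y assume "y \<in> UNIV \<and> D y $ i \<noteq> D r $ i"
      moreover have "D y $ i - D r $ i \<in> \<int>" using intD by auto
      ultimately show "1 \<le> norm (D y $ i - D r $ i)"
        using Ints_nonzero_abs_ge1 by fastforce
    qed simp
  qed
  have "D r = D 0" for r
    using const unfolding constant_on_def vec_eq_iff by (metis UNIV_I)
  then have "H (m + r) = G r + D 0" for r
    unfolding D_def by (metis add.commute diff_add_cancel)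
  then have eq: "G = (\<lambda>r. H (m + r) - D 0)" by auto
  have "((\<lambda>r. m + r) has_derivative (\<lambda>h. h)) (at p)"
    by (auto intro!: derivative_eq_intros)
  moreover have "(H has_derivative B) (at (m + p))"
    using H(3) by (simp add: m_def)
  ultimately have "((\<lambda>r. H (m + r)) has_derivative B) (at p)"
    using has_derivative_compose[of "\<lambda>r. m + r" "\<lambda>h. h" p UNIV H B] by simp
  then have "(G has_derivative B) (at p)"
    unfolding eq by (auto intro!: derivative_eq_intros)
  then show ?thesis
    using G(3) has_derivative_unique by blast
qed

definition torus_deriv :: "(torus \<Rightarrow> torus) \<Rightarrow> torus \<Rightarrow> real^2 \<Rightarrow> real^2" where
  "torus_deriv F x = (THE A. torus_has_derivative F A x)"

definition uniformly_expanding :: "(torus \<Rightarrow> torus) \<Rightarrow> bool" where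
  "uniformly_expanding F \<longleftrightarrow>
     (\<exists>C>0. \<exists>\<kappa>>1. \<forall>n x v. norm (torus_deriv (F ^^ n) x v) \<ge> C * \<kappa> ^ n * norm v)"

definition conservative :: "(torus \<Rightarrow> torus) \<Rightarrow> bool" where
  "conservative f \<longleftrightarrow> f \<in> measurable torus_haar torus_haar \<and> distr torus_haar torus_haar f = torus_haar"

definition conorm :: "(real^2 \<Rightarrow> real^2) \<Rightarrow> real" where
  "conorm A = (INF v\<in>sphere 0 1. norm (A v))"

text \<open>The predicates express existence of the limits together with their values.  The convention
  \<^term>\<open>ln 0 = (0::real)\<close> is harmless for the negative exponent: if \<^term>\<open>conorm\<close> vanishes for
  infinitely many iterates, the limit (if any) is \<open>0\<close>, hence not negative.\<close>

definition upper_lyapunov_exponent :: "(torus \<Rightarrow> torus) \<Rightarrow> torus \<Rightarrow> real \<Rightarrow> bool" where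
  "upper_lyapunov_exponent f x c \<longleftrightarrow>
     ((\<lambda>n. ln (onorm (torus_deriv (f ^^ n) x)) / real n) \<longlonglongrightarrow> c)"

definition lower_lyapunov_exponent :: "(torus \<Rightarrow> torus) \<Rightarrow> torus \<Rightarrow> real \<Rightarrow> bool" where
  "lower_lyapunov_exponent f x c \<longleftrightarrow>
     ((\<lambda>n. ln (conorm (torus_deriv (f ^^ n) x)) / real n) \<longlonglongrightarrow> c)"

definition nonuniformly_hyperbolic :: "(torus \<Rightarrow> torus) \<Rightarrow> bool" where
  "nonuniformly_hyperbolic f \<longleftrightarrow>
     (AE x in torus_haar. \<exists>a b. lower_lyapunov_exponent f x a \<and>
        upper_lyapunov_exponent f x b \<and> a < 0 \<and> 0 < b)"

definition is_factor_of :: "(torus \<Rightarrow> torus) \<Rightarrow> (torus \<Rightarrow> torus) \<Rightarrow> bool" where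
  "is_factor_of F f \<longleftrightarrow> (\<exists>h. continuous_on UNIV h \<and> surj h \<and> h \<circ> f = F \<circ> h)"

end

theory Submission
  imports Defs
begin

text \<open>Let \<open>E\<close> be the linear part of \<open>F\<close>. As \<open>E\<close> is not scalar, it is similar over the rationals to
  the companion matrix \<open>A\<close> of its characteristic polynomial, through an integer matrix \<open>H\<close>. The map
  \<open>f (x, y) = (- d y, x + \<tau> y + K sin (2 \<pi> y) / (2 \<pi>))\<close>, with \<open>d = det E\<close> and \<open>\<tau>\<close> the trace of \<open>E\<close>, is a
  smooth conservative endomorphism with linear part \<open>A\<close> and Jacobian \<open>d\<close>. A lift \<open>G\<close> of the
  expanding map \<open>F\<close> is a homeomorphism of the plane whose iterated inverses contract, so
  \<open>G\<^sup>-\<^sup>n \<circ> H \<circ> f\<^sup>n\<close> converges to a semiconjugacy.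

  For the exponents, consider the vector \<open>(D f\<^sup>n)\<^sup>-\<^sup>1 v\<close> along a random backward orbit. The \<open>\<bar>d\<bar>\<close> preimages
  of a point have equidistributed second coordinates, and for at most two of them
  \<open>\<tau> + K cos (2 \<pi> y)\<close> nearly cancels the other term of the inverse derivative. If \<open>\<bar>d\<bar> > 16\<close> and \<open>K\<close> is
  large, a small negative moment of a suitable norm of this vector therefore contracts by a fixed
  factor at each step, and the vector grows exponentially almost surely. This makes the lower
  exponent negative; the upper one is positive because the Jacobian is \<open>d\<close>. The limits
  exist by the subadditive ergodic theorem.\<close>

subsection \<open>The subadditive ergodic theorem for bounded processes\<close>

text \<open>The bound 16 comes out of the moment estimate. With \<open>K = R^2\<close> and the norm
  \<open>wnorm R\<close>, a good preimage multiplies the norm by at least about \<open>R\<close>,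
  and a bad one divides it by at most about \<open>R^2\<close>. If
  \<open>R powr \<theta> = 2\<close>, the moments are multiplied by about 1/2 and by at most about
  4. At most two of the D preimages are bad, so the average contracts as soon as D/2 + 8 < D, that
  is, D > 16. The constants that do not grow with \<open>K\<close> become harmless when
  \<open>R\<close> is a high power of them.

  Since \<open>f\<close> is not invertible, there is no backward orbit to follow. The average over a
  fibre of \<open>f\<close> is instead realised on the torus itself: measure-preserving skew
  translations move each point within its fibre, so that D copies of one integral turn into the
  integral of a sum over the fibre.

  If the inverse images of one vector grow at rate \<alpha>, the adjugate of the derivative, and
  hence the derivative, grows at rate at least \<open>ln \<bar>d\<bar> + \<alpha>\<close>. As the
  two exponents add up to \<open>ln \<bar>d\<bar>\<close>, both signs follow at once.\<close>

definition seq_liminf :: "(nat \<Rightarrow> real) \<Rightarrow> real" where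
  "seq_liminf X = real_of_ereal (liminf (\<lambda>n. ereal (X n)))"

context
  fixes X :: "nat \<Rightarrow> real" and C :: real
  assumes X: "\<And>n. 0 \<le> X n" "\<And>n. X n \<le> C"
begin

text \<open>Boundedness keeps the lower limit finite, so \<open>real_of_ereal\<close> never falls
  back on its default value; the detour through \<open>ereal\<close> makes measurability
  automatic.\<close>

lemma ereal_seq_liminf: "ereal (seq_liminf X) = liminf (\<lambda>n. ereal (X n))"
proof -
  have "0 \<le> liminf (\<lambda>n. ereal (X n))"
    by (rule Liminf_bounded) (simp add: X)
  moreover have "liminf (\<lambda>n. ereal (X n)) \<le> ereal C"
    using Liminf_mono[of "\<lambda>n. ereal (X n)" "\<lambda>_. ereal C" sequentially]
    by (simp add: X Liminf_const)
  ultimately show ?thesis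
    unfolding seq_liminf_def by (intro ereal_real') auto
qed

lemma eventually_gt_seq_liminf: "c < seq_liminf X \<Longrightarrow> eventually (\<lambda>n. c < X n) sequentially"
  using le_Liminf_iff[of "ereal (seq_liminf X)" sequentially "\<lambda>n. ereal (X n)"]
  by (auto simp: ereal_seq_liminf[symmetric] dest: spec[of _ "ereal c"])

lemma seq_liminf_ge: "eventually (\<lambda>n. c \<le> X n) sequentially \<Longrightarrow> c \<le> seq_liminf X"
  using Liminf_bounded[of "ereal c" "\<lambda>n. ereal (X n)" sequentially]
  by (simp add: ereal_seq_liminf[symmetric])

lemma seq_liminf_nonneg: "0 \<le> seq_liminf X"
  by (rule seq_liminf_ge) (simp add: X)

lemma seq_liminf_le: "seq_liminf X \<le> C"
proof (rule ccontr)
  assume "\<not> ?thesis"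
  then have "eventually (\<lambda>n. C < X n) sequentially"
    by (intro eventually_gt_seq_liminf) simp
  then obtain n where "C < X n" using eventually_happens by force
  then show False using X(2)[of n] by simp
qed

end

lemma funpow_funpow: "(f ^^ n) ((f ^^ m) x) = (f ^^ (m + n)) x"
  by (metis add.commute comp_apply funpow_add)

lemma borel_measurable_seq_liminf [measurable]:
  assumes [measurable]: "\<And>n. X n \<in> borel_measurable M"
  shows "(\<lambda>x. seq_liminf (\<lambda>n. X n x)) \<in> borel_measurable M"
  unfolding seq_liminf_def by measurable

locale measure_preserving_map = finite_measure M for M :: "'a measure" +
  fixes T :: "'a \<Rightarrow> 'a"
  assumes T_meas [measurable]: "T \<in> measurable M M"
    and distr_T: "distr M M T = M"
begin

lemma space_T: "x \<in> space M \<Longrightarrow> T x \<in> space M"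
  using T_meas by (rule measurable_space)

lemma funpow_meas [measurable]: "T ^^ n \<in> measurable M M"
  by (induction n) (auto intro: measurable_comp[OF _ T_meas])

lemma space_funpow: "x \<in> space M \<Longrightarrow> (T ^^ n) x \<in> space M"
  using funpow_meas by (rule measurable_space)

lemma integral_T:
  fixes g :: "'a \<Rightarrow> real"
  assumes [measurable]: "g \<in> borel_measurable M"
  shows "integral\<^sup>L M (\<lambda>x. g (T x)) = integral\<^sup>L M g"
  using integral_distr[OF T_meas, of g] by (simp add: distr_T)

lemma integral_funpow:
  fixes g :: "'a \<Rightarrow> real"
  assumes [measurable]: "g \<in> borel_measurable M"
  shows "integral\<^sup>L M (\<lambda>x. g ((T ^^ n) x)) = integral\<^sup>L M g"
proof (induction n)
  case (Suc n)
  have "integral\<^sup>L M (\<lambda>x. g ((T ^^ n) (T x))) = integral\<^sup>L M (\<lambda>x. g ((T ^^ n) x))"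
    by (rule integral_T) measurable
  then show ?case using Suc by (simp add: funpow_swap1)
qed simp

lemma AE_T:
  assumes "AE x in M. P x"
  shows "AE x in M. P (T x)"
proof -
  have "AE x in distr M M T. P x" using assms by (subst distr_T)
  then show ?thesis by (rule AE_distrD[OF T_meas])
qed

lemma AE_funpow:
  assumes "AE x in M. P x"
  shows "AE x in M. \<forall>n. P ((T ^^ n) x)"
proof -
  have "AE x in M. P ((T ^^ n) x)" for n
  proof (induction n)
    case (Suc n)
    from AE_T[OF Suc] show ?case by (simp add: funpow_swap1)
  qed (simp add: assms)
  then show ?thesis by (simp add: AE_all_countable)
qed

end

locale subadditive_process = measure_preserving_map +
  fixes \<phi> :: "nat \<Rightarrow> 'a \<Rightarrow> real" and C :: real
  assumes \<phi>_meas [measurable]: "\<And>n. \<phi> n \<in> borel_measurable M"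
    and \<phi>_nonneg: "\<And>n x. x \<in> space M \<Longrightarrow> 0 \<le> \<phi> n x"
    and \<phi>_le: "\<And>n x. x \<in> space M \<Longrightarrow> \<phi> n x \<le> C * real n"
    and \<phi>_subadd: "\<And>m n x. x \<in> space M \<Longrightarrow> \<phi> (m + n) x \<le> \<phi> m x + \<phi> n ((T ^^ m) x)"
begin

lemma C_nonneg: "x \<in> space M \<Longrightarrow> 0 \<le> C"
  using \<phi>_nonneg[of x 1] \<phi>_le[of x 1] by simp

definition L :: "'a \<Rightarrow> real" where
  "L x = seq_liminf (\<lambda>n. \<phi> n x / real n)"

lemma L_meas [measurable]: "L \<in> borel_measurable M"
  unfolding L_def by measurable

lemma avg_nonneg: "x \<in> space M \<Longrightarrow> 0 \<le> \<phi> n x / real n"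
  by (simp add: \<phi>_nonneg)

lemma avg_le: "x \<in> space M \<Longrightarrow> \<phi> n x / real n \<le> C"
  using \<phi>_le[of x n] C_nonneg[of x] by (cases "n = 0") (simp_all add: divide_le_eq)

lemma L_nonneg: "x \<in> space M \<Longrightarrow> 0 \<le> L x"
  unfolding L_def by (rule seq_liminf_nonneg[of _ C]) (auto simp: avg_nonneg avg_le)

lemma L_le: "x \<in> space M \<Longrightarrow> L x \<le> C"
  unfolding L_def by (rule seq_liminf_le) (auto simp: avg_nonneg avg_le)

text \<open>Dropping the first step of an orbit segment costs at most \<open>C\<close>, which
  vanishes after division by the length.\<close>

lemma L_le_T: assumes x: "x \<in> space M" shows "L x \<le> L (T x)"
proof (rule field_le_epsilon)
  fix e :: real assume e: "0 < e"
  have "L x - e \<le> L (T x)"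
    unfolding L_def[of "T x"]
  proof (rule seq_liminf_ge[of _ C])
    have "eventually (\<lambda>n. L x - e/2 < \<phi> n x / real n) sequentially"
      using e by (intro eventually_gt_seq_liminf[of _ C])
        (auto simp: avg_nonneg avg_le x L_def)
    then have 1: "eventually (\<lambda>n. L x - e/2 < \<phi> (Suc n) x / real (Suc n)) sequentially"
      by (rule eventually_compose_filterlim) (rule filterlim_Suc)
    have "(\<lambda>n. C / real (Suc n)) \<longlonglongrightarrow> 0"
      by (rule LIMSEQ_Suc[OF lim_const_over_n])
    then have 2: "eventually (\<lambda>n. C / real (Suc n) < e/2) sequentially"
      using e by (intro order_tendstoD(2)[of _ 0]) auto
    show "eventually (\<lambda>n. L x - e \<le> \<phi> n (T x) / real n) sequentially"
      using 1 2 eventually_gt_at_top[of 0]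
    proof eventually_elim
      case (elim n)
      have "\<phi> (Suc n) x \<le> C + \<phi> n (T x)"
        using \<phi>_subadd[OF x, of 1 n] \<phi>_le[OF x, of 1] by simp
      then have "\<phi> (Suc n) x / real (Suc n) \<le> C / real (Suc n) + \<phi> n (T x) / real (Suc n)"
        by (simp add: add_divide_distrib[symmetric] divide_right_mono)
      also have "\<phi> n (T x) / real (Suc n) \<le> \<phi> n (T x) / real n"
        using elim(3) \<phi>_nonneg[OF space_T[OF x]] by (intro divide_left_mono) auto
      finally show ?case using elim by linarith
    qed
  qed (auto simp: avg_nonneg avg_le x space_T)
  then show "L x \<le> L (T x) + e" by simp
qed

lemma integrable_bounded:
  fixes g :: "'a \<Rightarrow> real"
  assumes "g \<in> borel_measurable M" "\<And>x. x \<in> space M \<Longrightarrow> 0 \<le> g x" "\<And>x. x \<in> space M \<Longrightarrow> g x \<le> B"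
  shows "integrable M g"
  by (rule integrable_const_bound[of _ B]) (use assms in auto)

lemma L_integrable: "integrable M L"
  by (rule integrable_bounded[of _ C]) (auto simp: L_nonneg L_le)

text \<open>\<open>L x \<le> L (T x)\<close> holds everywhere and both sides have the same integral,
  so the nonnegative difference vanishes almost everywhere.\<close>

lemma AE_L_invariant: "AE x in M. \<forall>n. L ((T ^^ n) x) = L x"
proof -
  have int: "integrable M (\<lambda>x. L (T x))"
    by (rule integrable_bounded[of _ C]) (auto simp: L_nonneg L_le space_T)
  have "(\<integral>x. L (T x) - L x \<partial>M) = 0"
    using integral_T[OF L_meas] int L_integrable by simp
  then have "AE x in M. L (T x) - L x = 0"
    using int L_integrable L_le_T
    by (subst (asm) integral_nonneg_eq_0_iff_AE) auto
  then have "AE x in M. \<forall>n. L (T ((T ^^ n) x)) = L ((T ^^ n) x)"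
    using AE_funpow[of "\<lambda>x. L (T x) = L x"] by auto
  then show ?thesis
  proof eventually_elim
    case (elim x)
    show ?case
    proof
      fix n show "L ((T ^^ n) x) = L x"
        by (induction n) (use elim in auto)
    qed
  qed
qed

text \<open>These sets decrease to the empty set as \<open>N\<close> grows, because some average
  always lies below \<open>L x + e\<close>. Only at visits to them does the greedy decomposition pay
  the full price \<open>C\<close>.\<close>

definition bad :: "real \<Rightarrow> nat \<Rightarrow> 'a set" where
  "bad e N = {x \<in> space M. \<forall>m\<in>{1..N}. real m * (L x + e) < \<phi> m x}"

lemma bad_meas [measurable]: "bad e N \<in> sets M"
  unfolding bad_def by measurable

lemma measure_bad_tendsto:
  assumes e: "e > 0" shows "(\<lambda>N. measure M (bad e N)) \<longlonglongrightarrow> 0"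
proof -
  have "(\<lambda>N. measure M (bad e N)) \<longlonglongrightarrow> measure M (\<Inter>N. bad e N)"
    by (rule finite_Lim_measure_decseq) (auto simp: decseq_def bad_def)
  moreover have "(\<Inter>N. bad e N) = {}"
  proof (rule ccontr)
    assume "\<not> ?thesis"
    then obtain x where x: "\<And>N. x \<in> bad e N" by auto
    have xs: "x \<in> space M" using x[of 0] by (auto simp: bad_def)
    have "real m * (L x + e) < \<phi> m x" if "m \<ge> 1" for m
      using x[of m] that by (auto simp: bad_def)
    then have "L x + e \<le> \<phi> m x / real m" if "m \<ge> 1" for m
      using that by (simp add: le_divide_eq mult.commute less_imp_le)
    then have "eventually (\<lambda>m. L x + e \<le> \<phi> m x / real m) sequentially"
      by (auto simp: eventually_sequentially)
    then have "L x + e \<le> L x"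
      unfolding L_def[of x] by (rule seq_liminf_ge[of _ C, rotated 2]) (auto simp: avg_nonneg avg_le xs)
    then show False using e by simp
  qed
  ultimately show ?thesis by simp
qed

text \<open>Greedy decomposition of an orbit segment: blocks of length at most \<open>N\<close> on which the average
  is nearly optimal, single steps at bad times, and an incomplete last block.\<close>

lemma greedy_bound:
  assumes e: "e > 0" and x: "x \<in> space M" and inv: "\<And>k. L ((T ^^ k) x) = l"
  shows "\<phi> n x \<le> real n * (l + e) + C * (\<Sum>k<n. indicator (bad e N) ((T ^^ k) x)) + C * real N"
  using x inv
proof (induction n arbitrary: x rule: less_induct)
  case (less n x)
  note xs = less.prems(1)
  have C: "0 \<le> C" using C_nonneg xs .
  have Lx: "L x = l" using less.prems(2)[of 0] by simp
  have l: "0 \<le> l" using L_nonneg[OF xs] Lx by simp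
  let ?S = "\<lambda>n x. \<Sum>k<n. indicator (bad e N) ((T ^^ k) x) :: real"
  have S: "0 \<le> ?S n x" for n x by (simp add: sum_nonneg)
  have S_add: "?S (m + j) x = ?S m x + ?S j ((T ^^ m) x)" for m j
    by (induction j) (simp_all add: funpow_funpow)
  consider "n \<le> N" | "n > N" "x \<in> bad e N" | "n > N" "x \<notin> bad e N" by linarith
  then show ?case
  proof cases
    case 1
    have "\<phi> n x \<le> C * real n" using \<phi>_le xs .
    also have "\<dots> \<le> C * real N" using 1 C by (simp add: mult_left_mono)
    finally show ?thesis using S[where n=n and x=x] C l e by (simp add: add_increasing)
  next
    case 2
    then obtain j where n: "n = Suc j" by (cases n) auto
    have "\<phi> n x \<le> C + \<phi> j (T x)"
      using \<phi>_subadd[OF xs, of 1 j] \<phi>_le[OF xs, of 1] by (simp add: n)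
    also have "\<phi> j (T x) \<le> real j * (l + e) + C * ?S j (T x) + C * real N"
      by (rule less.IH) (use n less.prems(2)[of "Suc _"] space_T[OF xs] in \<open>auto simp: funpow_swap1\<close>)
    also have "C + (real j * (l + e) + C * ?S j (T x) + C * real N)
       \<le> real n * (l + e) + C * ?S n x + C * real N"
      using S_add[of 1 j] 2 l e by (simp add: n algebra_simps)
    finally show ?thesis by simp
  next
    case 3
    then obtain m where m: "1 \<le> m" "m \<le> N" "\<phi> m x \<le> real m * (l + e)"
      using xs Lx by (auto simp: bad_def not_less)
    define j where "j = n - m"
    have n: "n = m + j" using m 3 by (simp add: j_def)
    have "\<phi> n x \<le> \<phi> m x + \<phi> j ((T ^^ m) x)"
      using \<phi>_subadd[OF xs] by (simp add: n)
    also have "\<phi> j ((T ^^ m) x) \<le> real j * (l + e) + C * ?S j ((T ^^ m) x) + C * real N"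
    proof (rule less.IH)
      show "j < n" using n m by simp
      show "(T ^^ m) x \<in> space M" using xs by (rule space_funpow)
      show "L ((T ^^ k) ((T ^^ m) x)) = l" for k
        using less.prems(2)[of "k + m"] by (simp add: funpow_add)
    qed
    also have "\<phi> m x + (real j * (l + e) + C * ?S j ((T ^^ m) x) + C * real N)
       \<le> real n * (l + e) + C * ?S n x + C * real N"
    proof -
      have "C * ?S j ((T ^^ m) x) \<le> C * ?S n x"
        using S_add[of m j] S[where n=m and x=x] C by (intro mult_left_mono) (auto simp: n)
      then show ?thesis using m(3) by (simp add: n algebra_simps)
    qed
    finally show ?thesis by simp
  qed
qed

text \<open>The greedy bound is integrated and divided by \<open>n\<close>; then \<open>n\<close>
  and \<open>N\<close> tend to infinity and \<open>e\<close> to 0, in this order. Applied below to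
  an additive process, this takes the place of Birkhoff's theorem.\<close>

lemma integral_L_ge:
  assumes c: "\<And>n. real n * c \<le> (\<integral>x. \<phi> n x \<partial>M)"
  shows "c \<le> (\<integral>x. L x \<partial>M)"
proof -
  let ?\<mu> = "measure M (space M)"
  have main: "c \<le> (\<integral>x. L x \<partial>M) + e * ?\<mu>" if e: "e > 0" for e
  proof -
    have bound: "c \<le> (\<integral>x. L x \<partial>M) + e * ?\<mu> + C * measure M (bad e N)" for N
    proof -
      have *: "c \<le> (\<integral>x. L x \<partial>M) + e * ?\<mu> + C * measure M (bad e N) + C * real N * ?\<mu> / real n" if n: "n > 0" for n
      proof -
        have int: "integrable M (\<lambda>x. indicator (bad e N) ((T ^^ k) x) :: real)" for k
          by (rule integrable_bounded[of _ 1]) (auto split: split_indicator)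
        have ib: "(\<integral>x. indicator (bad e N) ((T ^^ k) x) \<partial>M) = measure M (bad e N)" for k
          using integral_funpow[of "indicator (bad e N)" k] sets.sets_into_space[OF bad_meas]
          by (simp add: Int_absorb2)
        have "real n * c \<le> (\<integral>x. \<phi> n x \<partial>M)" by (rule c)
        also have "\<dots> \<le> (\<integral>x. real n * (L x + e) + C * (\<Sum>k<n. indicator (bad e N) ((T ^^ k) x)) + C * real N \<partial>M)"
        proof (rule integral_mono_AE)
          show "integrable M (\<phi> n)"
            by (rule integrable_bounded[of _ "C * real n"]) (auto simp: \<phi>_nonneg \<phi>_le)
          show "integrable M (\<lambda>x. real n * (L x + e) + C * (\<Sum>k<n. indicator (bad e N) ((T ^^ k) x)) + C * real N)"
            using L_integrable int by auto
          show "AE x in M. \<phi> n x \<le> real n * (L x + e) + C * (\<Sum>k<n. indicator (bad e N) ((T ^^ k) x)) + C * real N"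
            using AE_L_invariant AE_space
            by eventually_elim (rule greedy_bound, use e in auto)
        qed
        also have "\<dots> = real n * ((\<integral>x. L x \<partial>M) + e * ?\<mu>) + C * (real n * measure M (bad e N)) + C * real N * ?\<mu>"
          using L_integrable int ib by simp
        also have "\<dots> = real n * ((\<integral>x. L x \<partial>M) + e * ?\<mu> + C * measure M (bad e N) + C * real N * ?\<mu> / real n)"
          using n by (simp add: field_simps)
        finally show ?thesis using n by simp
      qed
      have "(\<lambda>n. (\<integral>x. L x \<partial>M) + e * ?\<mu> + C * measure M (bad e N) + C * real N * ?\<mu> / real n) \<longlonglongrightarrow>
          (\<integral>x. L x \<partial>M) + e * ?\<mu> + C * measure M (bad e N) + 0"
        by (intro tendsto_intros lim_const_over_n)
      then show ?thesis
        by (intro tendsto_lowerbound[where F=sequentially, of _ _ c])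
          (auto simp: eventually_sequentially intro!: exI[of _ 1] *)
    qed
    have "(\<lambda>N. (\<integral>x. L x \<partial>M) + e * ?\<mu> + C * measure M (bad e N)) \<longlonglongrightarrow> (\<integral>x. L x \<partial>M) + e * ?\<mu> + C * 0"
      by (intro tendsto_intros measure_bad_tendsto e)
    then show ?thesis
      by (intro tendsto_lowerbound[where F=sequentially, of _ _ c]) (auto intro!: bound always_eventually)
  qed
  have "((\<lambda>e. (\<integral>x. L x \<partial>M) + e * ?\<mu>) \<longlongrightarrow> (\<integral>x. L x \<partial>M) + 0 * ?\<mu>) (at_right 0)"
    by (intro tendsto_intros)
  then have "((\<lambda>e. (\<integral>x. L x \<partial>M) + e * ?\<mu>) \<longlongrightarrow> (\<integral>x. L x \<partial>M)) (at_right 0)" by simp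
  then show ?thesis
    by (rule tendsto_lowerbound) (auto simp: eventually_at_right_field intro!: main exI[of _ 1])
qed

end

section \<open>Frequency of visits to a set\<close>

context measure_preserving_map
begin

definition visits :: "'a set \<Rightarrow> nat \<Rightarrow> 'a \<Rightarrow> real" where
  "visits B n x = (\<Sum>k<n. indicator B ((T ^^ k) x))"

lemma visits_add: "visits B (m + n) x = visits B m x + visits B n ((T ^^ m) x)"
  unfolding visits_def
  by (induction n) (simp_all add: funpow_funpow)

lemma visits_meas [measurable]: "B \<in> sets M \<Longrightarrow> visits B n \<in> borel_measurable M"
  unfolding visits_def[abs_def]
  by (intro borel_measurable_sum measurable_compose[OF funpow_meas] borel_measurable_indicator)

lemma visits_nonneg: "0 \<le> visits B n x"
  unfolding visits_def by (simp add: sum_nonneg)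

lemma visits_le: "visits B n x \<le> real n"
  unfolding visits_def using sum_mono[of "{..<n}" "\<lambda>k. indicator B ((T ^^ k) x)" "\<lambda>_. 1::real"]
  by (simp add: indicator_def)

text \<open>The maximal-type inequality is obtained by applying the lower bound for the integral of the
  lower limit to visits of the complement.\<close>

lemma integral_liminf_non_visits:
  assumes B[measurable]: "B \<in> sets M"
  defines "V \<equiv> \<lambda>x. seq_liminf (\<lambda>n. (real n - visits B n x) / real n)"
  shows "V \<in> borel_measurable M" "\<And>x. x \<in> space M \<Longrightarrow> 0 \<le> V x \<and> V x \<le> 1"
    "measure M (space M) - measure M B \<le> (\<integral>x. V x \<partial>M)"
proof -
  interpret A: subadditive_process M T "\<lambda>n x. real n - visits B n x" 1
    by unfold_locales (auto simp: visits_add visits_le visits_nonneg)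
  have V: "V = A.L" unfolding V_def A.L_def ..
  show "V \<in> borel_measurable M" "\<And>x. x \<in> space M \<Longrightarrow> 0 \<le> V x \<and> V x \<le> 1"
    by (auto simp: V A.L_nonneg A.L_le)
  show "measure M (space M) - measure M B \<le> (\<integral>x. V x \<partial>M)"
    unfolding V
  proof (rule A.integral_L_ge)
    fix n
    have int: "integrable M (\<lambda>x. indicator B ((T ^^ k) x) :: real)" for k
      by (rule A.integrable_bounded[of _ 1]) (auto split: split_indicator)
    have ib: "(\<integral>x. indicator B ((T ^^ k) x) \<partial>M) = measure M B" for k
      using integral_funpow[of "indicator B" k] sets.sets_into_space[OF B]
      by (simp add: Int_absorb2)
    show "real n * (measure M (space M) - measure M B) \<le> (\<integral>x. real n - visits B n x \<partial>M)"
      unfolding visits_def using int ib by (simp add: algebra_simps)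
  qed
qed

end

text \<open>By \<open>greedy_bound\<close> the upper limit exceeds \<open>L\<close> by at most
  \<open>e\<close> plus \<open>C\<close> times the upper frequency of visits to
  \<open>bad e N\<close>. The mean of that frequency is at most the measure of
  \<open>bad e N\<close>, which tends to 0 as \<open>N\<close> grows. Hence the upper and the lower
  limit have the same integral.\<close>

theorem (in subadditive_process) AE_convergent_average:
  "AE x in M. (\<lambda>n. \<phi> n x / real n) \<longlonglongrightarrow> L x"
proof -
  text \<open>The upper limit, written as a lower limit of the nonnegative sequence \<open>C - \<phi> n x / n\<close>.\<close>
  define U where "U = (\<lambda>x. C - seq_liminf (\<lambda>n. C - \<phi> n x / real n))"
  have Umeas[measurable]: "U \<in> borel_measurable M"
    unfolding U_def by measurable
  have U: "0 \<le> U x" "U x \<le> C" "L x \<le> U x" if x: "x \<in> space M" for x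
  proof -
    show "0 \<le> U x" "U x \<le> C"
      unfolding U_def using seq_liminf_nonneg[of "\<lambda>n. C - \<phi> n x / real n" C]
        seq_liminf_le[of "\<lambda>n. C - \<phi> n x / real n" C] avg_nonneg[OF x] avg_le[OF x] by auto
    show "L x \<le> U x"
    proof (rule ccontr)
      assume "\<not> ?thesis"
      then obtain c where c: "U x < c" "c < L x" using dense[of "U x" "L x"] by auto
      have "eventually (\<lambda>n. c < \<phi> n x / real n) sequentially"
        using c by (intro eventually_gt_seq_liminf[of _ C]) (auto simp: avg_nonneg avg_le x L_def)
      moreover have "eventually (\<lambda>n. C - c < C - \<phi> n x / real n) sequentially"
        using c by (intro eventually_gt_seq_liminf[of _ C]) (auto simp: avg_nonneg avg_le x U_def)
      ultimately have "eventually (\<lambda>n. False) sequentially" by eventually_elim auto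
      then show False by simp
    qed
  qed
  have Uint: "integrable M U"
    by (rule integrable_bounded[of _ C]) (use U in auto)
  let ?\<mu> = "measure M (space M)"
  have main: "(\<integral>x. U x - L x \<partial>M) \<le> e * ?\<mu>" if e: "e > 0" for e
  proof -
    have bound: "(\<integral>x. U x - L x \<partial>M) \<le> e * ?\<mu> + C * measure M (bad e N)" for N
    proof -
      define V where "V = (\<lambda>x. seq_liminf (\<lambda>n. (real n - visits (bad e N) n x) / real n))"
      have V: "V \<in> borel_measurable M" "\<And>x. x \<in> space M \<Longrightarrow> 0 \<le> V x \<and> V x \<le> 1"
        "?\<mu> - measure M (bad e N) \<le> (\<integral>x. V x \<partial>M)"
        unfolding V_def using integral_liminf_non_visits[OF bad_meas[of e N]] by auto
      have Vint: "integrable M V"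
        by (rule integrable_bounded[of _ 1]) (use V in auto)
      have "(\<integral>x. U x - L x \<partial>M) \<le> (\<integral>x. e + C * (1 - V x) \<partial>M)"
      proof (rule integral_mono_AE)
        show "integrable M (\<lambda>x. U x - L x)" "integrable M (\<lambda>x. e + C * (1 - V x))"
          using Uint L_integrable Vint by auto
        show "AE x in M. U x - L x \<le> e + C * (1 - V x)"
          using AE_L_invariant AE_space
        proof eventually_elim
          case (elim x)
          then have x: "x \<in> space M" and inv: "\<And>k. L ((T ^^ k) x) = L x" by auto
          have C: "0 \<le> C" using C_nonneg x .
          show ?case
          proof (rule field_le_epsilon)
            fix d0 :: real assume d0: "0 < d0"
            define d where "d = d0 / 2"
            have d: "0 < d" using d0 by (simp add: d_def)
            \<comment> \<open>An error \<open>d'\<close> in the visit frequency costs at most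
              \<open>d\<close> after multiplication by \<open>C\<close>; the summand 1 avoids
              division by 0.\<close>
            define d' where "d' = d / (C + 1)"
            have d': "d' > 0" "C * d' \<le> d" using d C by (auto simp: d'_def field_simps)
            have 1: "eventually (\<lambda>n. V x - d' < (real n - visits (bad e N) n x) / real n) sequentially"
              using d' unfolding V_def
              by (intro eventually_gt_seq_liminf[of _ 1])
                (auto simp: visits_le visits_nonneg divide_le_eq)
            have 2: "eventually (\<lambda>n. C * real N / real n < d) sequentially"
              using lim_const_over_n[of "C * real N"] d by (intro order_tendstoD(2)[of _ 0]) auto
            have "C - (L x + e + C * (1 - V x) + 2 * d) \<le> seq_liminf (\<lambda>n. C - \<phi> n x / real n)"
            proof (rule seq_liminf_ge[of _ C])
              show "eventually (\<lambda>n. C - (L x + e + C * (1 - V x) + 2 * d) \<le> C - \<phi> n x / real n) sequentially"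
                using 1 2 eventually_gt_at_top[of 0]
              proof eventually_elim
                case (elim n)
                have vn: "visits (bad e N) n x / real n \<le> 1 - V x + d'"
                  using elim(1,3) by (simp add: diff_divide_distrib)
                have "\<phi> n x \<le> real n * (L x + e) + C * visits (bad e N) n x + C * real N"
                  using greedy_bound[OF e x, of "L x" n N] inv by (simp add: visits_def)
                then have "\<phi> n x / real n \<le> (L x + e) + C * (visits (bad e N) n x / real n) + C * real N / real n"
                  using elim(3) by (simp add: field_simps)
                also have "\<dots> \<le> (L x + e) + C * (1 - V x + d') + d"
                  using mult_left_mono[OF vn C] elim(2) by linarith
                finally show ?case using d'(2) by (simp add: algebra_simps)
              qed
            qed (auto simp: avg_nonneg avg_le x)
            then have "U x - L x \<le> e + C * (1 - V x) + 2 * d"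
              unfolding U_def by linarith
            then show "U x - L x \<le> e + C * (1 - V x) + d0" by (simp add: d_def)
          qed
        qed
      qed
      also have "\<dots> = e * ?\<mu> + C * (?\<mu> - (\<integral>x. V x \<partial>M))"
        using Vint by simp
      also have "\<dots> \<le> e * ?\<mu> + C * measure M (bad e N)"
      \<comment> \<open>The sign of \<open>C\<close> is known only once the space has a
        point.\<close>
      proof (cases "space M = {}")
        case True
        then show ?thesis using V(3) by (simp add: Bochner_Integration.integral_empty bad_def)
      next
        case False
        then have "0 \<le> C" using C_nonneg by auto
        then show ?thesis using V(3) by (intro add_left_mono mult_left_mono) auto
      qed
      finally show ?thesis .
    qed
    have "(\<lambda>N. e * ?\<mu> + C * measure M (bad e N)) \<longlonglongrightarrow> e * ?\<mu> + C * 0"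
      by (intro tendsto_intros measure_bad_tendsto e)
    then show ?thesis
      by (intro tendsto_lowerbound[where F=sequentially]) (auto intro!: bound always_eventually)
  qed
  have "((\<lambda>e. e * ?\<mu>) \<longlongrightarrow> 0 * ?\<mu>) (at_right 0)"
    by (intro tendsto_intros)
  then have "((\<lambda>e. e * ?\<mu>) \<longlongrightarrow> 0) (at_right 0)" by simp
  then have "(\<integral>x. U x - L x \<partial>M) \<le> 0"
    by (rule tendsto_lowerbound) (auto simp: eventually_at_right_field intro!: main exI[of _ 1])
  moreover have "0 \<le> (\<integral>x. U x - L x \<partial>M)"
    using U by (intro integral_nonneg_AE) auto
  ultimately have "(\<integral>x. U x - L x \<partial>M) = 0" by simp
  then have "AE x in M. U x - L x = 0"
    using Uint L_integrable U by (subst (asm) integral_nonneg_eq_0_iff_AE) auto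
  then show ?thesis
    using AE_space
  proof eventually_elim
    case (elim x)
    then have x: "x \<in> space M" and eq: "U x = L x" by auto
    show ?case
    proof (rule order_tendstoI)
      fix a assume "a < L x"
      then show "eventually (\<lambda>n. a < \<phi> n x / real n) sequentially"
        by (intro eventually_gt_seq_liminf[of _ C]) (auto simp: avg_nonneg avg_le x L_def)
    next
      fix a assume "L x < a"
      then have "eventually (\<lambda>n. C - a < C - \<phi> n x / real n) sequentially"
        using eq by (intro eventually_gt_seq_liminf[of _ C]) (auto simp: avg_nonneg avg_le x U_def)
      then show "eventually (\<lambda>n. \<phi> n x / real n < a) sequentially"
        by eventually_elim auto
    qed
  qed
qed

subsection \<open>Lifts, homotopies and linear parts\<close>

definition int_vec :: "real^2 \<Rightarrow> bool" where
  "int_vec m \<longleftrightarrow> (\<forall>i. m $ i \<in> \<int>)"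

abbreviation rmat :: "int^2^2 \<Rightarrow> real^2^2" where
  "rmat E \<equiv> \<chi> i j. of_int (E $ i $ j)"

lemma int_vec_add [intro]: "int_vec a \<Longrightarrow> int_vec b \<Longrightarrow> int_vec (a + b)"
  and int_vec_diff [intro]: "int_vec a \<Longrightarrow> int_vec b \<Longrightarrow> int_vec (a - b)"
  by (auto simp: int_vec_def)

lemma int_vec_axis [simp]: "int_vec (axis j (of_int k))"
  by (simp add: int_vec_def axis_def)

lemma int_vec_rmat [intro]: "int_vec m \<Longrightarrow> int_vec (rmat E *v m)"
  by (auto simp: int_vec_def matrix_vector_mult_def intro!: Ints_sum Ints_mult)

lemma to_torus_eq: "to_torus p = to_torus q \<longleftrightarrow> int_vec (p - q)"
  by (simp add: to_torus_eq_iff int_vec_def)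

lemma to_torus_add_int [simp]: "int_vec m \<Longrightarrow> to_torus (p + m) = to_torus p"
  by (simp add: to_torus_eq)

lemma obtain_to_torus: obtains p where "x = to_torus p"
  using surj_to_torus by (metis surjD)

lemma to_torus_rep [simp]: "to_torus (rep_torus x) = x"
  unfolding to_torus_def by (metis Quotient3_abs_rep Quotient3_torus)

lemma vec2_axis: "p = axis 1 (p $ 1) + axis 2 (p $ 2)" for p :: "'a::monoid_add^2"
  by (simp add: vec_eq_iff forall_2 axis_def)

lemma int_valued_constant:
  fixes D :: "'a::real_normed_vector \<Rightarrow> real^2"
  assumes "continuous_on UNIV D" "\<And>p. int_vec (D p)"
  shows "D p = D q"
proof -
  have "(\<lambda>r. D r $ i) constant_on UNIV" for i
  proof (rule continuous_discrete_range_constant)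
    show "connected (UNIV :: 'a set)"
      by (simp add: convex_connected)
    show "continuous_on UNIV (\<lambda>r. D r $ i)"
      using assms(1) by (intro continuous_intros)
    fix r :: 'a
    show "\<exists>e>0. \<forall>y. y \<in> UNIV \<and> D y $ i \<noteq> D r $ i \<longrightarrow> e \<le> norm (D y $ i - D r $ i)"
    proof (intro exI[of _ 1] conjI allI impI)
      fix y assume "y \<in> UNIV \<and> D y $ i \<noteq> D r $ i"
      moreover have "D y $ i - D r $ i \<in> \<int>" using assms(2) by (auto simp: int_vec_def)
      ultimately show "1 \<le> norm (D y $ i - D r $ i)"
        using Ints_nonzero_abs_ge1 by fastforce
    qed simp
  qed
  then show ?thesis
    unfolding constant_on_def vec_eq_iff by (metis UNIV_I)
qed

text \<open>The lattice form of having linear part \<open>E\<close>: every lift satisfies it for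
  some \<open>E\<close> (\<open>torus_lift_equivariant\<close>), this \<open>E\<close> is the linear
  part of the torus map (\<open>torus_linear_part_eq\<close>), and for a continuous map it is enough
  to descend to the torus (\<open>equivariant_lift\<close>).\<close>

definition equivariant :: "int^2^2 \<Rightarrow> (real^2 \<Rightarrow> real^2) \<Rightarrow> bool" where
  "equivariant E G \<longleftrightarrow> (\<forall>p m. int_vec m \<longrightarrow> G (p + m) = G p + rmat E *v m)"

lemma equivariantD: "equivariant E G \<Longrightarrow> int_vec m \<Longrightarrow> G (p + m) = G p + rmat E *v m"
  by (simp add: equivariant_def)

lemma additive_int:
  fixes c :: "int \<Rightarrow> 'a::real_vector"
  assumes "\<And>a b. c (a + b) = c a + c b"
  shows "c k = of_int k *\<^sub>R c 1"
proof (induction k rule: int_induct[where k = 0])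
  case base
  show ?case using assms[of 0 0] by simp
next
  case (step1 i)
  then show ?case using assms[of i 1] by (simp add: scaleR_add_left)
next
  case (step2 i)
  then show ?case using assms[of "i - 1" 1] by (simp add: scaleR_diff_left algebra_simps)
qed

text \<open>The displacement \<open>G (p + m) - G p\<close> is continuous and integer valued in
  \<open>p\<close>, hence independent of \<open>p\<close>. It is then additive in \<open>m\<close>,
  and its values on the unit vectors are the columns of \<open>E\<close>.\<close>

lemma torus_lift_equivariant:
  assumes "torus_lift G F"
  obtains E where "equivariant E G"
proof -
  have G: "continuous_on UNIV G" "\<And>p. to_torus (G p) = F (to_torus p)"
    using assms by (auto simp: torus_lift_def)
  define c where "c m = G m - G 0" for m
  have c: "int_vec (c m)" "G (p + m) = G p + c m" if m: "int_vec m" for m p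
  proof -
    have iv: "int_vec (G (q + m) - G q)" for q
      using G(2)[of "q + m"] G(2)[of q] m by (simp flip: to_torus_eq)
    have cont: "continuous_on UNIV (\<lambda>q. G (q + m) - G q)"
      by (intro continuous_intros continuous_on_compose2[OF G(1)]) auto
    have "G (p + m) - G p = G (0 + m) - G 0"
      by (rule int_valued_constant[OF cont iv])
    then show "G (p + m) = G p + c m" by (simp add: c_def algebra_simps)
    show "int_vec (c m)" using iv[of 0] by (simp add: c_def)
  qed
  have cadd: "c (m + n) = c m + c n" if "int_vec m" "int_vec n" for m n
    using c(2)[OF that(2), of m] by (simp add: c_def)
  have caxis: "c (axis j (of_int k)) = of_int k *\<^sub>R c (axis j 1)" for j :: 2 and k
  proof -
    have "c (axis j (of_int (a + b))) = c (axis j (of_int a)) + c (axis j (of_int b))" for a b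
    proof -
      have "axis j (of_int (a + b)) = axis j (of_int a) + (axis j (of_int b) :: real^2)"
        by (simp add: axis_def vec_eq_iff)
      then show ?thesis by (simp only: cadd int_vec_axis)
    qed
    then have "c (axis j (of_int k)) = of_int k *\<^sub>R c (axis j (of_int 1))"
      by (rule additive_int)
    then show ?thesis by simp
  qed
  define E where "E = (\<chi> i j. \<lfloor>c (axis j 1) $ i\<rfloor>)"
  have E: "of_int (E $ i $ j) = c (axis j 1) $ i" for i j
    using c(1)[of "axis j 1"] int_vec_axis[of j 1] by (auto simp: E_def int_vec_def)
  have "equivariant E G"
    unfolding equivariant_def
  proof (intro allI impI)
    fix p m :: "real^2" assume m: "int_vec m"
    define k where "k i = \<lfloor>m $ i\<rfloor>" for i
    have k: "m $ i = of_int (k i)" for i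
      using m by (auto simp: int_vec_def k_def)
    have "c m = c (axis 1 (of_int (k 1)) + axis 2 (of_int (k 2)))"
      using vec2_axis[of m] by (simp add: k)
    also have "\<dots> = of_int (k 1) *\<^sub>R c (axis 1 1) + of_int (k 2) *\<^sub>R c (axis 2 1)"
      by (simp add: cadd caxis)
    also have "\<dots> = rmat E *v m"
      by (simp add: vec_eq_iff matrix_vector_mult_def sum_2 E k mult.commute)
    finally show "G (p + m) = G p + rmat E *v m" using c(2)[OF m] by simp
  qed
  then show thesis by (rule that)
qed

lemma equivariant_lift:
  assumes "equivariant E g" "continuous_on UNIV g"
  obtains f where "torus_lift g f"
proof
  show "torus_lift g (\<lambda>x. to_torus (g (rep_torus x)))"
    unfolding torus_lift_def
  proof (intro conjI allI assms)
    fix p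
    define m where "m = rep_torus (to_torus p) - p"
    have "int_vec m" unfolding m_def by (simp flip: to_torus_eq)
    then have "g (p + m) = g p + rmat E *v m" "int_vec (rmat E *v m)"
      using assms by (auto simp: equivariant_def)
    then have "to_torus (g (p + m)) = to_torus (g p)" by simp
    then show "to_torus (g p) = to_torus (g (rep_torus (to_torus p)))" by (simp add: m_def)
  qed
qed

section \<open>Topology of the quotient and homotopies\<close>

lemma open_to_torus_image:
  assumes "open U" shows "open (to_torus ` U)"
proof -
  have "to_torus -` (to_torus ` U) = (\<Union>m\<in>{m. int_vec m}. (\<lambda>p. p + m) ` U)"
  proof (intro set_eqI iffI)
    fix p assume "p \<in> to_torus -` (to_torus ` U)"
    then obtain u where "u \<in> U" "int_vec (p - u)" by (auto simp: to_torus_eq)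
    then show "p \<in> (\<Union>m\<in>{m. int_vec m}. (\<lambda>p. p + m) ` U)"
      by (intro UN_I[of "p - u"] image_eqI[of _ _ u]) auto
  qed auto
  moreover have "open ((\<lambda>p. p + m) ` U)" for m
    using open_translation[OF assms, of m] by (simp add: add.commute)
  ultimately show ?thesis by (auto simp: open_torus_def)
qed

lemma continuous_on_from_torus:
  assumes "continuous_on UNIV (\<lambda>p. f (to_torus p))"
  shows "continuous_on UNIV f"
  using assms by (simp add: continuous_on_open_vimage open_torus_def vimage_def)

lemma torus_lift_continuous: "torus_lift G F \<Longrightarrow> continuous_on UNIV F"
  using continuous_on_compose2[OF continuous_on_to_torus, of UNIV G]
  by (intro continuous_on_from_torus) (simp add: torus_lift_def)

text \<open>The product of a quotient map with an identity need not be a quotient map in general;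
  here it is one because \<open>to_torus\<close> is open. Homotopies given by lifts descend in this
  way.\<close>

lemma continuous_on_from_cylinder:
  fixes h :: "real \<times> torus \<Rightarrow> 'b::topological_space"
  assumes "continuous_on UNIV (\<lambda>(t, p). h (t, to_torus p))"
  shows "continuous_on UNIV h"
  unfolding continuous_on_open_vimage[OF open_UNIV]
proof (intro allI impI)
  fix W :: "'b set" assume W: "open W"
  let ?q = "\<lambda>(t::real, p). (t, to_torus p)"
  let ?K = "(\<lambda>(t, p). h (t, to_torus p)) -` W"
  have K: "open ?K"
    using assms W by (simp add: continuous_on_open_vimage)
  have "h -` W \<inter> UNIV = ?q ` ?K"
  proof (intro set_eqI iffI)
    fix z assume z: "z \<in> h -` W \<inter> UNIV"
    obtain t x where tx: "z = (t, x)" by (cases z)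
    obtain p where p: "x = to_torus p" by (rule obtain_to_torus)
    show "z \<in> ?q ` ?K" using z by (intro image_eqI[of _ _ "(t, p)"]) (auto simp: tx p)
  qed auto
  moreover have "open (?q ` ?K)"
  proof (rule topological_space_class.openI)
    fix z assume "z \<in> ?q ` ?K"
    then obtain t p where tp: "(t, p) \<in> ?K" "z = (t, to_torus p)" by auto
    obtain A B where AB: "open A" "open B" "(t, p) \<in> A \<times> B" "A \<times> B \<subseteq> ?K"
      using K tp(1) by (rule open_prod_elim)
    have "open (A \<times> to_torus ` B)"
      using AB by (intro open_Times open_to_torus_image)
    moreover have "z \<in> A \<times> to_torus ` B" using AB tp by auto
    moreover have "A \<times> to_torus ` B \<subseteq> ?q ` ?K"
    proof
      fix y assume "y \<in> A \<times> to_torus ` B"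
      then obtain a b where ab: "y = (a, to_torus b)" "(a, b) \<in> A \<times> B" by blast
      from AB(4) ab(2) have "(a, b) \<in> ?K" by (rule subsetD)
      then show "y \<in> ?q ` ?K" by (rule image_eqI[rotated]) (simp add: ab(1))
    qed
    ultimately show "\<exists>T. open T \<and> z \<in> T \<and> T \<subseteq> ?q ` ?K"
      by (intro exI[of _ "A \<times> to_torus ` B"] conjI)
  qed
  ultimately show "open (h -` W \<inter> UNIV)" by simp
qed

lemma continuous_map_cylinder:
  "continuous_map (prod_topology (top_of_set S) (top_of_set UNIV)) (top_of_set UNIV) h
    \<longleftrightarrow> continuous_on (S \<times> UNIV) h"
  unfolding prod_topology_subtopology_eu by (simp add: continuous_map_iff_continuous)

text \<open>At every time the straight-line homotopy from \<open>G\<close> to its linear part is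
  itself equivariant with the matrix \<open>E\<close>, so it descends to the torus.\<close>

lemma torus_homotopic_endo:
  assumes G: "torus_lift G F" and E: "equivariant E G"
  shows "torus_homotopic F (torus_endo E)"
proof -
  let ?k = "\<lambda>t p. (1 - t) *\<^sub>R G p + t *\<^sub>R (rmat E *v p)"
  define h where "h = (\<lambda>(t::real, x). to_torus (?k t (rep_torus x)))"
  have h: "h (t, to_torus p) = to_torus (?k t p)" for t p
  proof -
    define m where "m = rep_torus (to_torus p) - p"
    have m: "int_vec m" unfolding m_def by (simp flip: to_torus_eq)
    have "?k t (p + m) = ?k t p + rmat E *v m"
      unfolding equivariantD[OF E m] by (simp add: algebra_simps)
    then have "to_torus (?k t (p + m)) = to_torus (?k t p)"
      using int_vec_rmat[OF m] by (simp only: to_torus_add_int)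
    then show ?thesis by (simp add: h_def m_def)
  qed
  have cG: "continuous_on UNIV G" using G by (simp add: torus_lift_def)
  have "continuous_on UNIV (\<lambda>z. (1 - fst z) *\<^sub>R G (snd z) + fst z *\<^sub>R (rmat E *v snd z))"
    by (intro continuous_intros continuous_on_compose2[OF cG]
        linear_continuous_on_compose[of _ _ "\<lambda>p. rmat E *v p"]) auto
  then have "continuous_on UNIV h"
    by (intro continuous_on_from_cylinder)
      (auto simp: h case_prod_beta intro!: continuous_on_compose2[OF continuous_on_to_torus])
  then have "continuous_map (prod_topology (top_of_set {0..1}) (top_of_set UNIV)) (top_of_set UNIV) h"
    by (simp only: continuous_map_cylinder)
      (auto intro: continuous_on_subset)
  moreover have "h (0, x) = F x" "h (1, x) = torus_endo E x" for x
  proof -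
    obtain p where p: "x = to_torus p" by (rule obtain_to_torus)
    show "h (0, x) = F x" "h (1, x) = torus_endo E x"
      using G by (auto simp: p h torus_lift_def torus_endo_to_torus)
  qed
  ultimately show ?thesis
    unfolding homotopic_with_def by (intro exI[of _ h] conjI allI ballI TrueI)
qed

text \<open>The entry at (i, j) is the winding number of the i-th coordinate along the j-th unit
  loop. On the contractible strip of times and loop parameters the homotopy has a continuous
  logarithm. Its increment over one period, in units of 2 pi i, is an integer depending continuously
  on time, so it agrees at both ends.\<close>

lemma torus_endo_homotopic_unique:
  assumes "torus_homotopic (torus_endo E) (torus_endo E')"
  shows "E = E'"
proof -
  have "\<exists>h. continuous_map (prod_topology (top_of_set {0..1::real}) (top_of_set UNIV)) (top_of_set UNIV) h
      \<and> (\<forall>x. h (0, x) = torus_endo E x) \<and> (\<forall>x. h (1, x) = torus_endo E' x)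
      \<and> (\<forall>t\<in>{0..1::real}. True)"
    using assms unfolding homotopic_with_def .
  then obtain h where hh: "continuous_map (prod_topology (top_of_set {0..1::real}) (top_of_set UNIV)) (top_of_set UNIV) h
      \<and> (\<forall>x. h (0, x) = torus_endo E x) \<and> (\<forall>x. h (1, x) = torus_endo E' x)
      \<and> (\<forall>t\<in>{0..1::real}. True)" ..
  have h0: "h (0, x) = torus_endo E x" and h1: "h (1, x) = torus_endo E' x" for x
    using hh by simp_all
  from hh[THEN conjunct1] have h: "continuous_on ({0..1} \<times> UNIV) h"
    by (simp only: continuous_map_cylinder)
  have "E $ i $ j = E' $ i $ j" for i j
  proof -
    let ?S = "{0..1::real} \<times> (UNIV :: real set)"
    define e where "e = (\<lambda>x. exp (2 * of_real pi * \<i> * of_real (rep_torus x $ i)))"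
    have e: "e (to_torus p) = exp (2 * of_real pi * \<i> * of_real (p $ i))" for p
    proof -
      have "rep_torus (to_torus p) $ i - p $ i \<in> \<int>"
        using to_torus_eq_iff[of "rep_torus (to_torus p)" p] by simp
      then obtain k where "rep_torus (to_torus p) $ i - p $ i = of_int k" by (rule Ints_cases)
      then have k: "rep_torus (to_torus p) $ i = p $ i + of_int k" by simp
      show ?thesis unfolding e_def k exp_eq by (intro exI[of _ k]) (simp add: algebra_simps)
    qed
    have "continuous_on UNIV e"
      by (rule continuous_on_from_torus) (simp add: e continuous_intros)
    define q where "q = (\<lambda>(t::real, s::real). e (h (t, to_torus (axis j s))))"
    have "continuous_on UNIV (\<lambda>z::real\<times>real. axis j (snd z) :: real^2)"
      unfolding axis_def
    proof (intro continuous_intros)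
      show "continuous_on UNIV (\<lambda>z::real\<times>real. if i = j then snd z else 0)" for i
        by (cases "i = j") (auto intro: continuous_intros)
    qed
    have cax: "continuous_on UNIV (\<lambda>z::real\<times>real. to_torus (axis j (snd z)))"
      by (rule continuous_on_compose2[OF continuous_on_to_torus]) (fact, simp)
    have "continuous_on ?S (\<lambda>z. h (fst z, to_torus (axis j (snd z))))"
      by (rule continuous_on_compose2[OF h])
        (auto intro!: continuous_intros continuous_on_subset[OF cax])
    then have "continuous_on ?S q"
      unfolding q_def case_prod_beta
      by (rule continuous_on_compose2[OF \<open>continuous_on UNIV e\<close>]) auto
    moreover have "contractible ?S"
      by (intro convex_imp_contractible convex_Times) auto
    moreover have "q z \<noteq> 0" for z by (auto simp: q_def e_def case_prod_beta)
    ultimately obtain l where l: "continuous_on ?S l" "\<And>z. z \<in> ?S \<Longrightarrow> q z = exp (l z)"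
      using continuous_logarithm_on_contractible by metis
    have per: "\<exists>k::int. l (t, 1) - l (t, 0) = of_int k * (2 * of_real pi * \<i>)" if "t \<in> {0..1}" for t
    proof -
      have "to_torus (axis j 1) = to_torus (axis j 0)"
        using int_vec_axis[of j 1] by (simp add: to_torus_eq int_vec_def axis_def)
      then have "exp (l (t, 1)) = exp (l (t, 0))"
        using l(2)[of "(t, 1)"] l(2)[of "(t, 0)"] that by (simp add: q_def)
      then show ?thesis unfolding exp_eq by (auto simp: algebra_simps)
    qed
    define \<delta> where "\<delta> t = (l (t, 1) - l (t, 0)) / (2 * of_real pi * \<i>)" for t
    have \<delta>Z: "\<exists>k::int. \<delta> t = of_int k" if t: "t \<in> {0..1}" for t
      using per[OF t] by (auto simp: \<delta>_def)
    have "\<delta> constant_on {0..1}"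
    proof (rule continuous_discrete_range_constant)
      show "continuous_on {0..1} \<delta>"
        unfolding \<delta>_def
        by (intro continuous_intros continuous_on_compose2[OF l(1)]) auto
      fix x :: real assume x: "x \<in> {0..1}"
      show "\<exists>e>0. \<forall>y. y \<in> {0..1} \<and> \<delta> y \<noteq> \<delta> x \<longrightarrow> e \<le> norm (\<delta> y - \<delta> x)"
      proof (intro exI[of _ 1] conjI allI impI)
        fix y assume y: "y \<in> {0..1} \<and> \<delta> y \<noteq> \<delta> x"
        obtain a b :: int where "\<delta> x = of_int a" "\<delta> y = of_int b" using \<delta>Z x y by blast
        moreover from this have "\<delta> y - \<delta> x = of_int (b - a)" "b \<noteq> a" using y by auto
        ultimately show "1 \<le> norm (\<delta> y - \<delta> x)"
          by (simp only: norm_of_int)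
      qed simp
    qed (simp add: convex_connected)
    then have "\<delta> 0 = \<delta> 1" unfolding constant_on_def by (metis atLeastAtMost_iff order_refl zero_le_one)
    \<comment> \<open>At an endpoint the loop is linear, so the logarithm, in units of 2 pi i,
      differs from \<open>s * A $ i $ j\<close> by a continuous integer-valued function, hence by a
      constant.\<close>
    have endpt: "\<delta> t = of_int (A $ i $ j)"
      if t: "t \<in> {0..1}" and A: "\<And>x. h (t, x) = torus_endo A x" for t and A :: "int^2^2"
    proof -
      define m where "m s = l (t, s) / (2 * of_real pi * \<i>) - of_real (s * of_int (A $ i $ j))" for s
      have mZ: "\<exists>k::int. m s = of_int k" for s
      proof -
        have "exp (l (t, s)) = q (t, s)" using l(2)[of "(t, s)"] t by simp
        also have "\<dots> = exp (2 * of_real pi * \<i> * of_real ((rmat A *v axis j s) $ i))"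
          by (simp add: q_def A torus_endo_to_torus e)
        also have "(rmat A *v axis j s) $ i = s * of_int (A $ i $ j)"
          by (simp add: matrix_vector_mul_component inner_axis mult.commute)
        finally obtain k :: int where
          "l (t, s) = 2 * of_real pi * \<i> * of_real (s * of_int (A $ i $ j)) + of_real (of_int (2 * k) * pi) * \<i>"
          unfolding exp_eq by blast
        then have "m s = of_int k" by (simp add: m_def field_simps)
        then show ?thesis by blast
      qed
      have "m constant_on UNIV"
      proof (rule continuous_discrete_range_constant)
        show "continuous_on UNIV m"
          unfolding m_def using t
          by (intro continuous_intros continuous_on_compose2[OF l(1)]) auto
        fix x :: real
        show "\<exists>e>0. \<forall>y. y \<in> UNIV \<and> m y \<noteq> m x \<longrightarrow> e \<le> norm (m y - m x)"
        proof (intro exI[of _ 1] conjI allI impI)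
          fix y assume y: "y \<in> UNIV \<and> m y \<noteq> m x"
          obtain a b :: int where "m x = of_int a" "m y = of_int b" using mZ by blast
          moreover from this have "m y - m x = of_int (b - a)" "b \<noteq> a" using y by auto
          ultimately show "1 \<le> norm (m y - m x)"
            by (simp only: norm_of_int)
        qed simp
      qed (simp add: convex_connected)
      then have "m 0 = m 1" unfolding constant_on_def by (metis UNIV_I)
      then show ?thesis by (simp add: m_def \<delta>_def diff_divide_distrib algebra_simps)
    qed
    show ?thesis
      using endpt[of 0 E] endpt[of 1 E'] h0 h1 \<open>\<delta> 0 = \<delta> 1\<close> by simp
  qed
  then show ?thesis by (simp add: vec_eq_iff)
qed

lemma torus_linear_part_eq:
  assumes "torus_lift G F" "equivariant E G"
  shows "torus_linear_part F = E"
  unfolding torus_linear_part_def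
proof (rule the_equality)
  show FE: "torus_homotopic F (torus_endo E)" using assms by (rule torus_homotopic_endo)
  fix E' assume "torus_homotopic F (torus_endo E')"
  then have "torus_homotopic (torus_endo E) (torus_endo E')"
    by (rule homotopic_with_trans[OF FE[THEN homotopic_with_sym[THEN iffD1]]])
  then show "E' = E" by (rule torus_endo_homotopic_unique[symmetric])
qed

lemma torus_lift_funpow:
  assumes "torus_lift G F" shows "torus_lift (G ^^ n) (F ^^ n)"
proof (induction n)
  case (Suc n)
  have "continuous_on UNIV (\<lambda>p. G ((G ^^ n) p))"
    using Suc assms continuous_on_compose2[of UNIV G UNIV "G ^^ n"] by (simp add: torus_lift_def)
  then show ?case using Suc assms by (auto simp: torus_lift_def o_def)
qed (simp add: torus_lift_def)

lemma torus_deriv_eq: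
  assumes "torus_lift G F" "(G has_derivative A) (at p)"
  shows "torus_deriv F (to_torus p) = A"
  unfolding torus_deriv_def
proof (rule the_equality)
  show *: "torus_has_derivative F A (to_torus p)"
    unfolding torus_has_derivative_def by (intro exI[of _ G] exI[of _ p] conjI assms refl)
  show "B = A" if "torus_has_derivative F B (to_torus p)" for B
    using that * by (rule torus_has_derivative_unique)
qed

subsection \<open>Global inverses of locally expanding maps\<close>

text \<open>Expansion on the uniform scale \<open>r\<close> makes the image of every small ball
  contain a ball of a radius \<open>\<eta>\<close> that does not depend on the point. This makes the
  range closed as well as open and balls of radius \<open>\<eta>\<close> evenly covered, so
  \<open>G\<close> is a covering map. As the space is simply connected, the identity lifts to a
  global inverse. The factor \<open>c\<close> may be below 1.\<close>

lemma uniformly_expanding_inverse: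
  fixes G :: "'a::euclidean_space \<Rightarrow> 'a"
  assumes cont: "continuous_on UNIV G" and "r > 0" "c > 0"
    and expand: "\<And>a b. dist a b < r \<Longrightarrow> c * dist a b \<le> dist (G a) (G b)"
  obtains g where "continuous_on UNIV g" "\<And>y. G (g y) = y" "\<And>x. g (G x) = x"
proof -
  \<comment> \<open>Two points of one ball, and the centres of two overlapping balls, are then
    closer than \<open>2 * \<rho> < r\<close>, where the expansion hypothesis applies.\<close>
  define \<rho> where "\<rho> = r / 4"
  define \<eta> where "\<eta> = c * \<rho>"
  have \<rho>: "\<rho> > 0" "2 * \<rho> < r" and \<eta>: "\<eta> > 0" using assms by (auto simp: \<rho>_def \<eta>_def)
  have inj: "x = y" if "dist x y < r" "G x = G y" for x y
    using expand[OF that(1)] that(2) \<open>c > 0\<close> by (simp add: mult_le_0_iff)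
  have inj_ball: "inj_on G (ball x \<rho>)" for x
  proof (rule inj_onI)
    fix a b assume "a \<in> ball x \<rho>" "b \<in> ball x \<rho>" and eq: "G a = G b"
    then have "dist a b < r" using \<rho> dist_triangle[of a b x] by (auto simp: dist_commute)
    then show "a = b" using eq by (rule inj)
  qed
  \<comment> \<open>The image of the open ball is open by invariance of domain. It is also closed
    relative to \<open>?V\<close>, because no point at distance \<open>\<rho>\<close> from
    \<open>x\<close> is mapped into \<open>?V\<close>. As \<open>?V\<close> is connected, it is
    covered.\<close>
  have ball_sub: "ball (G x) \<eta> \<subseteq> G ` ball x \<rho>" for x
  proof -
    let ?V = "ball (G x) \<eta>" and ?W = "G ` ball x \<rho>"
    have op: "open ?W"
      by (rule invariance_of_domain[OF continuous_on_subset[OF cont] open_ball inj_ball]) simp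
    have cl: "closed (G ` cball x \<rho>)"
      by (intro compact_imp_closed compact_continuous_image continuous_on_subset[OF cont]) auto
    have "?V \<inter> G ` cball x \<rho> \<subseteq> ?W"
    proof
      fix y assume "y \<in> ?V \<inter> G ` cball x \<rho>"
      then obtain z where z: "dist x z \<le> \<rho>" "y = G z" "dist (G x) (G z) < \<eta>" by auto
      then have "c * dist x z < c * \<rho>"
        using expand[of x z] \<rho> by (simp add: \<eta>_def)
      then show "y \<in> ?W" using z \<open>c > 0\<close> by auto
    qed
    then have eq: "?V \<inter> G ` cball x \<rho> = ?V \<inter> ?W" using ball_subset_cball by blast
    have "?V \<inter> ?W = {} \<or> ?V \<inter> ?W = ?V"
    proof (rule connected_clopen[THEN iffD1, rule_format])
      show "connected ?V" by simp
      show "openin (top_of_set ?V) (?V \<inter> ?W) \<and> closedin (top_of_set ?V) (?V \<inter> ?W)"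
        using op cl eq by (metis closedin_closed openin_open)
    qed
    moreover have "G x \<in> ?V \<inter> ?W" using \<rho> \<eta> by auto
    ultimately show ?thesis by blast
  qed
  have surj: "range G = UNIV"
  proof -
    have "open (range G)"
    proof (rule openI)
      fix y assume "y \<in> range G"
      then obtain x where "y = G x" by auto
      then show "\<exists>e>0. ball y e \<subseteq> range G" using ball_sub[of x] \<eta> by blast
    qed
    moreover have "closed (range G)"
    proof (subst closure_subset_eq[symmetric], rule subsetI)
      fix y assume "y \<in> closure (range G)"
      then obtain x where "dist (G x) y < \<eta>" using \<eta> by (auto simp: closure_approachable)
      then have "y \<in> ball (G x) \<eta>" by simp
      then show "y \<in> range G" using ball_sub[of x] by blast
    qed
    ultimately show ?thesis using clopen[of "range G"] by auto
  qed
  have cov: "covering_space UNIV G UNIV"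
  proof (rule covering_spaceI[OF cont surj])
    fix y :: 'a assume "y \<in> UNIV"
    define U where "U x = ball x \<rho> \<inter> G -` ball y \<eta>" for x
    have opU: "open (U x)" for x
      unfolding U_def using continuous_on_open_vimage[of UNIV G] cont by (intro open_Int) auto
    have "G ` U x = ball y \<eta>" if "G x = y" for x
      using ball_sub[of x] that by (auto simp: U_def)
    then have hom: "\<exists>q. homeomorphism (U x) (ball y \<eta>) G q" if "G x = y" for x
      using invariance_of_domain_homeomorphism[OF opU[of x], of G] continuous_on_subset[OF cont]
        inj_on_subset[OF inj_ball[of x], of "U x"] that
      by (metis Int_lower1 U_def order_refl subset_UNIV)
    show "\<exists>T. y \<in> T \<and> openin (top_of_set UNIV) T \<and>
            (\<exists>v. \<Union> v = UNIV \<inter> G -` T \<and> (\<forall>u\<in>v. openin (top_of_set UNIV) u) \<and>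
                 pairwise disjnt v \<and> (\<forall>u\<in>v. \<exists>q. homeomorphism u T G q))"
    proof (intro exI[of _ "ball y \<eta>"] exI[of _ "U ` (G -` {y})"] conjI)
      show "y \<in> ball y \<eta>" using \<eta> by simp
      show "\<Union> (U ` (G -` {y})) = UNIV \<inter> G -` ball y \<eta>"
      proof (intro equalityI subsetI)
        fix z assume "z \<in> UNIV \<inter> G -` ball y \<eta>"
        then have "y \<in> ball (G z) \<eta>" "z \<in> G -` ball y \<eta>" by (auto simp: dist_commute)
        moreover then obtain x where "x \<in> ball z \<rho>" "G x = y" using ball_sub[of z] by auto
        ultimately show "z \<in> \<Union> (U ` (G -` {y}))"
          by (auto simp: U_def dist_commute intro!: bexI[of _ x])
      qed (auto simp: U_def)
      show "pairwise disjnt (U ` (G -` {y}))"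
      proof (rule pairwise_imageI)
        fix a b assume ab: "a \<in> G -` {y}" "b \<in> G -` {y}" "a \<noteq> b"
        have "dist a b < r" if "z \<in> U a" "z \<in> U b" for z
          using that dist_triangle[of a b z] \<rho> by (auto simp: U_def dist_commute)
        then show "disjnt (U a) (U b)" using inj[of a b] ab by (auto simp: disjnt_def)
      qed
    qed (use opU hom in auto)
  qed
  have sc: "simply_connected (UNIV :: 'a set)" "locally path_connected (UNIV :: 'a set)"
    by (auto simp: convex_imp_simply_connected convex_imp_locally_path_connected)
  obtain g where g: "continuous_on UNIV g" "g (G 0) = 0" "\<And>y. G (g y) = y"
    using covering_space_lift_strong[OF cov _ _ sc, of 0 "G 0" "\<lambda>x. x"]
    by (auto simp: continuous_on_id)
  \<comment> \<open>Both this composition and the identity are lifts of \<open>G\<close> through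
    \<open>G\<close>, and they agree at 0.\<close>
  have "g (G x) = x" for x
  proof (rule covering_space_lift_unique[OF cov, of "\<lambda>x. g (G x)" 0 "\<lambda>x. x" UNIV G])
    show "continuous_on UNIV (\<lambda>x. g (G x))"
      by (rule continuous_on_compose2[OF g(1) cont]) simp
  qed (use g cont in auto)
  with g that show thesis by blast
qed

section \<open>Lattice-periodic maps and derivatives of lifts\<close>

lemma shift_to_unit_cube:
  fixes p :: "real^2"
  obtains m where "int_vec m" "p + m \<in> cbox 0 1"
proof
  let ?m = "(\<chi> i. - of_int \<lfloor>p $ i\<rfloor>) :: real^2"
  show "int_vec ?m" by (simp add: int_vec_def)
  show "p + ?m \<in> cbox 0 1"
    by (auto simp: mem_box_cart) linarith+
qed

lemma periodic_uniformly_continuous: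
  fixes f :: "real^2 \<Rightarrow> 'b::metric_space"
  assumes cont: "continuous_on UNIV f" and per: "\<And>p m. int_vec m \<Longrightarrow> f (p + m) = f p"
  shows "uniformly_continuous_on UNIV f"
  unfolding uniformly_continuous_on_def
proof (intro allI impI)
  fix e :: real assume e: "e > 0"
  \<comment> \<open>The unit cube enlarged by 1 on each side: once one point is translated into the
    unit cube, every point at distance below 1 from it lies here too.\<close>
  let ?K = "cbox (-1) (2 :: real^2)"
  have "uniformly_continuous_on ?K f"
    by (intro compact_uniformly_continuous continuous_on_subset[OF cont]) auto
  then obtain d where d: "d > 0" "\<And>x y. x \<in> ?K \<Longrightarrow> y \<in> ?K \<Longrightarrow> dist y x < d \<Longrightarrow> dist (f y) (f x) < e"
    using e unfolding uniformly_continuous_on_def by metis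
  show "\<exists>d>0. \<forall>x\<in>UNIV. \<forall>y\<in>UNIV. dist y x < d \<longrightarrow> dist (f y) (f x) < e"
  proof (intro exI[of _ "min d 1"] conjI ballI impI)
    fix x y :: "real^2" assume xy: "dist y x < min d 1"
    obtain m where m: "int_vec m" "x + m \<in> cbox 0 1" by (rule shift_to_unit_cube)
    have "\<bar>y $ i - x $ i\<bar> < 1" for i
      using xy component_le_norm_cart[of "y - x" i] by (simp add: dist_norm)
    then have "\<bar>(y + m) $ i - (x + m) $ i\<bar> < 1" for i by simp
    then have "x + m \<in> ?K" "y + m \<in> ?K"
      using m(2) by (auto simp: mem_box_cart abs_less_iff) (smt (verit))+
    then have "dist (f (y + m)) (f (x + m)) < e"
      using d(2) xy by simp
    then show "dist (f y) (f x) < e" using per[OF m(1)] by simp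
  qed (use d in auto)
qed

lemma periodic_bounded:
  fixes f :: "real^2 \<Rightarrow> 'b::real_normed_vector"
  assumes cont: "continuous_on UNIV f" and per: "\<And>p m. int_vec m \<Longrightarrow> f (p + m) = f p"
  obtains B where "\<And>p. norm (f p) \<le> B"
proof -
  have "bounded (f ` cbox 0 1)"
    by (intro compact_imp_bounded compact_continuous_image continuous_on_subset[OF cont]) auto
  then obtain B where B: "\<And>x. x \<in> cbox 0 1 \<Longrightarrow> norm (f x) \<le> B"
    unfolding bounded_iff by auto
  have "norm (f p) \<le> B" for p
    by (metis B shift_to_unit_cube per)
  then show thesis by (rule that)
qed

lemma equivariant_frechet_derivative:
  assumes E: "equivariant E G" and G: "\<And>p. G differentiable (at p)" and m: "int_vec m"
  shows "frechet_derivative G (at (p + m)) = frechet_derivative G (at p)"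
proof -
  have "((\<lambda>x. x + m) has_derivative (\<lambda>h. h)) (at p)"
    by (auto intro!: derivative_eq_intros)
  moreover have "(G has_derivative frechet_derivative G (at (p + m))) (at (p + m))"
    using G frechet_derivative_works by blast
  ultimately have "((\<lambda>x. G (x + m)) has_derivative frechet_derivative G (at (p + m))) (at p)"
    using has_derivative_compose[of "\<lambda>x. x + m" "\<lambda>h. h" p UNIV G] by simp
  then have "((\<lambda>x. G x + rmat E *v m) has_derivative frechet_derivative G (at (p + m))) (at p)"
    by (simp only: equivariantD[OF E m])
  then have "((\<lambda>x. G x + rmat E *v m - rmat E *v m) has_derivative
      (\<lambda>h. frechet_derivative G (at (p + m)) h - 0)) (at p)"
    by (intro has_derivative_diff has_derivative_const)
  then have "(G has_derivative frechet_derivative G (at (p + m))) (at p)" by simp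
  then show ?thesis using frechet_derivative_at by blast
qed

text \<open>The derivative of a lift is periodic, hence uniformly continuous. On balls of one fixed
  radius \<open>G\<close> therefore stays within \<open>c / 2\<close> of its linearization, which
  leaves the local expansion factor \<open>c / 2\<close>.\<close>

lemma equivariant_C1_inverse:
  assumes E: "equivariant E G" and C1: "C_k 1 G" and "c > 0"
    and low: "\<And>p v. c * norm v \<le> norm (frechet_derivative G (at p) v)"
  obtains g where "continuous_on UNIV g" "\<And>y. G (g y) = y" "\<And>x. g (G x) = x"
proof -
  let ?D = "\<lambda>p. frechet_derivative G (at p)"
  have dG: "G differentiable (at p)" for p using C1 by simp
  have D: "(G has_derivative ?D p) (at p)" for p
    using dG frechet_derivative_works by blast
  have lin: "bounded_linear (?D p)" for p using D has_derivative_bounded_linear by blast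
  have cont: "continuous_on UNIV G"
    using dG by (simp add: continuous_on_eq_continuous_at differentiable_imp_continuous_within)
  have uc: "uniformly_continuous_on UNIV (\<lambda>p. ?D p v)" for v
    by (rule periodic_uniformly_continuous)
      (use C1 equivariant_frechet_derivative[OF E dG] in auto)
  \<comment> \<open>\<open>C_k\<close> gives continuity for each direction separately, so the
    operator norm is controlled through a basis: \<open>c / 4\<close> in each of two directions adds
    up to \<open>c / 2\<close>.\<close>
  have "\<exists>d>0. \<forall>p q. dist p q < d \<longrightarrow> norm (?D p v - ?D q v) < c / 4" for v
    using uc[of v] \<open>c > 0\<close> unfolding uniformly_continuous_on_def dist_norm
    by (metis UNIV_I divide_pos_pos zero_less_numeral)
  then obtain d where d: "\<And>v. d v > 0" "\<And>v p q. dist p q < d v \<Longrightarrow> norm (?D p v - ?D q v) < c / 4"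
    by metis
  define r where "r = min (d (axis 1 1)) (d (axis 2 1))"
  have close: "onorm (\<lambda>v. ?D p v - ?D q v) \<le> c / 2" if pq: "dist p q < r" for p q
  proof (rule onorm_bound)
    fix v
    interpret L: bounded_linear "\<lambda>v. ?D p v - ?D q v"
      using lin by (intro bounded_linear_sub)
    let ?L = "\<lambda>v. ?D p v - ?D q v"
    have v: "v = (v $ 1) *\<^sub>R axis 1 1 + (v $ 2) *\<^sub>R axis (2::2) 1"
      by (simp add: vec_eq_iff forall_2 axis_def)
    have "?L v = (v $ 1) *\<^sub>R ?L (axis 1 1) + (v $ 2) *\<^sub>R ?L (axis 2 1)"
      using L.add[of "(v $ 1) *\<^sub>R axis 1 1" "(v $ 2) *\<^sub>R axis 2 1"] L.scaleR v by simp
    then have "norm (?L v) \<le> \<bar>v $ 1\<bar> * norm (?L (axis 1 1)) + \<bar>v $ 2\<bar> * norm (?L (axis 2 1))"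
      using norm_triangle_ineq[of "(v $ 1) *\<^sub>R ?L (axis 1 1)" "(v $ 2) *\<^sub>R ?L (axis 2 1)"] by simp
    also have "\<dots> \<le> norm v * (c / 4) + norm v * (c / 4)"
      using d(2)[of p q "axis 1 1"] d(2)[of p q "axis 2 1"] pq
      by (intro add_mono mult_mono component_le_norm_cart) (auto simp: r_def)
    finally show "norm (?L v) \<le> c / 2 * norm v" by (simp add: algebra_simps)
  qed (use \<open>c > 0\<close> in auto)
  show thesis
  proof (rule uniformly_expanding_inverse[OF cont])
    show "r > 0" using d(1) by (simp add: r_def)
    show "c / 2 > 0" using \<open>c > 0\<close> by simp
    fix a b :: "real^2" assume ab: "dist a b < r"
    have "norm (G b - G a - ?D a (b - a)) \<le> norm (b - a) * (c / 2)"
    proof (rule differentiable_bound_linearization[where S = "ball a r" and f' = ?D])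
      show "a + t *\<^sub>R (b - a) \<in> ball a r" if "t \<in> {0..1}" for t
      proof -
        have "\<bar>t\<bar> * norm (b - a) \<le> 1 * norm (b - a)" using that by (intro mult_right_mono) auto
        then show ?thesis using ab by (simp add: dist_norm norm_minus_commute)
      qed
      show "(G has_derivative ?D x) (at x within ball a r)" for x
        using D by (rule has_derivative_at_withinI)
      show "onorm (?D x - ?D a) \<le> c / 2" if "x \<in> ball a r" for x
        using close[of x a] that by (simp add: dist_commute fun_diff_def)
      show "a \<in> ball a r" using d(1) by (simp add: r_def)
    qed
    moreover have "norm (?D a (b - a)) \<le> norm (G b - G a - ?D a (b - a)) + norm (G b - G a)"
      using norm_triangle_sub[of "?D a (b - a)" "G b - G a"] by (simp add: norm_minus_commute add.commute)
    ultimately show "c / 2 * dist a b \<le> dist (G a) (G b)"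
      using low[of "b - a" a] by (simp add: dist_norm norm_minus_commute algebra_simps)
  qed (use that in blast)
qed

text \<open>The derivative of the inverse has norm at most \<open>1 / c\<close>, and the mean value
  inequality applies. The intended \<open>G\<close> is an iterate: the constant in
  \<open>uniformly_expanding\<close> may be below 1, so a single inverse step need not
  contract.\<close>

lemma inverse_lipschitz:
  fixes G :: "'a::euclidean_space \<Rightarrow> 'a"
  assumes dG: "\<And>p. G differentiable (at p)" and "c > 0"
    and low: "\<And>p v. c * norm v \<le> norm (frechet_derivative G (at p) v)"
    and g: "continuous_on UNIV g" "\<And>y. G (g y) = y"
  shows "dist (g a) (g b) \<le> dist a b / c"
proof -
  let ?D = "\<lambda>p. frechet_derivative G (at p)"
  have D: "(G has_derivative ?D p) (at p)" for p
    using dG frechet_derivative_works by blast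
  have "\<exists>g'. (g has_derivative g') (at y) \<and> onorm g' \<le> 1 / c" for y
  proof -
    have lin: "linear (?D (g y))" using D has_derivative_linear by blast
    have "inj (?D (g y))"
      unfolding linear_injective_0[OF lin]
    proof (intro allI impI)
      fix v assume "?D (g y) v = 0"
      then show "v = 0" using low[of v "g y"] \<open>c > 0\<close> by (simp add: mult_le_0_iff)
    qed
    then obtain g' where g': "linear g'" "\<And>v. g' (?D (g y) v) = v" "\<And>v. ?D (g y) (g' v) = v"
      using linear_injective_isomorphism[OF lin] by auto
    have "(g has_derivative g') (at y)"
    proof (rule has_derivative_inverse_basic[where f = G and f' = "?D (g y)" and T = UNIV])
      show "bounded_linear g'" using g'(1) linear_conv_bounded_linear by blast
      show "continuous (at y) g" using g(1) by (simp add: continuous_on_eq_continuous_at)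
    qed (use g' g D in \<open>auto simp: fun_eq_iff\<close>)
    moreover have "onorm g' \<le> 1 / c"
    proof (rule onorm_bound)
      show "norm (g' v) \<le> 1 / c * norm v" for v
        using low[of "g' v" "g y"] g'(3)[of v] \<open>c > 0\<close> by (simp add: field_simps)
    qed (use \<open>c > 0\<close> in auto)
    ultimately show ?thesis by blast
  qed
  then obtain g' where g': "\<And>y. (g has_derivative g' y) (at y)" "\<And>y. onorm (g' y) \<le> 1 / c" by metis
  have "norm (g a - g b) \<le> 1 / c * norm (a - b)"
    by (rule differentiable_bound[of UNIV g g']) (use g' in auto)
  then show ?thesis by (simp add: dist_norm)
qed

subsection \<open>Semiconjugacy to an expanding map\<close>

lemma rmat_mult: "rmat (A ** B) = rmat A ** rmat B"
  by (simp add: vec_eq_iff matrix_matrix_mult_def)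

lemma funpow_inverse:
  fixes G g :: "'a \<Rightarrow> 'a"
  assumes "\<And>y. G (g y) = y" shows "(G ^^ n) ((g ^^ n) y) = y"
proof (induction n)
  case (Suc n)
  then show ?case unfolding funpow_Suc_right[of n G] by (simp add: assms)
qed simp

lemma continuous_on_funpow:
  assumes "continuous_on UNIV (g :: 'a::topological_space \<Rightarrow> 'a)" shows "continuous_on UNIV (g ^^ n)"
proof (induction n)
  case (Suc n)
  show ?case using continuous_on_compose2[OF assms Suc] by (simp add: o_def)
qed (simp add: continuous_on_id id_def)

text \<open>Solutions of \<open>h p = y\<close> are the fixed points of the map \<open>?T\<close>
  below. It has bounded range because \<open>h\<close> stays near the linear map, so Brouwer's
  theorem applies on a large ball.\<close>

lemma surj_if_close_to_linear:
  fixes h :: "real^2 \<Rightarrow> real^2"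
  assumes cont: "continuous_on UNIV h" and near: "\<And>p. norm (h p - A *v p) \<le> B" and A: "invertible A"
  shows "surj h"
proof -
  have "\<exists>p. h p = y" for y
  proof -
    obtain A' where "A ** A' = mat 1" using A unfolding invertible_def by blast
    then have AA': "A *v (A' *v v) = v" for v
      by (simp add: matrix_vector_mul_assoc)
    let ?T = "\<lambda>p. A' *v (y - (h p - A *v p))"
    define R where "R = onorm ((*v) A') * (norm y + B)"
    have B: "0 \<le> B" using near[of 0] norm_ge_zero order_trans by blast
    have R: "0 \<le> R" unfolding R_def using B by (intro mult_nonneg_nonneg onorm_pos_le) auto
    have "norm (?T p) \<le> R" for p
    proof -
      have "norm (?T p) \<le> onorm ((*v) A') * norm (y - (h p - A *v p))"
        by (rule onorm) simp
      also have "\<dots> \<le> R"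
        unfolding R_def using norm_triangle_ineq4[of y "h p - A *v p"] near[of p]
        by (intro mult_left_mono onorm_pos_le) auto
      finally show ?thesis .
    qed
    moreover have "continuous_on (cball 0 R) ?T"
      by (intro continuous_intros linear_continuous_on_compose[of _ _ "\<lambda>p. A' *v p"]
        linear_continuous_on_compose[of _ _ "\<lambda>p. A *v p"] continuous_on_subset[OF cont]) auto
    ultimately obtain p where "?T p = p"
      using brouwer[of "cball 0 R" ?T] R by auto
    then have "A *v p = y - (h p - A *v p)" using AA' by metis
    then show ?thesis by (intro exI[of _ p]) simp
  qed
  then show ?thesis by (metis surjI)
qed

text \<open>The relation \<open>E ** H = H ** A\<close> makes the first two approximations differ by
  a lattice-periodic, hence bounded, function. Later pairs arise from this one by applying
  \<open>g ^^ n\<close>, so they approach each other geometrically and the convergence is uniform.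
  The limit stays within bounded distance of the invertible map given by \<open>H\<close>, which
  makes it surjective.\<close>

lemma semiconjugacy_exists:
  assumes G: "torus_lift G F" "equivariant E G"
    and g: "continuous_on UNIV g" "\<And>y. G (g y) = y" "\<And>x. g (G x) = x"
    and lip: "\<And>n a b. dist ((g ^^ n) a) ((g ^^ n) b) \<le> dist a b / (C * \<kappa> ^ n)"
    and C: "C > 0" "\<kappa> > 1"
    and q: "torus_lift q f" "equivariant A q"
    and H: "E ** H = H ** A" "invertible (rmat H)"
  shows "is_factor_of F f"
proof -
  have cq: "continuous_on UNIV q" using q by (simp add: torus_lift_def)
  have g_eq: "g (y + rmat E *v m) = g y + m" if "int_vec m" for y m
  proof -
    have "G (g y + m) = y + rmat E *v m" using equivariantD[OF G(2) that] g(2) by simp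
    then show ?thesis using g(3)[of "g y + m"] by simp
  qed
  have EH: "rmat E *v (rmat H *v m) = rmat H *v (rmat A *v m)" for m
    by (simp add: matrix_vector_mul_assoc rmat_mult[symmetric] H(1))
  define hs where "hs n p = (g ^^ n) (rmat H *v ((q ^^ n) p))" for n p
  have hs_Suc: "hs (Suc n) p = g (hs n (q p))" for n p
    unfolding hs_def by (simp add: funpow_swap1)
  have chs: "continuous_on UNIV (hs n)" for n
    unfolding hs_def
    by (intro continuous_on_compose2[OF continuous_on_funpow[OF g(1)]]
        linear_continuous_on_compose[of _ _ "\<lambda>p. rmat H *v p"] continuous_on_funpow[OF cq]) auto
  have hs_eq: "hs n (p + m) = hs n p + rmat H *v m" if "int_vec m" for n p m
    using that
  proof (induction n arbitrary: p m)
    case 0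
    then show ?case by (simp add: hs_def matrix_vector_right_distrib)
  next
    case (Suc n)
    have "hs (Suc n) (p + m) = g (hs n (q p + rmat A *v m))"
      by (simp only: hs_Suc equivariantD[OF q(2) Suc.prems])
    also have "\<dots> = g (hs n (q p) + rmat H *v (rmat A *v m))"
      by (subst Suc.IH) (use Suc.prems in auto)
    also have "\<dots> = g (hs n (q p)) + rmat H *v m"
      by (simp only: EH[symmetric]) (rule g_eq, use Suc.prems in auto)
    finally show ?case by (simp only: hs_Suc)
  qed
  obtain B where B: "\<And>p. norm (hs 1 p - hs 0 p) \<le> B"
  proof (rule periodic_bounded)
    show "continuous_on UNIV (\<lambda>p. hs 1 p - hs 0 p)" by (intro continuous_intros chs)
    show "hs 1 (p + m) - hs 0 (p + m) = hs 1 p - hs 0 p" if "int_vec m" for p m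
      by (simp add: hs_eq[OF that])
  qed blast
  define M where "M n = (B / C) * (1 / \<kappa>) ^ n" for n
  have step: "norm (hs (Suc n) p - hs n p) \<le> M n" for n p
  proof -
    let ?y = "(q ^^ n) p"
    have "hs (Suc n) p = (g ^^ n) (hs 1 ?y)" "hs n p = (g ^^ n) (hs 0 ?y)"
      by (simp_all add: hs_def funpow_swap1)
    then have "norm (hs (Suc n) p - hs n p) \<le> norm (hs 1 ?y - hs 0 ?y) / (C * \<kappa> ^ n)"
      using lip[of n "hs 1 ?y" "hs 0 ?y"] by (simp add: dist_norm)
    also have "\<dots> \<le> B / (C * \<kappa> ^ n)"
      using B C by (intro divide_right_mono) auto
    finally show ?thesis by (simp add: M_def power_divide)
  qed
  have sM: "summable M"
    unfolding M_def using C by (intro summable_mult summable_geometric) simp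
  define h where "h p = hs 0 p + (\<Sum>n. hs (Suc n) p - hs n p)" for p
  have ul: "uniform_limit UNIV hs h sequentially"
  proof -
    have "uniform_limit UNIV (\<lambda>n p. \<Sum>i<n. hs (Suc i) p - hs i p) (\<lambda>p. \<Sum>i. hs (Suc i) p - hs i p) sequentially"
      by (rule Weierstrass_m_test[OF _ sM]) (rule step)
    then have "uniform_limit UNIV (\<lambda>n p. hs 0 p + (\<Sum>i<n. hs (Suc i) p - hs i p)) h sequentially"
      unfolding h_def by (intro uniform_limit_add uniform_limit_const)
    moreover have "hs 0 p + (\<Sum>i<n. hs (Suc i) p - hs i p) = hs n p" for n p
      using sum_lessThan_telescope[of "\<lambda>n. hs n p" n] by simp
    ultimately show ?thesis by simp
  qed
  have ch: "continuous_on UNIV h"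
    by (rule uniform_limit_theorem[OF _ ul]) (auto simp: chs)
  have lim: "(\<lambda>n. hs n p) \<longlonglongrightarrow> h p" for p
    using ul by (rule tendsto_uniform_limitI) simp
  have h_near: "norm (h p - rmat H *v p) \<le> suminf M" for p
  proof -
    have "norm (\<Sum>n. hs (Suc n) p - hs n p) \<le> suminf M"
      by (rule norm_suminf_le[OF step sM])
    then show ?thesis by (simp add: h_def hs_def)
  qed
  have h_eq: "equivariant H h"
    unfolding equivariant_def
  proof (intro allI impI)
    fix p m assume m: "int_vec m"
    have "(\<lambda>n. hs n (p + m)) \<longlonglongrightarrow> h p + rmat H *v m"
      by (simp only: hs_eq[OF m]) (intro tendsto_intros lim)
    then show "h (p + m) = h p + rmat H *v m"
      using lim LIMSEQ_unique by blast
  qed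
  \<comment> \<open>The limit of \<open>hs_Suc\<close> reads \<open>h p = g (h (q p))\<close>;
    applying \<open>G\<close> removes \<open>g\<close>.\<close>
  have conj: "h (q p) = G (h p)" for p
  proof -
    have "isCont g (h (q p))" using g(1) by (simp add: continuous_on_eq_continuous_at)
    then have "(\<lambda>n. g (hs n (q p))) \<longlonglongrightarrow> g (h (q p))"
      by (rule isCont_tendsto_compose) (rule lim)
    moreover have "(\<lambda>n. g (hs n (q p))) \<longlonglongrightarrow> h p"
      using LIMSEQ_Suc[OF lim[of p]] by (simp only: hs_Suc)
    ultimately have "g (h (q p)) = h p" by (rule LIMSEQ_unique)
    then show ?thesis using g(2)[of "h (q p)"] by simp
  qed
  obtain t where t: "torus_lift h t" using equivariant_lift[OF h_eq ch] .
  have "surj h" using surj_if_close_to_linear[OF ch h_near H(2)] .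
  have "surj t"
  proof (rule surjI)
    fix x
    have "t (to_torus (inv h (rep_torus x))) = to_torus (h (inv h (rep_torus x)))"
      using t by (simp add: torus_lift_def)
    then show "t (to_torus (inv h (rep_torus x))) = x"
      by (simp add: surj_f_inv_f[OF \<open>surj h\<close>])
  qed
  moreover have "t \<circ> f = F \<circ> t"
  proof
    fix x
    obtain p where "x = to_torus p" by (rule obtain_to_torus)
    then show "(t \<circ> f) x = (F \<circ> t) x"
      using t q(1) G(1) conj[of p] by (simp add: torus_lift_def) metis
  qed
  ultimately show ?thesis
    unfolding is_factor_of_def using torus_lift_continuous[OF t] by blast
qed

lemma expanding_factor:
  assumes F: "torus_C_k 1 F" "uniformly_expanding F"
    and q: "torus_lift q f" "equivariant A q"
    and H: "torus_linear_part F ** H = H ** A" "invertible (rmat H)"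
  shows "is_factor_of F f"
proof -
  obtain G where G: "torus_lift G F" and C1: "C_k 1 G" using F(1) by (auto simp: torus_C_k_def)
  obtain E where E: "equivariant E G" using torus_lift_equivariant[OF G] .
  have EF: "torus_linear_part F = E" using torus_linear_part_eq[OF G E] .
  obtain C \<kappa> where C: "C > 0" "\<kappa> > 1"
    and exp: "\<And>n x v. C * \<kappa> ^ n * norm v \<le> norm (torus_deriv (F ^^ n) x v)"
    using F(2) unfolding uniformly_expanding_def by metis
  have dG: "G differentiable (at p)" for p using C1 by simp
  have dGn: "(G ^^ n) differentiable (at p)" for n p
  proof (induction n)
    case (Suc n)
    show ?case unfolding funpow.simps by (rule differentiable_chain_at[OF Suc dG])
  qed (simp add: id_def)
  have low: "C * \<kappa> ^ n * norm v \<le> norm (frechet_derivative (G ^^ n) (at p) v)" for n p v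
  proof -
    have "torus_deriv (F ^^ n) (to_torus p) = frechet_derivative (G ^^ n) (at p)"
      by (rule torus_deriv_eq[OF torus_lift_funpow[OF G]])
        (use dGn frechet_derivative_works in blast)
    then show ?thesis using exp[of n v "to_torus p"] by simp
  qed
  \<comment> \<open>The case \<open>n = 1\<close> of \<open>low\<close>: the bound
    \<open>C * \<kappa>\<close> may be below 1, but any positive constant yields the global
    inverse.\<close>
  obtain g where g: "continuous_on UNIV g" "\<And>y. G (g y) = y" "\<And>x. g (G x) = x"
    using equivariant_C1_inverse[OF E C1, of "C * \<kappa>"] low[of 1] C by auto
  show ?thesis
  proof (rule semiconjugacy_exists[OF G E g _ C q])
    show "E ** H = H ** A" using H(1) EF by simp
    show "dist ((g ^^ n) a) ((g ^^ n) b) \<le> dist a b / (C * \<kappa> ^ n)" for n a b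
    proof (rule inverse_lipschitz[where G = "G ^^ n"])
      show "(G ^^ n) differentiable (at p)" for p by (rule dGn)
      show "0 < C * \<kappa> ^ n" using C by simp
      show "C * \<kappa> ^ n * norm v \<le> norm (frechet_derivative (G ^^ n) (at p) v)" for p v by (rule low)
      show "continuous_on UNIV (g ^^ n)" by (rule continuous_on_funpow[OF g(1)])
      show "(G ^^ n) ((g ^^ n) y) = y" for y by (rule funpow_inverse) (rule g)
    qed
  qed (rule H)
qed

subsection \<open>Haar integrals in coordinates\<close>

abbreviation vec2 :: "real \<Rightarrow> real \<Rightarrow> real^2" where
  "vec2 x y \<equiv> vector [x, y]"

lemma vec2_eq_axis: "vec2 x y = x *\<^sub>R axis 1 1 + y *\<^sub>R axis 2 1"
  by (simp add: vec_eq_iff forall_2 axis_def)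

lemma vec2_eta [simp]: "vec2 (p $ 1) (p $ 2) = p"
  by (simp add: vec_eq_iff forall_2)

lemma continuous_on_vec2 [continuous_intros]:
  "continuous_on S f \<Longrightarrow> continuous_on S g \<Longrightarrow> continuous_on S (\<lambda>x. vec2 (f x) (g x))"
  unfolding vec2_eq_axis by (intro continuous_intros)

lemma borel_measurable_vec2 [measurable]:
  assumes [measurable]: "f \<in> borel_measurable M" "g \<in> borel_measurable M"
  shows "(\<lambda>x. vec2 (f x) (g x)) \<in> borel_measurable M"
  unfolding vec2_eq_axis by measurable

lemma Basis_real2: "(Basis :: (real^2) set) = {axis 1 1, axis 2 1}"
  by (auto simp: Basis_vec_def UNIV_2)

lemma lborel_vec2: "(lborel :: (real^2) measure) = distr (lborel \<Otimes>\<^sub>M lborel) borel (\<lambda>(x, y). vec2 x y)"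
proof (rule lborel_eqI)
  fix l u :: "real^2"
  assume "\<And>b. b \<in> Basis \<Longrightarrow> l \<bullet> b \<le> u \<bullet> b"
  from this[of "axis 1 1"] this[of "axis 2 1"] have lu: "l $ 1 \<le> u $ 1" "l $ 2 \<le> u $ 2"
    by (simp_all add: Basis_real2 inner_axis)
  have ne: "axis 1 (1::real) \<noteq> (axis 2 1 :: real^2)"
    by (simp add: axis_eq_axis)
  have pre: "(\<lambda>(x, y). vec2 x y) -` box l u \<inter> space (lborel \<Otimes>\<^sub>M lborel) = {l$1<..<u$1} \<times> {l$2<..<u$2}"
    by (auto simp: mem_box_cart forall_2 space_pair_measure)
  have "emeasure (distr (lborel \<Otimes>\<^sub>M lborel) borel (\<lambda>(x, y). vec2 x y)) (box l u)
      = emeasure (lborel \<Otimes>\<^sub>M lborel) ({l$1<..<u$1} \<times> {l$2<..<u$2})"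
    by (subst emeasure_distr) (auto simp: pre)
  also have "\<dots> = emeasure lborel {l$1<..<u$1} * emeasure lborel {l$2<..<u$2}"
    by (rule lborel.emeasure_pair_measure_Times) auto
  also have "\<dots> = (\<Prod>b\<in>Basis. (u - l) \<bullet> b)"
    using lu ne by (simp add: Basis_real2 inner_axis ennreal_mult')
  finally show "emeasure (distr (lborel \<Otimes>\<^sub>M lborel) borel (\<lambda>(x, y). vec2 x y)) (box l u)
      = (\<Prod>b\<in>Basis. (u - l) \<bullet> b)" .
qed simp

section \<open>Integration over the circle and the torus\<close>

definition unit_int :: "(real \<Rightarrow> ennreal) \<Rightarrow> ennreal" where
  "unit_int \<phi> = (\<integral>\<^sup>+x. \<phi> x * indicator {0..<1} x \<partial>lborel)"

lemma nn_integral_interval_shift: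
  fixes a b c :: real
  assumes [measurable]: "\<phi> \<in> borel_measurable borel"
  shows "(\<integral>\<^sup>+x. \<phi> x * indicator {a..<b} x \<partial>lborel)
    = (\<integral>\<^sup>+x. \<phi> (x + c) * indicator {a - c..<b - c} x \<partial>lborel)"
  by (subst nn_integral_real_affine[where c = 1 and t = c])
    (auto intro!: nn_integral_cong simp: add.commute split: split_indicator)

lemma nn_integral_interval_split:
  fixes a b c :: real
  assumes [measurable]: "\<phi> \<in> borel_measurable borel" and "a \<le> b" "b \<le> c"
  shows "(\<integral>\<^sup>+x. \<phi> x * indicator {a..<c} x \<partial>lborel)
    = (\<integral>\<^sup>+x. \<phi> x * indicator {a..<b} x \<partial>lborel) + (\<integral>\<^sup>+x. \<phi> x * indicator {b..<c} x \<partial>lborel)"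
  by (subst nn_integral_add[symmetric])
    (use assms(2,3) in \<open>auto intro!: nn_integral_cong split: split_indicator\<close>)

lemma periodic_of_nat:
  fixes \<phi> :: "real \<Rightarrow> 'a"
  assumes per: "\<And>x. \<phi> (x + 1) = \<phi> x"
  shows "\<phi> (x + real n) = \<phi> x"
proof (induction n)
  case (Suc n)
  then show ?case using per[of "x + real n"] by (simp add: add_ac)
qed simp

lemma periodic_of_int:
  fixes \<phi> :: "real \<Rightarrow> 'a"
  assumes per: "\<And>x. \<phi> (x + 1) = \<phi> x"
  shows "\<phi> (x + of_int k) = \<phi> x"
proof (cases "0 \<le> k")
  case True
  then show ?thesis using periodic_of_nat[of \<phi> x "nat k", OF per] by simp
next
  case False
  then show ?thesis using periodic_of_nat[of \<phi> "x + of_int k" "nat (- k)", OF per] by simp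
qed

context
  fixes \<phi> :: "real \<Rightarrow> ennreal"
  assumes meas [measurable]: "\<phi> \<in> borel_measurable borel"
    and per: "\<And>x. \<phi> (x + 1) = \<phi> x"
begin

text \<open>Periodicity reduces the shift to one between 0 and 1; the piece pushed beyond 1 is then
  moved back by one period.\<close>

lemma unit_int_shift: "unit_int (\<lambda>x. \<phi> (x + c)) = unit_int \<phi>"
proof -
  define t where "t = c - of_int \<lfloor>c\<rfloor>"
  have t: "0 \<le> t" "t \<le> 1" unfolding t_def by linarith+
  have "\<phi> (x + c) = \<phi> (x + t)" for x
    using periodic_of_int[of \<phi> "x + t" "\<lfloor>c\<rfloor>", OF per] by (simp add: t_def)
  then have "unit_int (\<lambda>x. \<phi> (x + c)) = (\<integral>\<^sup>+x. \<phi> (x + t) * indicator {t - t..<(1 + t) - t} x \<partial>lborel)"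
    by (simp add: unit_int_def)
  also have "\<dots> = (\<integral>\<^sup>+x. \<phi> x * indicator {t..<1 + t} x \<partial>lborel)"
    by (rule nn_integral_interval_shift[symmetric]) simp
  also have "\<dots> = (\<integral>\<^sup>+x. \<phi> x * indicator {t..<1} x \<partial>lborel) + (\<integral>\<^sup>+x. \<phi> x * indicator {1..<1 + t} x \<partial>lborel)"
    by (rule nn_integral_interval_split) (use t in auto)
  also have "(\<integral>\<^sup>+x. \<phi> x * indicator {1..<1 + t} x \<partial>lborel) = (\<integral>\<^sup>+x. \<phi> x * indicator {0..<t} x \<partial>lborel)"
    by (subst nn_integral_interval_shift[where c = 1]) (auto simp: per)
  also have "(\<integral>\<^sup>+x. \<phi> x * indicator {t..<1} x \<partial>lborel) + (\<integral>\<^sup>+x. \<phi> x * indicator {0..<t} x \<partial>lborel) = unit_int \<phi>"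
    unfolding unit_int_def
    by (subst nn_integral_interval_split[where a = 0 and b = t and c = 1]) (use t in \<open>auto simp: add.commute\<close>)
  finally show ?thesis .
qed

text \<open>The integral over \<open>{0..<real n}\<close> is computed twice: as a sum over
  \<open>n\<close> periods and by rescaling to the unit interval.\<close>

lemma unit_int_scale_nat:
  assumes n: "n > 0" shows "unit_int (\<lambda>x. \<phi> (real n * x)) = unit_int \<phi>"
proof -
  have sum: "(\<integral>\<^sup>+x. \<phi> x * indicator {0..<real n} x \<partial>lborel) = of_nat n * unit_int \<phi>" for n
  proof (induction n)
    case (Suc n)
    have "(\<integral>\<^sup>+x. \<phi> x * indicator {0..<real (Suc n)} x \<partial>lborel)
       = (\<integral>\<^sup>+x. \<phi> x * indicator {0..<real n} x \<partial>lborel) + (\<integral>\<^sup>+x. \<phi> x * indicator {real n..<real (Suc n)} x \<partial>lborel)"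
      by (rule nn_integral_interval_split) auto
    also have "(\<integral>\<^sup>+x. \<phi> x * indicator {real n..<real (Suc n)} x \<partial>lborel) = unit_int \<phi>"
      unfolding unit_int_def
      by (subst nn_integral_interval_shift[where c = "real n"]) (auto simp: periodic_of_nat[of \<phi>, OF per])
    finally show ?case using Suc by (simp add: algebra_simps)
  qed (simp add: unit_int_def)
  have "of_nat n * unit_int \<phi> = (\<integral>\<^sup>+x. \<phi> x * indicator {0..<real n} x \<partial>lborel)"
    by (rule sum[symmetric])
  also have "\<dots> = of_nat n * unit_int (\<lambda>x. \<phi> (real n * x))"
    unfolding unit_int_def
    by (subst nn_integral_real_affine[where c = "real n" and t = 0])
      (use n in \<open>auto intro!: arg_cong2[where f = "(*)"] nn_integral_cong
        simp: ennreal_of_nat_eq_real_of_nat zero_le_mult_iff split: split_indicator\<close>)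
  finally show ?thesis
    using n by (subst (asm) ennreal_mult_cancel_left) auto
qed

end

lemma unit_int_affine:
  fixes \<phi> :: "real \<Rightarrow> ennreal"
  assumes meas [measurable]: "\<phi> \<in> borel_measurable borel"
    and per: "\<And>x. \<phi> (x + 1) = \<phi> x"
    and m: "m \<noteq> (0::int)"
  shows "unit_int (\<lambda>x. \<phi> (of_int m * x + c)) = unit_int \<phi>"
proof -
  define n where "n = nat \<bar>m\<bar>"
  have n: "n > 0" using m by (simp add: n_def)
  have scale: "unit_int (\<lambda>x. \<phi> (real n * x + d)) = unit_int \<phi>" for d
  proof -
    have "unit_int (\<lambda>x. \<phi> (real n * x + d)) = unit_int (\<lambda>x. \<phi> (real n * (x + d / real n)))"
      using n by (simp add: distrib_left)
    also have "\<dots> = unit_int (\<lambda>x. \<phi> (real n * x))"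
    proof (rule unit_int_shift)
      show "\<phi> (real n * (x + 1)) = \<phi> (real n * x)" for x
        using periodic_of_nat[of \<phi> "real n * x" n, OF per] by (simp add: distrib_left)
    qed measurable
    also have "\<dots> = unit_int \<phi>" by (rule unit_int_scale_nat[OF meas per n])
    finally show ?thesis .
  qed
  show ?thesis
  proof (cases "m > 0")
    case True
    then have "real_of_int m = real n" by (simp add: n_def)
    then show ?thesis using scale by simp
  next
    case False
    then have mn: "real_of_int m = - real n" by (simp add: n_def)
    have "unit_int (\<lambda>x. \<phi> (of_int m * x + c))
       = (\<integral>\<^sup>+x. \<phi> (of_int m * (1 - x) + c) * indicator {0..<1} (1 - x) \<partial>lborel)"
      unfolding unit_int_def
      by (subst nn_integral_real_affine[where c = "-1" and t = 1]) auto
    \<comment> \<open>The reflection turns the half-open interval around; the two versions differ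
      only at the end points, which are null.\<close>
    also have "\<dots> = (\<integral>\<^sup>+x. \<phi> (of_int m * (1 - x) + c) * indicator {0..<1} x \<partial>lborel)"
    proof (rule nn_integral_cong_AE)
      have "AE x in lborel. x \<noteq> (0::real)" "AE x in lborel. x \<noteq> (1::real)"
        by (rule AE_lborel_singleton)+
      then show "AE x in lborel. \<phi> (of_int m * (1 - x) + c) * indicator {0..<1} (1 - x)
         = \<phi> (of_int m * (1 - x) + c) * indicator {0..<1} x"
        by eventually_elim (auto split: split_indicator)
    qed
    also have "\<dots> = unit_int (\<lambda>x. \<phi> (real n * x + (c - real n)))"
      unfolding unit_int_def by (simp add: mn algebra_simps)
    finally show ?thesis using scale by simp
  qed
qed

lemma sets_torus_haar [simp, measurable_cong]: "sets torus_haar = sets borel"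
  and space_torus_haar [simp]: "space torus_haar = UNIV"
  by (simp_all add: torus_haar_def)

lemma borel_measurable_to_torus [measurable]: "to_torus \<in> borel_measurable borel"
  by (rule borel_measurable_continuous_onI[OF continuous_on_to_torus])

text \<open>Both orders of integration are recorded because \<open>f\<close> exchanges the roles of
  the coordinates: its invariance starts from one order and ends in the other.\<close>

lemma nn_integral_torus_haar:
  assumes f [measurable]: "f \<in> borel_measurable borel"
  shows "(\<integral>\<^sup>+x. f x \<partial>torus_haar) = unit_int (\<lambda>x. unit_int (\<lambda>y. f (to_torus (vec2 x y))))"
    and "(\<integral>\<^sup>+x. f x \<partial>torus_haar) = unit_int (\<lambda>y. unit_int (\<lambda>x. f (to_torus (vec2 x y))))"
proof -
  let ?S = "{p :: real^2. \<forall>i. 0 \<le> p $ i \<and> p $ i < 1}"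
  let ?h = "\<lambda>x y. f (to_torus (vec2 x y)) * indicator {0..<1} x * indicator {0..<1} y :: ennreal"
  have S[measurable]: "?S \<in> sets borel" by measurable
  have "(\<integral>\<^sup>+x. f x \<partial>torus_haar) = (\<integral>\<^sup>+p. f (to_torus p) \<partial>restrict_space lborel ?S)"
    unfolding torus_haar_def
    by (intro nn_integral_distr measurable_restrict_space1) auto
  also have "\<dots> = (\<integral>\<^sup>+p. f (to_torus p) * indicator ?S p \<partial>lborel)"
    by (rule nn_integral_restrict_space) simp
  also have "\<dots> = (\<integral>\<^sup>+z. ?h (fst z) (snd z) \<partial>(lborel \<Otimes>\<^sub>M lborel))"
    by (subst lborel_vec2, subst nn_integral_distr)
      (auto intro!: nn_integral_cong simp: forall_2 split: split_indicator)
  finally have *: "(\<integral>\<^sup>+x. f x \<partial>torus_haar) = (\<integral>\<^sup>+z. ?h (fst z) (snd z) \<partial>(lborel \<Otimes>\<^sub>M lborel))" .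
  have "(\<integral>\<^sup>+z. ?h (fst z) (snd z) \<partial>(lborel \<Otimes>\<^sub>M lborel)) = (\<integral>\<^sup>+x. \<integral>\<^sup>+y. ?h x y \<partial>lborel \<partial>lborel)"
    by (subst lborel.nn_integral_fst[symmetric]) auto
  also have "\<dots> = unit_int (\<lambda>x. unit_int (\<lambda>y. f (to_torus (vec2 x y))))"
    unfolding unit_int_def
    by (intro nn_integral_cong) (auto simp: mult_ac nn_integral_multc[symmetric] split: split_indicator)
  finally show "(\<integral>\<^sup>+x. f x \<partial>torus_haar) = unit_int (\<lambda>x. unit_int (\<lambda>y. f (to_torus (vec2 x y))))"
    using * by simp
  have "(\<integral>\<^sup>+z. ?h (fst z) (snd z) \<partial>(lborel \<Otimes>\<^sub>M lborel)) = (\<integral>\<^sup>+y. \<integral>\<^sup>+x. ?h x y \<partial>lborel \<partial>lborel)"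
    by (subst lborel_pair.nn_integral_snd[symmetric]) auto
  also have "\<dots> = unit_int (\<lambda>y. unit_int (\<lambda>x. f (to_torus (vec2 x y))))"
    unfolding unit_int_def
    by (intro nn_integral_cong) (auto simp: mult_ac nn_integral_multc[symmetric] split: split_indicator)
  finally show "(\<integral>\<^sup>+x. f x \<partial>torus_haar) = unit_int (\<lambda>y. unit_int (\<lambda>x. f (to_torus (vec2 x y))))"
    using * by simp
qed

lemma borel_measurable_unit_int [measurable]:
  assumes [measurable]: "(\<lambda>(x, y). f x y) \<in> borel_measurable (M \<Otimes>\<^sub>M borel)"
  shows "(\<lambda>x. unit_int (f x)) \<in> borel_measurable M"
  unfolding unit_int_def by measurable

lemma to_torus_vec2_shift: "to_torus (vec2 (x + of_int k) (y + of_int l)) = to_torus (vec2 x y)"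
  by (simp add: to_torus_eq int_vec_def forall_2)

lemma to_torus_vec2_periodic:
  "to_torus (vec2 (x + 1) y) = to_torus (vec2 x y)" "to_torus (vec2 x (y + 1)) = to_torus (vec2 x y)"
  using to_torus_vec2_shift[of x 1 y 0] to_torus_vec2_shift[of x 0 y 1] by simp_all

text \<open>For \<open>c = k / D\<close> and a suitable \<open>a\<close> this transformation moves
  each point to another point of its fibre under \<open>f\<close>; \<open>moment_step\<close> uses
  it to average over fibres.\<close>

lemma nn_integral_torus_skew_shift:
  assumes f [measurable]: "f \<in> borel_measurable borel" and a [measurable]: "a \<in> borel_measurable borel"
  shows "unit_int (\<lambda>y. unit_int (\<lambda>x. f (to_torus (vec2 (x + a y) (y + c))))) = (\<integral>\<^sup>+x. f x \<partial>torus_haar)"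
proof -
  have "unit_int (\<lambda>x. f (to_torus (vec2 (x + a y) (y + c)))) = unit_int (\<lambda>x. f (to_torus (vec2 x (y + c))))" for y
    by (rule unit_int_shift[where \<phi> = "\<lambda>x. f (to_torus (vec2 x (y + c)))"])
      (auto simp: to_torus_vec2_periodic)
  then have "unit_int (\<lambda>y. unit_int (\<lambda>x. f (to_torus (vec2 (x + a y) (y + c)))))
     = unit_int (\<lambda>y. unit_int (\<lambda>x. f (to_torus (vec2 x (y + c)))))" by simp
  also have "\<dots> = unit_int (\<lambda>y. unit_int (\<lambda>x. f (to_torus (vec2 x y))))"
    by (rule unit_int_shift[where \<phi> = "\<lambda>y. unit_int (\<lambda>x. f (to_torus (vec2 x y)))"])
      (auto simp: to_torus_vec2_periodic)
  finally show ?thesis by (simp add: nn_integral_torus_haar(2))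
qed

text \<open>The invariance computation for \<open>f\<close>: for fixed \<open>y\<close> the second
  coordinate is a translate of \<open>x\<close>, and what remains is multiplication by
  \<open>m\<close> on the circle.\<close>

lemma nn_integral_torus_henon:
  assumes f [measurable]: "f \<in> borel_measurable borel" and a [measurable]: "a \<in> borel_measurable borel"
    and m: "m \<noteq> (0::int)"
  shows "unit_int (\<lambda>y. unit_int (\<lambda>x. f (to_torus (vec2 (of_int m * y) (x + a y))))) = (\<integral>\<^sup>+x. f x \<partial>torus_haar)"
proof -
  have "unit_int (\<lambda>x. f (to_torus (vec2 (of_int m * y) (x + a y)))) = unit_int (\<lambda>x. f (to_torus (vec2 (of_int m * y) x)))" for y
    by (rule unit_int_shift[where \<phi> = "\<lambda>x. f (to_torus (vec2 (of_int m * y) x))"])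
      (auto simp: to_torus_vec2_periodic)
  then have "unit_int (\<lambda>y. unit_int (\<lambda>x. f (to_torus (vec2 (of_int m * y) (x + a y)))))
     = unit_int (\<lambda>y. unit_int (\<lambda>x. f (to_torus (vec2 (of_int m * y) x))))" by simp
  also have "\<dots> = unit_int (\<lambda>y. unit_int (\<lambda>x. f (to_torus (vec2 y x))))"
    using unit_int_affine[where \<phi> = "\<lambda>y. unit_int (\<lambda>x. f (to_torus (vec2 y x)))" and c = 0, OF _ _ m]
    by (auto simp: to_torus_vec2_periodic)
  finally show ?thesis by (simp add: nn_integral_torus_haar(1))
qed

subsection \<open>Averaged growth over preimages\<close>

text \<open>The cosine takes each value at most twice per period. Quantitatively, if two of the
  values are close, the product formula for a difference of cosines makes the sine of the mean angle
  small, since the sine of the half difference is at least \<open>\<sigma>\<close>. Three close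
  values would give two mean angles with small sines, whose difference is again a half difference, a
  contradiction.\<close>

lemma cos_equidistant_separation:
  fixes D :: nat
  assumes D: "D \<ge> 2"
  obtains \<kappa> :: real where "\<kappa> > 0"
    "\<And>y s. card {k\<in>{..<D}. \<bar>cos (2 * pi * (y + real k / real D)) - s\<bar> < \<kappa>} \<le> 2"
proof -
  define \<sigma> where "\<sigma> = Min ((\<lambda>j. sin (pi * real j / real D)) ` {1..<D})"
  have sin_pos: "sin (pi * real j / real D) > 0" if "j \<in> {1..<D}" for j
    using that by (intro sin_gt_zero) (auto simp: field_simps)
  have \<sigma>: "\<sigma> > 0" unfolding \<sigma>_def using D sin_pos by (subst Min_gr_iff) auto
  have sep: "\<sigma> \<le> \<bar>sin (pi * (real k - real l) / real D)\<bar>" if "k < D" "l < D" "k \<noteq> l" for k l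
  proof -
    have *: "\<sigma> \<le> sin (pi * (real k - real l) / real D)" if "l < k" "k < D" for k l
    proof -
      have "\<sigma> \<le> sin (pi * real (k - l) / real D)"
        unfolding \<sigma>_def using that by (intro Min_le image_eqI[of _ _ "k - l"]) auto
      then show ?thesis using that by (simp add: of_nat_diff)
    qed
    show ?thesis
    proof (cases "l < k")
      case True
      then show ?thesis using *[of l k] that by linarith
    next
      case False
      have "sin (pi * (real k - real l) / real D) = - sin (pi * (real l - real k) / real D)"
        by (simp flip: sin_minus add: minus_divide_left algebra_simps)
      then show ?thesis using *[of k l] that False by linarith
    qed
  qed
  \<comment> \<open>Chosen so that \<open>\<kappa> / \<sigma> = \<sigma> / 4\<close>: the sines of
    two mean angles still add up to less than \<open>\<sigma>\<close>.\<close>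
  define \<kappa> where "\<kappa> = \<sigma>\<^sup>2 / 4"
  have "card {k\<in>{..<D}. \<bar>cos (2 * pi * (y + real k / real D)) - s\<bar> < \<kappa>} \<le> 2" (is "card ?B \<le> 2") for y s
  proof (rule ccontr)
    assume "\<not> ?thesis"
    then obtain B where "B \<subseteq> ?B" "card B = 3"
      using obtain_subset_with_card_n[of 3 ?B] by auto
    then obtain k l m where klm: "k \<in> ?B" "l \<in> ?B" "m \<in> ?B" "k \<noteq> l" "k \<noteq> m" "l \<noteq> m"
      unfolding card_3_iff by blast
    let ?P = "\<lambda>k l. pi * (2 * y + (real k + real l) / real D)"
    have small: "\<bar>sin (?P k l)\<bar> < \<sigma> / 4" if "k \<in> ?B" "l \<in> ?B" "k \<noteq> l" for k l
    proof -
      let ?a = "2 * pi * (y + real k / real D)" and ?b = "2 * pi * (y + real l / real D)"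
      have "cos ?a - cos ?b = 2 * sin ((?a + ?b) / 2) * sin ((?b - ?a) / 2)"
        by (rule cos_diff_cos)
      also have "(?a + ?b) / 2 = ?P k l"
        using D by (simp add: field_simps)
      also have "(?b - ?a) / 2 = pi * (real l - real k) / real D"
        using D by (simp add: field_simps)
      finally have "2 * \<bar>sin (?P k l)\<bar> * \<bar>sin (pi * (real l - real k) / real D)\<bar> = \<bar>cos ?a - cos ?b\<bar>"
        by (simp add: abs_mult)
      also have "\<dots> < 2 * \<kappa>" using that by auto
      finally have "\<bar>sin (?P k l)\<bar> * \<bar>sin (pi * (real l - real k) / real D)\<bar> < \<kappa>" by simp
      moreover have "\<bar>sin (?P k l)\<bar> * \<sigma> \<le> \<bar>sin (?P k l)\<bar> * \<bar>sin (pi * (real l - real k) / real D)\<bar>"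
        using sep[of l k] that by (intro mult_left_mono) auto
      ultimately have "\<bar>sin (?P k l)\<bar> * \<sigma> < \<sigma> / 4 * \<sigma>" by (simp add: \<kappa>_def power2_eq_square)
      then show ?thesis using \<sigma> by simp
    qed
    have "pi * (real l - real m) / real D = ?P k l - ?P k m"
      using D by (simp add: field_simps)
    then have "\<bar>sin (pi * (real l - real m) / real D)\<bar>
        = \<bar>sin (?P k l) * cos (?P k m) - cos (?P k l) * sin (?P k m)\<bar>"
      by (simp only: sin_diff)
    also have "\<dots> \<le> \<bar>sin (?P k l)\<bar> * \<bar>cos (?P k m)\<bar> + \<bar>cos (?P k l)\<bar> * \<bar>sin (?P k m)\<bar>"
      unfolding abs_mult[symmetric] by (rule abs_triangle_ineq4)
    also have "\<dots> \<le> \<bar>sin (?P k l)\<bar> * 1 + 1 * \<bar>sin (?P k m)\<bar>"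
      by (intro add_mono mult_mono) auto
    also have "\<dots> < \<sigma>" using small[of k l] small[of k m] klm \<sigma> by auto
    finally show False using sep[of l m] klm by auto
  qed
  then show thesis using \<sigma> by (intro that[of \<kappa>]) (simp_all add: \<kappa>_def)
qed

text \<open>The weight is tuned to \<open>K = R^2\<close>. At a good point a vector dominated by
  either coordinate gains a factor of order \<open>R\<close>: a dominant \<open>a\<close> is
  multiplied by a number of order \<open>K\<close>, and a dominant \<open>b\<close> moves to the
  unweighted coordinate. At a bad point the loss is of order \<open>R^2\<close>.\<close>

definition wnorm :: "real \<Rightarrow> real \<Rightarrow> real \<Rightarrow> real" where
  "wnorm R a b = max \<bar>a\<bar> (\<bar>b\<bar> / R)"

lemma wnorm_pos: "R > 0 \<Longrightarrow> (a, b) \<noteq> (0, 0) \<Longrightarrow> wnorm R a b > 0"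
  by (auto simp: wnorm_def less_max_iff_disj)

text \<open>The vector \<open>(b + (\<tau> + K c) a / d, - a / d)\<close> is the image of \<open>(a, b)\<close> under the inverse
  derivative at a point with \<open>cos (2 \<pi> y) = c\<close>.\<close>

lemma inverse_derivative_growth:
  fixes R M \<kappa> \<tau> d a b c :: real
  assumes d: "d \<noteq> 0" and R: "R \<ge> 1" and K: "K = R\<^sup>2" "\<bar>\<tau>\<bar> \<le> K" and \<kappa>: "\<kappa> > 0" and c: "\<bar>c\<bar> \<le> 1"
    and M: "4 / \<kappa> \<le> M" "\<bar>d\<bar> / \<kappa> \<le> M" "\<bar>d\<bar> \<le> M" "4 \<le> M"
  defines "a' \<equiv> b + (\<tau> + K * c) * a / d" and "b' \<equiv> - a / d"
  shows "wnorm R a b / (M * R\<^sup>2) \<le> wnorm R a' b'"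
    and "\<kappa> \<le> \<bar>c - (- (\<tau> + d * b / a) / K)\<bar> \<Longrightarrow> wnorm R a b * R / M \<le> wnorm R a' b'"
proof -
  have Kpos: "K > 0" and R2: "R \<le> R\<^sup>2" "1 \<le> R\<^sup>2"
    using R K by (auto simp: power2_eq_square mult_ge1_I)
  have Mpos: "M > 0" using M by simp
  have slope: "\<bar>\<tau> + K * c\<bar> \<le> 2 * K"
  proof -
    have "\<bar>K * c\<bar> \<le> K * 1" unfolding abs_mult using c Kpos by (intro mult_mono) auto
    then show ?thesis using K(2) by linarith
  qed
  \<comment> \<open>For \<open>a\<close> this small the term carrying \<open>c\<close> is at most
    half of \<open>b\<close> in absolute value, whatever \<open>c\<close> is.\<close>
  have small: "\<bar>b\<bar> / 2 \<le> wnorm R a' b'" if "\<bar>a\<bar> \<le> \<bar>b\<bar> * \<bar>d\<bar> / (4 * K)"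
  proof -
    define X where "X = (\<tau> + K * c) * a / d"
    have "\<bar>X\<bar> \<le> 2 * K * (\<bar>b\<bar> * \<bar>d\<bar> / (4 * K)) / \<bar>d\<bar>"
      unfolding X_def abs_mult abs_divide using slope that Kpos by (intro divide_right_mono mult_mono) auto
    also have "\<dots> = \<bar>b\<bar> / 2" using Kpos d by simp
    finally have "\<bar>b\<bar> / 2 \<le> \<bar>b + X\<bar>" by linarith
    then have "\<bar>b\<bar> / 2 \<le> \<bar>a'\<bar>" by (simp add: a'_def X_def)
    then show ?thesis unfolding wnorm_def by (rule order_trans[OF _ max.cobounded1])
  qed
  have second: "\<bar>a\<bar> / (\<bar>d\<bar> * R) \<le> wnorm R a' b'"
    by (simp add: wnorm_def b'_def)
  show "wnorm R a b / (M * R\<^sup>2) \<le> wnorm R a' b'"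
  proof (cases "\<bar>b\<bar> / R \<le> \<bar>a\<bar>")
    case True
    then have "wnorm R a b / (M * R\<^sup>2) = \<bar>a\<bar> / (M * R\<^sup>2)" by (simp add: wnorm_def)
    also have "\<dots> \<le> \<bar>a\<bar> / (\<bar>d\<bar> * R)"
      using M R d R2 Mpos by (intro divide_left_mono mult_mono mult_pos_pos) auto
    finally show ?thesis using second by simp
  next
    case False
    then have N: "wnorm R a b = \<bar>b\<bar> / R" by (simp add: wnorm_def)
    show ?thesis
    proof (cases "\<bar>a\<bar> \<le> \<bar>b\<bar> * \<bar>d\<bar> / (4 * K)")
      case True
      have MR: "1 \<le> R * R\<^sup>2" using R R2 by (intro mult_ge1_I) auto
      have "wnorm R a b / (M * R\<^sup>2) = \<bar>b\<bar> / (M * (R * R\<^sup>2))" by (simp add: N mult_ac)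
      also have "\<dots> \<le> \<bar>b\<bar> / (2 * 1)"
        using M MR Mpos R R2 by (intro divide_left_mono mult_mono mult_pos_pos) auto
      also have "\<dots> = \<bar>b\<bar> / 2" by simp
      also note small[OF True]
      finally show ?thesis .
    next
      \<comment> \<open>The worst case: \<open>a'\<close> may cancel completely, and only
        \<open>b'\<close> keeps a fraction of order \<open>1 / R^2\<close> of the norm.\<close>
      case False
      have "wnorm R a b / (M * R\<^sup>2) = (\<bar>b\<bar> / R) / (M * R\<^sup>2)" by (simp add: N)
      also have "\<dots> \<le> (\<bar>b\<bar> / R) / (4 * R\<^sup>2)"
        using M R R2 Mpos by (intro divide_left_mono mult_mono mult_pos_pos) auto
      also have "\<dots> = (\<bar>b\<bar> * \<bar>d\<bar> / (4 * K)) / (\<bar>d\<bar> * R)" using d R by (simp add: K(1) field_simps)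
      also have "\<dots> \<le> \<bar>a\<bar> / (\<bar>d\<bar> * R)" using False R by (intro divide_right_mono) auto
      finally show ?thesis using second by simp
    qed
  qed
  assume good: "\<kappa> \<le> \<bar>c - (- (\<tau> + d * b / a) / K)\<bar>"
  \<comment> \<open>For \<open>a \<noteq> 0\<close> the number subtracted from \<open>c\<close> is
    the one value at which \<open>a'\<close> vanishes, and \<open>a'\<close> is
    \<open>K * a / d\<close> times the difference.\<close>
  have large: "\<kappa> * K * \<bar>a\<bar> / \<bar>d\<bar> \<le> \<bar>a'\<bar>" if "a \<noteq> 0"
  proof -
    have "a' = (c - (- (\<tau> + d * b / a) / K)) * (K * a / d)"
      unfolding a'_def using that d Kpos by (simp add: field_simps)
    then have "\<bar>a'\<bar> = \<bar>c - (- (\<tau> + d * b / a) / K)\<bar> * (K * \<bar>a\<bar> / \<bar>d\<bar>)"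
      using Kpos by (simp add: abs_mult)
    moreover have "\<kappa> * (K * \<bar>a\<bar> / \<bar>d\<bar>) \<le> \<bar>c - (- (\<tau> + d * b / a) / K)\<bar> * (K * \<bar>a\<bar> / \<bar>d\<bar>)"
      using good Kpos by (intro mult_right_mono) auto
    ultimately show ?thesis by (simp add: mult_ac)
  qed
  show "wnorm R a b * R / M \<le> wnorm R a' b'"
  proof (cases "\<bar>b\<bar> / R \<le> \<bar>a\<bar>")
    case True
    then have N: "wnorm R a b = \<bar>a\<bar>" by (simp add: wnorm_def)
    have "\<bar>a\<bar> * R / M \<le> \<kappa> * K * \<bar>a\<bar> / \<bar>d\<bar>"
    proof -
      have "1 / M \<le> \<kappa> / \<bar>d\<bar>" using M(2) Mpos \<kappa> d by (simp add: field_simps)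
      then have "(\<bar>a\<bar> * R) * (1 / M) \<le> (\<bar>a\<bar> * K) * (\<kappa> / \<bar>d\<bar>)"
        using R R2 K Mpos by (intro mult_mono) auto
      then show ?thesis by (simp add: mult_ac)
    qed
    also have "\<dots> \<le> \<bar>a'\<bar>" using large by (cases "a = 0") auto
    finally show ?thesis by (simp add: N) (simp add: wnorm_def)
  next
    case False
    then have N: "wnorm R a b * R / M = \<bar>b\<bar> / M" using R by (simp add: wnorm_def)
    show ?thesis
    proof (cases "\<bar>a\<bar> \<le> \<bar>b\<bar> * \<bar>d\<bar> / (4 * K)")
      case True
      have "\<bar>b\<bar> / M \<le> \<bar>b\<bar> / 2" using M by (intro divide_left_mono) auto
      also note small[OF True]
      finally show ?thesis unfolding N .
    next
      case False
      then have "a \<noteq> 0" using Kpos by (auto simp: divide_simps)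
      have "1 / M \<le> \<kappa> / 4" using M(1) Mpos \<kappa> by (simp add: field_simps)
      then have "\<bar>b\<bar> * (1 / M) \<le> \<bar>b\<bar> * (\<kappa> / 4)" by (intro mult_left_mono) auto
      also have "\<dots> = \<kappa> * K * (\<bar>b\<bar> * \<bar>d\<bar> / (4 * K)) / \<bar>d\<bar>" using Kpos d by simp
      also have "\<dots> \<le> \<kappa> * K * \<bar>a\<bar> / \<bar>d\<bar>"
        using False \<kappa> Kpos by (intro divide_right_mono mult_left_mono) auto
      also have "\<dots> \<le> \<bar>a'\<bar>" using large \<open>a \<noteq> 0\<close> by simp
      also have "\<bar>a'\<bar> \<le> wnorm R a' b'" by (simp add: wnorm_def)
      finally show ?thesis unfolding N by simp
    qed
  qed
qed

text \<open>Bernoulli's inequality gives \<open>(51 / 50) ^ 100 \<ge> 3\<close>. The exponent comes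
  from the choice \<open>R = M ^ 100\<close> below.\<close>

lemma two_powr_hundredth: "(2::real) powr (1 / 100) \<le> 51 / 50"
proof (rule ccontr)
  let ?x = "(2::real) powr (1 / 100)"
  assume "\<not> ?thesis"
  then have "(51 / 50) ^ 100 \<le> ?x ^ 100" by (intro power_mono) auto
  also have "?x ^ 100 = 2" by (simp add: powr_power)
  finally show False using Bernoulli_inequality[of "1 / 50 :: real" 100] by simp
qed

text \<open>Relative to the old moment, a good preimage contributes at most
  \<open>1 / 2 * (51 / 50)\<close> and each of the at most two bad ones at most
  \<open>4 * (51 / 50)\<close>. Counting all D preimages as good and using
  \<open>2 \<le> 2 / 17 * D\<close>, the average is at most 51/100 + 48/100 = 99/100.\<close>

lemma averaged_contraction:
  fixes d :: int and \<tau> :: real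
  assumes "\<bar>d\<bar> \<ge> 17"
  shows "\<exists>R \<theta> K. R \<ge> 1 \<and> \<theta> > 0 \<and> K > 0 \<and> (\<forall>a b y. (a, b) \<noteq> (0, 0) \<longrightarrow>
      (\<Sum>k<nat \<bar>d\<bar>. wnorm R (b + (\<tau> + K * cos (2 * pi * (y + real k / real (nat \<bar>d\<bar>)))) * a / d) (- a / d) powr (- \<theta>))
        \<le> real (nat \<bar>d\<bar>) * (99 / 100 * wnorm R a b powr (- \<theta>)))"
proof -
  define D where "D = nat \<bar>d\<bar>"
  have D: "D \<ge> 17" "real D = \<bar>real_of_int d\<bar>" using assms by (auto simp: D_def)
  obtain \<kappa> :: real where \<kappa>: "\<kappa> > 0"
    and few: "\<And>y s. card {k\<in>{..<D}. \<bar>cos (2 * pi * (y + real k / real D)) - s\<bar> < \<kappa>} \<le> 2"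
    using cos_equidistant_separation[of D] D by auto
  \<comment> \<open>One bound for all the constants in \<open>inverse_derivative_growth\<close>; the
    last summand also yields \<open>\<bar>\<tau>\<bar> \<le> M \<le> R \<le> K\<close>.\<close>
  define M where "M = 4 / \<kappa> + real D / \<kappa> + real D + 4 + \<bar>\<tau>\<bar>"
  have M: "4 / \<kappa> \<le> M" "\<bar>real_of_int d\<bar> / \<kappa> \<le> M" "\<bar>real_of_int d\<bar> \<le> M" "4 \<le> M" "\<bar>\<tau>\<bar> \<le> M"
    unfolding M_def D(2)[symmetric] using \<kappa> by (simp_all add: add_nonneg_nonneg)
  \<comment> \<open>The high power makes the loss of a factor \<open>M\<close> negligible:
    \<open>R powr \<theta> = 2\<close> gives
    \<open>M powr \<theta> = 2 powr (1 / 100)\<close>.\<close>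
  define R where "R = M ^ 100"
  define K where "K = R\<^sup>2"
  define \<theta> where "\<theta> = ln 2 / ln R"
  have "M * 1 \<le> M * M ^ 99" using M(4) by (intro mult_left_mono one_le_power) auto
  also have "M * M ^ 99 = R" by (simp add: R_def flip: power_Suc)
  finally have MR: "M \<le> R" by simp
  then have R: "R \<ge> 1" "R > 1" using M(4) by auto
  have "R * 1 \<le> R * R" using R by (intro mult_left_mono) auto
  then have RK: "R \<le> K" by (simp add: K_def power2_eq_square)
  have \<theta>: "\<theta> > 0" using R by (simp add: \<theta>_def)
  have R\<theta>: "R powr \<theta> = 2" using R by (simp add: powr_def \<theta>_def)
  have "M powr \<theta> = 2 powr (1 / 100)"
    using M(4) R by (simp add: powr_def \<theta>_def R_def ln_realpow)
  then have M\<theta>: "M powr \<theta> \<le> 51 / 50" using two_powr_hundredth by simp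
  have "(\<Sum>k<D. wnorm R (b + (\<tau> + K * cos (2 * pi * (y + real k / real D))) * a / d) (- a / d) powr (- \<theta>))
      \<le> real D * (99 / 100 * wnorm R a b powr (- \<theta>))"
    if ab: "(a, b) \<noteq> (0, 0)" for a b y
  proof -
    define c where "c k = cos (2 * pi * (y + real k / real D))" for k :: nat
    define w where "w k = wnorm R (b + (\<tau> + K * c k) * a / d) (- a / d)" for k
    define \<nu> where "\<nu> = wnorm R a b powr (- \<theta>)"
    define B where "B = {k\<in>{..<D}. \<bar>c k - (- (\<tau> + d * b / a) / K)\<bar> < \<kappa>}"
    have N: "wnorm R a b > 0" using wnorm_pos ab R by simp
    have \<nu>: "\<nu> > 0" using N by (simp add: \<nu>_def)
    have B: "B \<subseteq> {..<D}" "card B \<le> 2" unfolding B_def c_def using few by auto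
    have d0: "real_of_int d \<noteq> 0" using D by auto
    have K': "\<bar>\<tau>\<bar> \<le> K" using M(5) MR RK by simp
    have dec: "x powr (- \<theta>) \<le> y powr (- \<theta>)" if "0 < y" "y \<le> x" for x y :: real
      using that \<theta> by (intro powr_mono2') auto
    have bad: "w k powr (- \<theta>) \<le> 4 * (51 / 50) * \<nu>" for k
    proof -
      have "wnorm R a b / (M * R\<^sup>2) \<le> w k"
        unfolding w_def c_def
        by (rule inverse_derivative_growth(1)[OF d0 R(1) K_def K' \<kappa> _ M(1-4)]) simp
      then have "w k powr (- \<theta>) \<le> (wnorm R a b / (M * R\<^sup>2)) powr (- \<theta>)"
        using N M(4) R by (intro dec) auto
      also have "\<dots> = (M powr \<theta> * (R powr \<theta> * R powr \<theta>)) * \<nu>"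
        using N M(4) R by (simp add: \<nu>_def powr_divide powr_mult powr_minus power2_eq_square field_simps)
      also have "\<dots> \<le> (51 / 50 * (2 * 2)) * \<nu>"
        using M\<theta> \<nu> by (intro mult_right_mono) (auto simp: R\<theta>)
      finally show ?thesis by simp
    qed
    have good: "w k powr (- \<theta>) \<le> 1 / 2 * (51 / 50) * \<nu>" if "k \<in> {..<D} - B" for k
    proof -
      have "wnorm R a b * R / M \<le> w k"
        unfolding w_def c_def
        by (rule inverse_derivative_growth(2)[OF d0 R(1) K_def K' \<kappa> _ M(1-4)])
          (use that in \<open>auto simp: B_def c_def\<close>)
      then have "w k powr (- \<theta>) \<le> (wnorm R a b * R / M) powr (- \<theta>)"
        using N M(4) R by (intro dec) auto
      also have "\<dots> = (M powr \<theta> / R powr \<theta>) * \<nu>"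
        using N M(4) R by (simp add: \<nu>_def powr_divide powr_mult powr_minus field_simps)
      also have "\<dots> \<le> (51 / 50 / 2) * \<nu>"
        using M\<theta> \<nu> by (intro mult_right_mono) (auto simp: R\<theta>)
      finally show ?thesis by simp
    qed
    have "(\<Sum>k<D. w k powr (- \<theta>)) = (\<Sum>k\<in>{..<D} - B. w k powr (- \<theta>)) + (\<Sum>k\<in>B. w k powr (- \<theta>))"
      by (rule sum.subset_diff) (use B in auto)
    also have "\<dots> \<le> real (card ({..<D} - B)) * (1 / 2 * (51 / 50) * \<nu>) + real (card B) * (4 * (51 / 50) * \<nu>)"
      by (intro add_mono sum_bounded_above good bad)
    also have "\<dots> \<le> real D * (1 / 2 * (51 / 50) * \<nu>) + 2 * (4 * (51 / 50) * \<nu>)"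
      using B card_mono[of "{..<D}" "{..<D} - B"] \<nu> by (intro add_mono mult_right_mono) auto
    also have "\<dots> \<le> real D * (1 / 2 * (51 / 50) * \<nu>) + (2 / 17 * real D) * (4 * (51 / 50) * \<nu>)"
      using D \<nu> by (intro add_left_mono mult_right_mono) auto
    also have "\<dots> = real D * (99 / 100 * \<nu>)" by (simp add: algebra_simps)
    finally show ?thesis by (simp add: w_def c_def \<nu>_def)
  qed
  moreover have "K > 0" using RK R by simp
  ultimately show ?thesis
    using R \<theta> by (intro exI[of _ R] exI[of _ \<theta>] exI[of _ K]) (simp add: D_def)
qed

subsection \<open>The endomorphism and its derivative cocycle\<close>

lemma matrix_vector_mult_2: "(M :: real^2^2) *v v = vec2 (M$1$1 * v$1 + M$1$2 * v$2) (M$2$1 * v$1 + M$2$2 * v$2)"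
  by (simp add: vec_eq_iff forall_2 matrix_vector_mult_def sum_2)

lemma has_derivative_component [derivative_intros]:
  "((\<lambda>p::real^'n. p $ i) has_derivative (\<lambda>h. h $ i)) F"
  by (rule bounded_linear.has_derivative[OF bounded_linear_vec_nth has_derivative_ident])

text \<open>This class is closed under directional derivatives: the linear part becomes a constant,
  and sine and cosine exchange their coefficients up to factors.\<close>

lemma C_k_trigonometric:
  fixes L :: "real^2 \<Rightarrow> real^2"
  assumes "bounded_linear L"
  shows "C_k k (\<lambda>p. c + L p + sin (2 * pi * p $ 2) *\<^sub>R u + cos (2 * pi * p $ 2) *\<^sub>R w)"
  using assms
proof (induction k arbitrary: c L u w)
  case 0
  then have "continuous_on UNIV L" by (rule linear_continuous_on)
  then show ?case by (auto intro!: continuous_intros)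
next
  case (Suc k)
  let ?F = "\<lambda>p. c + L p + sin (2 * pi * p $ 2) *\<^sub>R u + cos (2 * pi * p $ 2) *\<^sub>R w"
  have D: "(?F has_derivative (\<lambda>v. L v + sin (2 * pi * p $ 2) *\<^sub>R (- (2 * pi * v $ 2) *\<^sub>R w)
      + cos (2 * pi * p $ 2) *\<^sub>R ((2 * pi * v $ 2) *\<^sub>R u))) (at p)" for p
    by (rule derivative_eq_intros bounded_linear_imp_has_derivative[OF Suc.prems] refl)+
      (simp add: fun_eq_iff algebra_simps)
  have fd: "frechet_derivative ?F (at p) v = L v + 0 + sin (2 * pi * p $ 2) *\<^sub>R (- (2 * pi * v $ 2) *\<^sub>R w)
      + cos (2 * pi * p $ 2) *\<^sub>R ((2 * pi * v $ 2) *\<^sub>R u)" for p v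
    by (subst frechet_derivative_at[OF D[of p], symmetric]) simp
  show ?case
    unfolding C_k.simps
  proof (intro conjI allI)
    show "?F differentiable (at p)" for p
      unfolding differentiable_def by (rule exI) (rule D)
    show "C_k k (\<lambda>p. frechet_derivative ?F (at p) v)" for v
      unfolding fd by (rule Suc.IH[OF bounded_linear_zero])
  qed
qed

text \<open>Used in place of the operator norm: it is submultiplicative, comparable to that norm up
  to the factor 4, the same for a matrix and its adjugate, and visibly measurable in the
  entries.\<close>

definition entry_sum :: "real^2^2 \<Rightarrow> real" where
  "entry_sum M = \<bar>M$1$1\<bar> + \<bar>M$1$2\<bar> + \<bar>M$2$1\<bar> + \<bar>M$2$2\<bar>"

lemma entry_sum_nonneg: "0 \<le> entry_sum M"
  by (simp add: entry_sum_def)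

lemma entry_sum_mult: "entry_sum (A ** B) \<le> entry_sum A * entry_sum B"
proof -
  have *: "\<bar>x * y + z * w\<bar> \<le> \<bar>x\<bar> * \<bar>y\<bar> + \<bar>z\<bar> * \<bar>w\<bar>" for x y z w :: real
    using abs_triangle_ineq[of "x * y" "z * w"] by (simp add: abs_mult)
  let ?r = "\<lambda>i j. \<bar>A$i$1\<bar> * \<bar>B$1$j\<bar> + \<bar>A$i$2\<bar> * \<bar>B$2$j\<bar>"
  have "entry_sum (A ** B) \<le> ?r 1 1 + ?r 1 2 + ?r 2 1 + ?r 2 2"
    unfolding entry_sum_def matrix_matrix_mult_def by (simp add: sum_2 add_mono *)
  also have "\<dots> \<le> entry_sum A * entry_sum B"
    unfolding entry_sum_def by (simp add: algebra_simps)
  finally show ?thesis .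
qed

lemma norm_vec2_bounds: "\<bar>p $ 1\<bar> + \<bar>p $ 2\<bar> \<ge> norm p" "\<bar>p $ i\<bar> \<le> norm p" for p :: "real^2"
  using norm_le_l1_cart[of p] component_le_norm_cart[of p i] by (simp_all add: sum_2)

lemma norm_matrix_vector_le: "norm (M *v v) \<le> entry_sum M * norm v" for M :: "real^2^2"
proof -
  have "norm (M *v v) \<le> \<bar>M$1$1 * v$1 + M$1$2 * v$2\<bar> + \<bar>M$2$1 * v$1 + M$2$2 * v$2\<bar>"
    using norm_vec2_bounds(1)[of "M *v v"] by (simp add: matrix_vector_mult_2)
  also have "\<dots> \<le> (\<bar>M$1$1\<bar> * \<bar>v$1\<bar> + \<bar>M$1$2\<bar> * \<bar>v$2\<bar>) + (\<bar>M$2$1\<bar> * \<bar>v$1\<bar> + \<bar>M$2$2\<bar> * \<bar>v$2\<bar>)"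
    unfolding abs_mult[symmetric] by (intro add_mono abs_triangle_ineq)
  also have "\<dots> \<le> (\<bar>M$1$1\<bar> * norm v + \<bar>M$1$2\<bar> * norm v) + (\<bar>M$2$1\<bar> * norm v + \<bar>M$2$2\<bar> * norm v)"
    by (intro add_mono mult_left_mono norm_vec2_bounds) auto
  finally show ?thesis by (simp add: entry_sum_def algebra_simps)
qed

text \<open>Each of the four entries is at most the norm of the longer column.\<close>

lemma large_column:
  fixes M :: "real^2^2"
  obtains j where "entry_sum M \<le> 4 * norm (M *v axis j 1)"
proof -
  have col: "(M *v axis j 1) $ i = M $ i $ j" for i j
    by (simp add: matrix_vector_mul_component inner_axis)
  have ent: "\<bar>M $ i $ j\<bar> \<le> norm (M *v axis j 1)" for i j
    using norm_vec2_bounds(2)[of "M *v axis j 1" i] by (simp add: col)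
  show thesis
  proof (cases "norm (M *v axis 1 1) \<le> norm (M *v axis 2 1)")
    case True
    then show thesis using ent[of 1 1] ent[of 1 2] ent[of 2 1] ent[of 2 2]
      by (intro that[of 2]) (simp add: entry_sum_def)
  next
    case False
    then show thesis using ent[of 1 1] ent[of 1 2] ent[of 2 1] ent[of 2 2]
      by (intro that[of 1]) (simp add: entry_sum_def)
  qed
qed

lemma onorm_entry_sum:
  fixes M :: "real^2^2"
  shows "entry_sum M / 4 \<le> onorm ((*v) M)" "onorm ((*v) M) \<le> entry_sum M"
proof -
  obtain j where j: "entry_sum M \<le> 4 * norm (M *v axis j 1)" by (rule large_column)
  have "norm (M *v axis j 1) \<le> onorm ((*v) M) * norm (axis j 1 :: real^2)"
    by (rule onorm) simp
  then show "entry_sum M / 4 \<le> onorm ((*v) M)" using j by simp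
  show "onorm ((*v) M) \<le> entry_sum M"
    by (rule onorm_bound) (simp_all add: norm_matrix_vector_le entry_sum_nonneg)
qed

definition adj2 :: "real^2^2 \<Rightarrow> real^2^2" where
  "adj2 M = vector [vector [M$2$2, - M$1$2], vector [- M$2$1, M$1$1]]"

lemma entry_sum_adj2 [simp]: "entry_sum (adj2 M) = entry_sum M"
  by (simp add: entry_sum_def adj2_def)

lemma adj2_mult: "adj2 M *v (M *v v) = det M *\<^sub>R v" "M *v (adj2 M *v v) = det M *\<^sub>R v"
  by (simp_all add: matrix_vector_mult_2 adj2_def det_2 vec_eq_iff forall_2 algebra_simps)

text \<open>The inverse of \<open>M\<close> is its adjugate divided by the determinant, so the least
  stretch of \<open>M\<close> is governed by the size of the adjugate. A long column of the adjugate
  is a direction that \<open>M\<close> nearly stretches least.\<close>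

lemma conorm_entry_sum:
  fixes M :: "real^2^2"
  assumes "det M \<noteq> 0"
  shows "entry_sum M > 0" "\<bar>det M\<bar> / entry_sum M \<le> conorm ((*v) M)" "conorm ((*v) M) \<le> 4 * \<bar>det M\<bar> / entry_sum M"
proof -
  have "M \<noteq> 0" using assms by (auto simp: det_2)
  then have "\<not> (M$1$1 = 0 \<and> M$1$2 = 0 \<and> M$2$1 = 0 \<and> M$2$2 = 0)"
    by (auto simp: vec_eq_iff forall_2)
  then show s: "entry_sum M > 0" unfolding entry_sum_def by auto
  have ne: "sphere (0 :: real^2) 1 \<noteq> {}"
    using norm_axis_1[of 1] by (auto simp: sphere_def intro!: exI[of _ "axis 1 1 :: real^2"])
  show "\<bar>det M\<bar> / entry_sum M \<le> conorm ((*v) M)"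
    unfolding conorm_def
  proof (rule cINF_greatest[OF ne])
    fix v :: "real^2" assume "v \<in> sphere 0 1"
    then have "\<bar>det M\<bar> = norm (adj2 M *v (M *v v))" by (simp add: adj2_mult)
    also have "\<dots> \<le> entry_sum M * norm (M *v v)"
      using norm_matrix_vector_le[of "adj2 M" "M *v v"] by simp
    finally show "\<bar>det M\<bar> / entry_sum M \<le> norm (M *v v)" using s by (simp add: field_simps)
  qed
  obtain j where j: "entry_sum (adj2 M) \<le> 4 * norm (adj2 M *v axis j 1)" by (rule large_column)
  define w where "w = adj2 M *v axis j 1"
  have w: "norm w > 0" "entry_sum M \<le> 4 * norm w" using j s by (auto simp: w_def)
  have "conorm ((*v) M) \<le> norm (M *v (w /\<^sub>R norm w))"
    unfolding conorm_def
    by (rule cINF_lower) (use w in \<open>auto intro!: bdd_belowI[of _ 0]\<close>)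
  also have "M *v (w /\<^sub>R norm w) = (det M *\<^sub>R axis j 1) /\<^sub>R norm w"
    by (simp add: matrix_vector_mult_scaleR w_def adj2_mult)
  also have "norm \<dots> = \<bar>det M\<bar> / norm w" by (simp add: divide_inverse abs_mult)
  also have "\<dots> \<le> \<bar>det M\<bar> / (entry_sum M / 4)"
    using w s by (intro divide_left_mono mult_pos_pos) auto
  finally show "conorm ((*v) M) \<le> 4 * \<bar>det M\<bar> / entry_sum M" by (simp add: mult.commute)
qed

lemma rep_torus_periodic:
  assumes "\<And>p m. int_vec m \<Longrightarrow> F (p + m) = F p"
  shows "F (rep_torus (to_torus p)) = F p"
proof -
  have "int_vec (rep_torus (to_torus p) - p)" by (simp flip: to_torus_eq)
  from assms[OF this, of p] show ?thesis by simp
qed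

lemma cos_int_shift: "k \<in> \<int> \<Longrightarrow> cos (2 * pi * (x + k)) = cos (2 * pi * x)"
  and sin_int_shift: "k \<in> \<int> \<Longrightarrow> sin (2 * pi * (x + k)) = sin (2 * pi * x)"
proof -
  assume "k \<in> \<int>"
  then obtain n where "k = of_int n" by (rule Ints_cases)
  then have eq: "2 * pi * (x + k) = 2 * pi * x + of_int n * (2 * pi)" by (simp add: algebra_simps)
  have c: "cos (of_int n * (2 * pi)) = 1" and s: "sin (of_int n * (2 * pi)) = 0"
    using cos_int_2pin[of n] sin_int_2pin[of n] by (simp_all add: mult.commute)
  show "cos (2 * pi * (x + k)) = cos (2 * pi * x)" "sin (2 * pi * (x + k)) = sin (2 * pi * x)"
    by (simp_all add: eq cos_add sin_add c s)
qed

text \<open>Here \<open>d\<close> and \<open>t\<close> stand for determinant and trace of the linear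
  part. The assumption \<open>average\<close> is the conclusion of
  \<open>averaged_contraction\<close>, so the constants are fixed before the map that depends on
  \<open>K\<close> is built.\<close>

locale henon_endo =
  fixes d t :: int and K R \<theta> :: real
  assumes d: "\<bar>d\<bar> \<ge> 17" and R: "R \<ge> 1" and \<theta>: "\<theta> > 0" and K: "K > 0"
    and average: "\<And>a b y. (a, b) \<noteq> (0, 0) \<Longrightarrow>
      (\<Sum>k<nat \<bar>d\<bar>. wnorm R (b + (t + K * cos (2 * pi * (y + real k / real (nat \<bar>d\<bar>)))) * a / d) (- a / d) powr (- \<theta>))
        \<le> real (nat \<bar>d\<bar>) * (99 / 100 * wnorm R a b powr (- \<theta>))"
begin

definition Phi :: "real \<Rightarrow> real" where
  "Phi y = of_int t * y + K / (2 * pi) * sin (2 * pi * y)"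

definition dPhi :: "real \<Rightarrow> real" where
  "dPhi y = of_int t + K * cos (2 * pi * y)"

definition g :: "real^2 \<Rightarrow> real^2" where
  "g p = vec2 (- of_int d * p $ 2) (p $ 1 + Phi (p $ 2))"

definition J :: "real^2 \<Rightarrow> real^2^2" where
  "J p = vector [vector [0, - of_int d], vector [1, dPhi (p $ 2)]]"

definition J_inv :: "real^2 \<Rightarrow> real^2 \<Rightarrow> real^2" where
  "J_inv p v = vec2 (v $ 2 + dPhi (p $ 2) * v $ 1 / d) (- v $ 1 / d)"

definition A :: "int^2^2" where
  "A = vector [vector [0, - d], vector [1, t]]"

lemma d_nz: "real_of_int d \<noteq> 0" "d \<noteq> 0" using d by auto

lemma g_derivative: "(g has_derivative (*v) (J p)) (at p)"
  unfolding g_def[abs_def] vec2_eq_axis Phi_def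
  by (rule derivative_eq_intros refl)+
    (simp add: fun_eq_iff matrix_vector_mult_2 J_def dPhi_def vec_eq_iff forall_2 axis_def algebra_simps)

lemma g_smooth: "C_k k g"
proof -
  have "g = (\<lambda>p. 0 + rmat A *v p + sin (2 * pi * p $ 2) *\<^sub>R ((K / (2 * pi)) *\<^sub>R axis 2 1) + cos (2 * pi * p $ 2) *\<^sub>R 0)"
    by (simp add: fun_eq_iff g_def Phi_def matrix_vector_mult_2 A_def vec_eq_iff forall_2 axis_def)
  then show ?thesis
    by (simp only:) (rule C_k_trigonometric, rule matrix_vector_mul_bounded_linear)
qed

lemma continuous_g: "continuous_on UNIV g"
  using g_smooth[of 0] by simp

lemma g_equivariant: "equivariant A g"
  unfolding equivariant_def
proof (intro allI impI)
  fix p m :: "real^2" assume m: "int_vec m"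
  have "sin (2 * pi * (p $ 2 + m $ 2)) = sin (2 * pi * p $ 2)"
    using m by (intro sin_int_shift) (simp add: int_vec_def)
  then show "g (p + m) = g p + rmat A *v m"
    by (simp add: g_def Phi_def matrix_vector_mult_2 A_def vec_eq_iff forall_2 algebra_simps)
qed

lemma dPhi_periodic: "int_vec m \<Longrightarrow> dPhi (p $ 2 + m $ 2) = dPhi (p $ 2)"
  using cos_int_shift[of "m $ 2" "p $ 2"] by (simp add: dPhi_def int_vec_def)

lemma J_periodic: "int_vec m \<Longrightarrow> J (p + m) = J p"
  and J_inv_periodic: "int_vec m \<Longrightarrow> J_inv (p + m) v = J_inv p v"
  by (simp_all add: J_def J_inv_def dPhi_periodic)

lemma J_J_inv: "J p *v J_inv p v = v"
  using d_nz by (simp add: matrix_vector_mult_2 J_def J_inv_def vec_eq_iff forall_2)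

lemma det_J: "det (J p) = d"
  by (simp add: det_2 J_def)

definition f :: "torus \<Rightarrow> torus" where
  "f x = to_torus (g (rep_torus x))"

lemma lift_f: "torus_lift g f"
proof -
  obtain f' where f': "torus_lift g f'" using equivariant_lift[OF g_equivariant continuous_g] .
  have "f' x = f x" for x
    using f' unfolding f_def torus_lift_def by (metis to_torus_rep)
  then have "f' = f" by auto
  with f' show ?thesis by simp
qed

lemma f_to_torus: "f (to_torus p) = to_torus (g p)"
  using lift_f by (simp add: torus_lift_def)

lemma smooth_f: "torus_smooth f"
  unfolding torus_smooth_def by (intro exI[of _ g] conjI allI lift_f g_smooth)

lemma borel_measurable_f [measurable]: "f \<in> borel_measurable borel"
  by (rule borel_measurable_continuous_onI[OF torus_lift_continuous[OF lift_f]])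

lemma borel_measurable_Phi [measurable]: "Phi \<in> borel_measurable borel"
  unfolding Phi_def[abs_def] by measurable

lemma nn_integral_f:
  assumes [measurable]: "h \<in> borel_measurable borel"
  shows "(\<integral>\<^sup>+x. h (f x) \<partial>torus_haar) = (\<integral>\<^sup>+x. h x \<partial>torus_haar)"
proof -
  have "(\<integral>\<^sup>+x. h (f x) \<partial>torus_haar) = unit_int (\<lambda>y. unit_int (\<lambda>x. h (f (to_torus (vec2 x y)))))"
    by (rule nn_integral_torus_haar(2)) measurable
  also have "\<dots> = unit_int (\<lambda>y. unit_int (\<lambda>x. h (to_torus (vec2 (of_int (- d) * y) (x + Phi y)))))"
    by (simp add: f_to_torus g_def)
  also have "\<dots> = (\<integral>\<^sup>+x. h x \<partial>torus_haar)"
    by (rule nn_integral_torus_henon) (use d_nz in auto)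
  finally show ?thesis .
qed

lemma distr_f: "distr torus_haar torus_haar f = torus_haar"
proof (rule measure_eqI)
  fix X assume "X \<in> sets (distr torus_haar torus_haar f)"
  then have X[measurable]: "X \<in> sets borel" by simp
  have "emeasure (distr torus_haar torus_haar f) X = (\<integral>\<^sup>+x. indicator X x \<partial>distr torus_haar torus_haar f)"
    by simp
  also have "\<dots> = (\<integral>\<^sup>+x. indicator X (f x) \<partial>torus_haar)"
    by (rule nn_integral_distr) measurable
  also have "\<dots> = (\<integral>\<^sup>+x. indicator X x \<partial>torus_haar)"
    by (rule nn_integral_f) measurable
  finally show "emeasure (distr torus_haar torus_haar f) X = emeasure torus_haar X" by simp
qed simp

lemma conservative_f: "conservative f"
  unfolding conservative_def using distr_f borel_measurable_f
  by (simp add: measurable_cong_sets[OF sets_torus_haar sets_torus_haar])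

section \<open>The derivative cocycle and its inverse\<close>

primrec C :: "nat \<Rightarrow> real^2 \<Rightarrow> real^2^2" where
  "C 0 p = mat 1"
| "C (Suc n) p = C n (g p) ** J p"

text \<open>This is the inverse of the derivative of \<open>g ^^ n\<close> at \<open>p\<close>,
  applied to \<open>v\<close> (see \<open>C_W\<close>). The recursion peels off the first iterate:
  \<open>J_inv p\<close> acts last, and the rest depends on \<open>g p\<close> only. For points of
  one fibre of \<open>f\<close> it therefore acts on one common vector.\<close>

primrec W :: "nat \<Rightarrow> real^2 \<Rightarrow> real^2 \<Rightarrow> real^2" where
  "W 0 p v = v"
| "W (Suc n) p v = J_inv p (W n (g p) v)"

lemma C_W: "C n p *v W n p v = v"
proof (induction n arbitrary: p)
  case (Suc n)
  show ?case
    by (simp only: C.simps W.simps matrix_vector_mul_assoc[symmetric] J_J_inv Suc)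
qed simp

lemma C_periodic: "int_vec m \<Longrightarrow> C n (p + m) = C n p"
proof (induction n arbitrary: p m)
  case (Suc n)
  have "C n (g p + rmat A *v m) = C n (g p)" using Suc by blast
  then show ?case by (simp only: C.simps equivariantD[OF g_equivariant Suc.prems] J_periodic[OF Suc.prems])
qed simp

lemma W_periodic: "int_vec m \<Longrightarrow> W n (p + m) v = W n p v"
proof (induction n arbitrary: p m)
  case (Suc n)
  have "W n (g p + rmat A *v m) v = W n (g p) v" using Suc by blast
  then show ?case by (simp only: W.simps equivariantD[OF g_equivariant Suc.prems] J_inv_periodic[OF Suc.prems])
qed simp

lemma C_rep: "C n (rep_torus (to_torus p)) = C n p"
  by (rule rep_torus_periodic) (rule C_periodic)

lemma W_rep: "W n (rep_torus (to_torus p)) v = W n p v"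
  by (rule rep_torus_periodic[of "\<lambda>p. W n p v"]) (rule W_periodic)

lemma C_add: "C (m + n) p = C n ((g ^^ m) p) ** C m p"
  by (induction m arbitrary: p) (simp_all add: funpow_swap1 matrix_mul_assoc)

lemma det_C: "det (C n p) = of_int d ^ n"
  by (induction n arbitrary: p) (simp_all add: det_mul det_J mult.commute)

lemma g_funpow_derivative: "((g ^^ n) has_derivative (*v) (C n p)) (at p)"
proof (induction n arbitrary: p)
  case 0
  show ?case by (simp add: id_def)
next
  case (Suc n)
  have "((\<lambda>x. (g ^^ n) (g x)) has_derivative (\<lambda>v. C n (g p) *v (J p *v v))) (at p)"
    using has_derivative_compose[OF g_derivative Suc] .
  then show ?case by (simp add: funpow_Suc_right o_def matrix_vector_mul_assoc del: funpow.simps)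
qed

lemma torus_deriv_f: "torus_deriv (f ^^ n) x = (*v) (C n (rep_torus x))"
  using torus_deriv_eq[OF torus_lift_funpow[OF lift_f] g_funpow_derivative, of n "rep_torus x"] by simp

lemma f_funpow_to_torus: "(f ^^ n) (to_torus p) = to_torus ((g ^^ n) p)"
  using torus_lift_funpow[OF lift_f, of n] by (simp add: torus_lift_def)

lemma continuous_C: "continuous_on UNIV (\<lambda>p. C n p $ i $ j)"
proof (induction n arbitrary: i j)
  case (Suc n)
  have J: "continuous_on UNIV (\<lambda>p. J p $ i $ j)" for i j
    using exhaust_2[of i] exhaust_2[of j]
    by (elim disjE; simp add: J_def dPhi_def; intro continuous_intros)
  show ?case
    unfolding C.simps matrix_matrix_mult_def
    by (simp add: sum_2) (intro continuous_intros J continuous_on_compose2[OF Suc continuous_g] subset_UNIV)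
qed simp

lemma continuous_W: "continuous_on UNIV (\<lambda>p. W n p v)"
proof (induction n)
  case (Suc n)
  have "continuous_on UNIV (\<lambda>p. W n (g p) v)"
    by (rule continuous_on_compose2[OF Suc continuous_g]) simp
  then show ?case
    unfolding W.simps J_inv_def dPhi_def using d_nz by (intro continuous_intros) auto
qed simp

lemma borel_measurable_torus_entry [measurable]: "(\<lambda>x. C n (rep_torus x) $ i $ j) \<in> borel_measurable borel"
  by (intro borel_measurable_continuous_onI continuous_on_from_torus) (simp add: C_rep continuous_C)

lemma borel_measurable_torus_W [measurable]: "(\<lambda>x. W n (rep_torus x) v) \<in> borel_measurable borel"
  by (intro borel_measurable_continuous_onI continuous_on_from_torus) (simp add: W_rep continuous_W)

definition \<nu> :: "real^2 \<Rightarrow> real" where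
  "\<nu> u = wnorm R (u $ 1) (u $ 2) powr (- \<theta>)"

lemma borel_measurable_\<nu> [measurable]: "\<nu> \<in> borel_measurable borel"
  unfolding \<nu>_def[abs_def] wnorm_def by measurable

end

subsection \<open>Lyapunov exponents\<close>

lemma tendsto_average_bounded_diff:
  fixes a b :: "nat \<Rightarrow> real"
  assumes b: "(\<lambda>n. b n / real n) \<longlonglongrightarrow> l" and c: "\<And>n. n > 0 \<Longrightarrow> \<bar>a n - b n\<bar> \<le> c"
  shows "(\<lambda>n. a n / real n) \<longlonglongrightarrow> l"
proof -
  have "(\<lambda>n. (a n - b n) / real n) \<longlonglongrightarrow> 0"
  proof (rule Lim_null_comparison[OF _ lim_const_over_n[of c]])
    show "\<forall>\<^sub>F n in sequentially. norm ((a n - b n) / real n) \<le> c / real n"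
      using eventually_gt_at_top[of 0]
      by eventually_elim (auto simp: abs_divide intro!: divide_right_mono c)
  qed
  from tendsto_add[OF b this] show ?thesis by (simp add: diff_divide_distrib)
qed

lemma unit_int_cmult:
  "\<phi> \<in> borel_measurable borel \<Longrightarrow> unit_int (\<lambda>x. c * \<phi> x) = c * unit_int \<phi>"
  unfolding unit_int_def by (subst nn_integral_cmult[symmetric]) (auto simp: mult.assoc)

lemma unit_int_sum:
  assumes "\<And>k. k \<in> I \<Longrightarrow> \<phi> k \<in> borel_measurable borel"
  shows "unit_int (\<lambda>x. \<Sum>k\<in>I. \<phi> k x) = (\<Sum>k\<in>I. unit_int (\<phi> k))"
  unfolding unit_int_def using assms by (subst nn_integral_sum[symmetric]) (auto simp: sum_distrib_right)

lemma unit_int_mono: "(\<And>x. \<phi> x \<le> \<psi> x) \<Longrightarrow> unit_int \<phi> \<le> unit_int \<psi>"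
  unfolding unit_int_def by (intro nn_integral_mono mult_right_mono) auto

lemma abs_det_le_entry_sum: "\<bar>det M\<bar> \<le> (entry_sum M)\<^sup>2" for M :: "real^2^2"
proof -
  have "\<bar>det M\<bar> \<le> \<bar>M$1$1\<bar> * \<bar>M$2$2\<bar> + \<bar>M$1$2\<bar> * \<bar>M$2$1\<bar>"
    unfolding det_2 abs_mult[symmetric] by (rule abs_triangle_ineq4)
  also have "\<dots> \<le> (entry_sum M)\<^sup>2"
    unfolding entry_sum_def power2_eq_square by (simp add: algebra_simps)
  finally show ?thesis .
qed

lemma finite_measure_torus_haar: "finite_measure torus_haar"
  by (rule finite_measureI) (simp add: emeasure_torus_haar_UNIV)

context henon_endo
begin

lemma W_nonzero: "v \<noteq> 0 \<Longrightarrow> (W n p v $ 1, W n p v $ 2) \<noteq> (0, 0)"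
proof
  assume "v \<noteq> 0" "(W n p v $ 1, W n p v $ 2) = (0, 0)"
  then have "W n p v = 0" by (simp add: vec_eq_iff forall_2)
  then show False using C_W[of n p v] \<open>v \<noteq> 0\<close> by simp
qed

text \<open>The D integrals of \<open>H (Suc n)\<close> over skew-shifted copies of the torus are
  all equal. Their sum is the integral of a sum over a fibre of \<open>f\<close>, to which
  \<open>average\<close> applies pointwise; the invariance of the measure then removes
  \<open>f\<close> from the bound.\<close>

lemma moment_step:
  assumes v: "v \<noteq> 0"
  shows "(\<integral>\<^sup>+x. \<nu> (W (Suc n) (rep_torus x) v) \<partial>torus_haar)
    \<le> ennreal (99 / 100) * (\<integral>\<^sup>+x. \<nu> (W n (rep_torus x) v) \<partial>torus_haar)"
proof -
  define H where "H n x = ennreal (\<nu> (W n (rep_torus x) v))" for n x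
  have H [measurable]: "H n \<in> borel_measurable borel" for n unfolding H_def by measurable
  define D where "D = nat \<bar>d\<bar>"
  have D: "D > 0" "real D = \<bar>real_of_int d\<bar>" using d by (auto simp: D_def)
  \<comment> \<open>The correction of the first coordinate that keeps \<open>x + Phi y\<close>
    unchanged when \<open>y\<close> moves by \<open>k / D\<close>; the other coordinate of
    \<open>g\<close> changes by an integer.\<close>
  define a where "a k y = Phi y - Phi (y + real k / real D)" for k y
  have a [measurable]: "a k \<in> borel_measurable borel" for k
    unfolding a_def by measurable
  have point: "(\<Sum>k<D. H (Suc n) (to_torus (vec2 (x + a k y) (y + real k / real D))))
      \<le> of_nat D * (ennreal (99 / 100) * H n (f (to_torus (vec2 x y))))" for x y
  proof -
    define u where "u = W n (g (vec2 x y)) v"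
    have u: "(u $ 1, u $ 2) \<noteq> (0, 0)" unfolding u_def using v by (rule W_nonzero)
    have "H (Suc n) (to_torus (vec2 (x + a k y) (y + real k / real D)))
        = ennreal (wnorm R (u $ 2 + (t + K * cos (2 * pi * (y + real k / real D))) * u $ 1 / d) (- u $ 1 / d) powr (- \<theta>))" for k
    proof -
      let ?q = "vec2 (x + a k y) (y + real k / real D)" and ?m = "vec2 (- of_int d * (real k / real D)) 0"
      \<comment> \<open>As D is the absolute value of \<open>d\<close>, this number is
        \<open>k\<close> up to sign.\<close>
      have "of_int d * (real k / real D) \<in> \<int>"
        using D by (cases "d > 0") auto
      then have m: "int_vec ?m" by (simp add: int_vec_def forall_2)
      have "g ?q = g (vec2 x y) + ?m"
        by (simp add: g_def a_def vec_eq_iff forall_2 algebra_simps)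
      then have "W n (g ?q) v = u" using W_periodic[OF m] by (simp add: u_def)
      then show ?thesis
        by (simp add: H_def W_rep del: W.simps) (simp add: \<nu>_def J_inv_def dPhi_def)
    qed
    then have "(\<Sum>k<D. H (Suc n) (to_torus (vec2 (x + a k y) (y + real k / real D))))
        = ennreal (\<Sum>k<D. wnorm R (u $ 2 + (t + K * cos (2 * pi * (y + real k / real D))) * u $ 1 / d) (- u $ 1 / d) powr (- \<theta>))"
      by simp
    also have "\<dots> \<le> ennreal (real D * (99 / 100 * \<nu> u))"
      using average[OF u, of y] by (intro ennreal_leI) (simp add: D_def \<nu>_def)
    also have "\<dots> = of_nat D * (ennreal (99 / 100) * H n (f (to_torus (vec2 x y))))"
      unfolding H_def f_to_torus W_rep u_def[symmetric] ennreal_of_nat_eq_real_of_nat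
      by (subst ennreal_mult', simp, subst ennreal_mult', simp, rule refl)
    finally show ?thesis .
  qed
  have "of_nat D * (\<integral>\<^sup>+x. H (Suc n) x \<partial>torus_haar)
      = (\<Sum>k<D. unit_int (\<lambda>y. unit_int (\<lambda>x. H (Suc n) (to_torus (vec2 (x + a k y) (y + real k / real D))))))"
    by (simp add: nn_integral_torus_skew_shift)
  also have "\<dots> = unit_int (\<lambda>y. \<Sum>k<D. unit_int (\<lambda>x. H (Suc n) (to_torus (vec2 (x + a k y) (y + real k / real D)))))"
    by (rule unit_int_sum[symmetric]) measurable
  also have "\<dots> = unit_int (\<lambda>y. unit_int (\<lambda>x. \<Sum>k<D. H (Suc n) (to_torus (vec2 (x + a k y) (y + real k / real D)))))"
    by (subst unit_int_sum) auto
  also have "\<dots> \<le> unit_int (\<lambda>y. unit_int (\<lambda>x. of_nat D * (ennreal (99 / 100) * H n (f (to_torus (vec2 x y))))))"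
    by (intro unit_int_mono point)
  also have "\<dots> = of_nat D * (ennreal (99 / 100) * unit_int (\<lambda>y. unit_int (\<lambda>x. H n (f (to_torus (vec2 x y))))))"
    by (simp add: unit_int_cmult)
  also have "unit_int (\<lambda>y. unit_int (\<lambda>x. H n (f (to_torus (vec2 x y))))) = (\<integral>\<^sup>+x. H n (f x) \<partial>torus_haar)"
    by (rule nn_integral_torus_haar(2)[symmetric]) measurable
  also have "\<dots> = (\<integral>\<^sup>+x. H n x \<partial>torus_haar)"
    by (rule nn_integral_f) measurable
  finally show ?thesis
    using D(1) unfolding H_def by (subst (asm) ennreal_mult_le_mult_iff) auto
qed

lemma moment_bound:
  assumes v: "v \<noteq> 0"
  shows "(\<integral>\<^sup>+x. \<nu> (W n (rep_torus x) v) \<partial>torus_haar) \<le> ennreal ((99 / 100) ^ n * \<nu> v)"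
proof (induction n)
  case 0
  show ?case by (simp add: emeasure_torus_haar_UNIV)
next
  case (Suc n)
  have "(\<integral>\<^sup>+x. \<nu> (W (Suc n) (rep_torus x) v) \<partial>torus_haar)
      \<le> ennreal (99 / 100) * ennreal ((99 / 100) ^ n * \<nu> v)"
    by (rule order_trans[OF moment_step[OF v] mult_left_mono[OF Suc]]) simp
  also have "\<dots> = ennreal ((99 / 100) ^ Suc n * \<nu> v)"
    by (subst ennreal_mult'[symmetric]) (simp_all add: \<nu>_def mult.assoc)
  finally show ?case .
qed

text \<open>A Borel-Cantelli argument: the moments decay geometrically, so after division by
  \<open>r ^ n\<close> they are still summable. Almost everywhere the negative power of the weighted
  norm is then eventually below \<open>r ^ n\<close>, which is exponential growth of the
  vector.\<close>

lemma AE_backward_growth: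
  "\<exists>\<alpha>>0. \<forall>v. v \<noteq> 0 \<longrightarrow>
    (AE x in torus_haar. \<forall>\<^sub>F n in sequentially. real n * \<alpha> \<le> ln (norm (W n (rep_torus x) v)))"
proof -
  \<comment> \<open>The square root splits the decay in two: one factor \<open>r ^ n\<close> is the
    pointwise bound, the other ensures summability.\<close>
  define r :: real where "r = sqrt (99 / 100)"
  have r: "0 < r" "r < 1" "r * r = 99 / 100" by (simp_all add: r_def)
  define \<alpha> where "\<alpha> = - ln r / \<theta>"
  have "\<alpha> > 0" unfolding \<alpha>_def using r \<theta> by (intro divide_pos_pos) auto
  moreover have "AE x in torus_haar. \<forall>\<^sub>F n in sequentially. real n * \<alpha> \<le> ln (norm (W n (rep_torus x) v))"
    if v: "v \<noteq> 0" for v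
  proof -
    define T where "T n x = \<nu> (W n (rep_torus x) v) / r ^ n" for n x
    have T: "0 \<le> T n x" for n x using r by (simp add: T_def \<nu>_def)
    have T_meas [measurable]: "T n \<in> borel_measurable borel" for n unfolding T_def by measurable
    have "(\<integral>\<^sup>+x. T n x \<partial>torus_haar) \<le> ennreal (\<nu> v * r ^ n)" for n
    proof -
      have "(\<integral>\<^sup>+x. T n x \<partial>torus_haar) = (\<integral>\<^sup>+x. ennreal (1 / r ^ n) * \<nu> (W n (rep_torus x) v) \<partial>torus_haar)"
        using r by (simp add: T_def ennreal_mult'[symmetric])
      also have "\<dots> = ennreal (1 / r ^ n) * (\<integral>\<^sup>+x. \<nu> (W n (rep_torus x) v) \<partial>torus_haar)"
        by (rule nn_integral_cmult) measurable
      also have "\<dots> \<le> ennreal (1 / r ^ n) * ennreal ((99 / 100) ^ n * \<nu> v)"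
        by (intro mult_left_mono moment_bound v) simp
      also have "\<dots> = ennreal (\<nu> v * r ^ n)"
        using r by (simp add: ennreal_mult'[symmetric] r(3)[symmetric] power_mult_distrib mult.commute)
      finally show ?thesis .
    qed
    then have "(\<Sum>n. \<integral>\<^sup>+x. T n x \<partial>torus_haar) \<le> (\<Sum>n. ennreal (\<nu> v * r ^ n))"
      by (intro suminf_le) auto
    also have "\<dots> = ennreal (\<Sum>n. \<nu> v * r ^ n)"
      using r by (intro suminf_ennreal2 summable_mult summable_geometric) (auto simp: \<nu>_def)
    also have "\<dots> < \<infinity>" by simp
    finally have "(\<integral>\<^sup>+x. (\<Sum>n. ennreal (T n x)) \<partial>torus_haar) \<noteq> \<infinity>"
      by (subst nn_integral_suminf) auto
    then have "AE x in torus_haar. (\<Sum>n. ennreal (T n x)) \<noteq> \<infinity>"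
      by (intro nn_integral_noteq_infinite) auto
    then show ?thesis
    proof eventually_elim
      case (elim x)
      then have "summable (\<lambda>n. T n x)"
        using T by (intro summable_suminf_not_top) auto
      then have "(\<lambda>n. T n x) \<longlonglongrightarrow> 0" by (rule summable_LIMSEQ_zero)
      then have "\<forall>\<^sub>F n in sequentially. T n x < 1"
        by (rule order_tendstoD) simp
      then show ?case
      proof eventually_elim
        case (elim n)
        let ?u = "W n (rep_torus x) v"
        define N where "N = wnorm R (?u $ 1) (?u $ 2)"
        have N: "N > 0" unfolding N_def using W_nonzero[OF v] R by (intro wnorm_pos) auto
        have "N powr (- \<theta>) < r ^ n" using elim r by (simp add: T_def \<nu>_def N_def)
        then have "ln (N powr (- \<theta>)) < ln (r ^ n)" using N r by (subst ln_less_cancel_iff) auto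
        then have "- \<theta> * ln N < real n * ln r" using N r by (simp add: ln_powr ln_realpow)
        then have "real n * \<alpha> < ln N" using \<theta> by (simp add: \<alpha>_def field_simps)
        moreover have "N \<le> norm ?u"
        proof -
          have "\<bar>?u $ 2\<bar> / R \<le> \<bar>?u $ 2\<bar>" using R by (simp add: divide_le_eq mult_le_cancel_left1)
          then show ?thesis unfolding N_def wnorm_def
            using norm_vec2_bounds(2)[of ?u 1] norm_vec2_bounds(2)[of ?u 2] by linarith
        qed
        then have "ln N \<le> ln (norm ?u)" using N by (subst ln_le_cancel_iff) linarith+
        ultimately show ?case by simp
      qed
    qed
  qed
  ultimately show ?thesis by (intro exI[of _ \<alpha>]) simp
qed

text \<open>The value at 0 is set by hand: the identity has entry sum 2, and \<open>ln 2\<close>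
  would violate the bound by a multiple of \<open>n\<close>.\<close>

definition \<phi> :: "nat \<Rightarrow> torus \<Rightarrow> real" where
  "\<phi> n x = (if n = 0 then 0 else ln (entry_sum (C n (rep_torus x))))"

lemma entry_sum_C_ge_1: "1 \<le> entry_sum (C n p)"
proof -
  have "1 \<le> \<bar>det (C n p)\<bar>"
    using d by (simp add: det_C power_abs one_le_power)
  also have "\<dots> \<le> (entry_sum (C n p))\<^sup>2" by (rule abs_det_le_entry_sum)
  finally have "1\<^sup>2 \<le> (entry_sum (C n p))\<^sup>2" by simp
  then show ?thesis by (rule power2_le_imp_le) (rule entry_sum_nonneg)
qed

text \<open>The induction starts at the first iterate because the entry sum of the identity exceeds
  1.\<close>

lemma entry_sum_C_le: "entry_sum (C (Suc n) p) \<le> (\<bar>d\<bar> + 1 + \<bar>t\<bar> + K) ^ Suc n"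
proof (induction n arbitrary: p)
  have J: "entry_sum (J p) \<le> \<bar>d\<bar> + 1 + \<bar>t\<bar> + K" for p
  proof -
    have "\<bar>K * cos (2 * pi * p $ 2)\<bar> \<le> K * 1"
      unfolding abs_mult using K by (intro mult_mono) auto
    then have "\<bar>dPhi (p $ 2)\<bar> \<le> \<bar>t\<bar> + K" unfolding dPhi_def by linarith
    then show ?thesis by (simp add: entry_sum_def J_def)
  qed
  {
    case 0
    show ?case using J by simp
  next
    case (Suc n)
    have "entry_sum (C (Suc (Suc n)) p) \<le> entry_sum (C (Suc n) (g p)) * entry_sum (J p)"
      unfolding C.simps(2)[of "Suc n"] by (rule entry_sum_mult)
    also have "\<dots> \<le> (\<bar>d\<bar> + 1 + \<bar>t\<bar> + K) ^ Suc n * (\<bar>d\<bar> + 1 + \<bar>t\<bar> + K)"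
      using K by (intro mult_mono Suc J) (auto simp: entry_sum_nonneg)
    finally show ?case by (simp add: mult.commute)
  }
qed

sublocale subadditive_process torus_haar f \<phi> "ln (\<bar>d\<bar> + 1 + \<bar>t\<bar> + K)"
proof (intro subadditive_process.intro subadditive_process_axioms.intro
    measure_preserving_map.intro measure_preserving_map_axioms.intro finite_measure_torus_haar)
  show "f \<in> torus_haar \<rightarrow>\<^sub>M torus_haar" "distr torus_haar torus_haar f = torus_haar"
    using conservative_f by (auto simp: conservative_def)
  show "\<phi> n \<in> borel_measurable torus_haar" for n
    unfolding \<phi>_def[abs_def] entry_sum_def by measurable
  show "0 \<le> \<phi> n x" for n x
    using entry_sum_C_ge_1 by (simp add: \<phi>_def)
  show "\<phi> n x \<le> ln (\<bar>d\<bar> + 1 + \<bar>t\<bar> + K) * real n" for n x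
  proof (cases n)
    case (Suc m)
    have "ln (entry_sum (C n (rep_torus x))) \<le> ln ((\<bar>d\<bar> + 1 + \<bar>t\<bar> + K) ^ n)"
      using entry_sum_C_le[of m "rep_torus x"] entry_sum_C_ge_1[of n "rep_torus x"] Suc
      by (subst ln_le_cancel_iff) (auto simp del: C.simps)
    also have "\<dots> = ln (\<bar>d\<bar> + 1 + \<bar>t\<bar> + K) * real n"
      using K by (subst ln_realpow) auto
    finally show ?thesis using Suc by (simp add: \<phi>_def del: C.simps)
  qed (simp add: \<phi>_def)
  show "\<phi> (m + n) x \<le> \<phi> m x + \<phi> n ((f ^^ m) x)" for m n x
  proof (cases "m = 0 \<or> n = 0")
    case False
    let ?p = "rep_torus x"
    have "(f ^^ m) x = to_torus ((g ^^ m) ?p)"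
      using f_funpow_to_torus[of m ?p] by simp
    then have C: "C n (rep_torus ((f ^^ m) x)) = C n ((g ^^ m) ?p)" by (simp add: C_rep)
    have pos: "0 < entry_sum (C k q)" for k q using entry_sum_C_ge_1[of k q] by linarith
    have "ln (entry_sum (C (m + n) ?p)) \<le> ln (entry_sum (C n ((g ^^ m) ?p)) * entry_sum (C m ?p))"
      unfolding C_add using entry_sum_mult pos[of "m + n" ?p] pos
      by (subst ln_le_cancel_iff) (auto simp: C_add)
    also have "\<dots> = ln (entry_sum (C n ((g ^^ m) ?p))) + ln (entry_sum (C m ?p))"
      using pos[of n "(g ^^ m) ?p"] pos[of m ?p] by (rule ln_mult_pos)
    finally show ?thesis using False by (simp add: \<phi>_def C)
  qed (auto simp: \<phi>_def)
qed

text \<open>One vector suffices: the adjugate of \<open>C n\<close> maps \<open>v\<close> to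
  \<open>W n\<close> scaled by the determinant, so \<open>entry_sum (C n)\<close> is at least
  \<open>\<bar>d\<bar> ^ n\<close> times the norm of \<open>W n\<close>. Hence the limit
  \<open>L x\<close> is at least \<open>\<alpha> + ln \<bar>d\<bar>\<close>. The comparisons of
  \<open>onorm\<close> and \<open>conorm\<close> with \<open>entry_sum\<close> make
  \<open>L x\<close> the upper exponent and \<open>ln \<bar>d\<bar> - L x \<le> - \<alpha>\<close>
  the lower one.\<close>

lemma nonuniformly_hyperbolic_f: "nonuniformly_hyperbolic f"
proof -
  obtain \<alpha> where \<alpha>: "\<alpha> > 0" and growth: "\<forall>v. v \<noteq> 0 \<longrightarrow>
      (AE x in torus_haar. \<forall>\<^sub>F n in sequentially. real n * \<alpha> \<le> ln (norm (W n (rep_torus x) v)))"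
    using AE_backward_growth by (elim exE conjE)
  define v :: "real^2" where "v = axis 1 1"
  have v: "v \<noteq> 0" "norm v = 1" by (simp_all add: v_def axis_eq_0_iff)
  let ?l = "ln \<bar>real_of_int d\<bar>"
  have l: "?l > 0" using d by simp
  have pos: "0 < entry_sum (C n p)" for n p using entry_sum_C_ge_1[of n p] by linarith
  show ?thesis
    unfolding nonuniformly_hyperbolic_def
    using growth[rule_format, OF v(1)] AE_convergent_average
  proof eventually_elim
    case (elim x)
    let ?s = "\<lambda>n. entry_sum (C n (rep_torus x))"
    have dn: "det (C n p) \<noteq> 0" "\<bar>det (C n p)\<bar> = \<bar>real_of_int d\<bar> ^ n" for n p
      using d_nz by (simp_all add: det_C power_abs)
    have "\<forall>\<^sub>F n in sequentially. \<alpha> + ?l \<le> \<phi> n x / real n"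
      using elim(1) eventually_gt_at_top[of 0]
    proof eventually_elim
      case (elim n)
      let ?u = "W n (rep_torus x) v"
      have u: "norm ?u > 0" using W_nonzero[OF v(1), of n "rep_torus x"] by auto
      have "\<bar>real_of_int d\<bar> ^ n * norm ?u = norm (det (C n (rep_torus x)) *\<^sub>R ?u)" by (simp add: dn)
      also have "\<dots> = norm (adj2 (C n (rep_torus x)) *v v)"
        using adj2_mult(1)[of "C n (rep_torus x)" ?u] by (simp add: C_W)
      also have "\<dots> \<le> ?s n"
        using norm_matrix_vector_le[of "adj2 (C n (rep_torus x))" v] v by simp
      finally have "ln (\<bar>real_of_int d\<bar> ^ n * norm ?u) \<le> ln (?s n)"
        using u d_nz pos by (subst ln_le_cancel_iff) auto
      moreover have "ln (\<bar>real_of_int d\<bar> ^ n * norm ?u) = real n * ?l + ln (norm ?u)"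
        using u d_nz by (subst ln_mult_pos) (auto simp: ln_realpow)
      ultimately have "real n * (\<alpha> + ?l) \<le> \<phi> n x"
        using elim by (simp add: \<phi>_def algebra_simps)
      then show ?case using elim(2) by (simp add: field_simps)
    qed
    then have L: "\<alpha> + ?l \<le> L x"
      by (intro tendsto_lowerbound[OF elim(2)]) auto
    have "upper_lyapunov_exponent f x (L x)"
      unfolding upper_lyapunov_exponent_def torus_deriv_f
    proof (rule tendsto_average_bounded_diff[OF elim(2)])
      fix n :: nat assume n: "n > 0"
      have b: "?s n / 4 \<le> onorm ((*v) (C n (rep_torus x)))" "onorm ((*v) (C n (rep_torus x))) \<le> ?s n"
        by (rule onorm_entry_sum)+
      have "ln (?s n / 4) \<le> ln (onorm ((*v) (C n (rep_torus x))))"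
        using b pos[of n "rep_torus x"] by (subst ln_le_cancel_iff) auto
      moreover have "ln (onorm ((*v) (C n (rep_torus x)))) \<le> ln (?s n)"
        using b pos[of n "rep_torus x"] by (subst ln_le_cancel_iff) linarith+
      moreover have "ln (?s n / 4) = ln (?s n) - ln 4" using pos[of n "rep_torus x"] by (simp add: ln_div)
      ultimately show "\<bar>ln (onorm ((*v) (C n (rep_torus x)))) - \<phi> n x\<bar> \<le> ln 4"
        using n by (simp add: \<phi>_def)
    qed
    moreover have "lower_lyapunov_exponent f x (?l - L x)"
      unfolding lower_lyapunov_exponent_def torus_deriv_f
    proof (rule tendsto_average_bounded_diff)
      have "(\<lambda>n. ?l - \<phi> n x / real n) \<longlonglongrightarrow> ?l - L x"
        by (intro tendsto_intros elim)
      moreover have "\<forall>\<^sub>F n in sequentially. ?l - \<phi> n x / real n = (real n * ?l - \<phi> n x) / real n"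
        using eventually_gt_at_top[of 0] by eventually_elim (simp add: field_simps)
      ultimately show "(\<lambda>n. (real n * ?l - \<phi> n x) / real n) \<longlonglongrightarrow> ?l - L x"
        by (rule Lim_transform_eventually)
      fix n :: nat assume n: "n > 0"
      let ?c = "conorm ((*v) (C n (rep_torus x)))"
      note b = conorm_entry_sum[OF dn(1)[of n "rep_torus x"], unfolded dn(2)]
      have q: "0 < \<bar>real_of_int d\<bar> ^ n / ?s n" using b(1) d_nz by simp
      have "ln (\<bar>real_of_int d\<bar> ^ n / ?s n) \<le> ln ?c"
        using b q by (subst ln_le_cancel_iff) linarith+
      moreover have "ln ?c \<le> ln (4 * (\<bar>real_of_int d\<bar> ^ n / ?s n))"
        using b q by (subst ln_le_cancel_iff) auto
      moreover have "ln (4 * (\<bar>real_of_int d\<bar> ^ n / ?s n)) = ln 4 + ln (\<bar>real_of_int d\<bar> ^ n / ?s n)"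
        using q by (subst ln_mult_pos) auto
      moreover have "ln (\<bar>real_of_int d\<bar> ^ n / ?s n) = real n * ?l - ln (?s n)"
        using d_nz pos[of n "rep_torus x"] by (simp add: ln_div ln_realpow)
      ultimately show "\<bar>ln ?c - (real n * ?l - \<phi> n x)\<bar> \<le> ln 4"
        using n by (simp add: \<phi>_def)
    qed
    ultimately show ?case
      using L \<alpha> l by (intro exI[of _ "?l - L x"] exI[of _ "L x"]) auto
  qed
qed

end

text \<open>The columns of \<open>H a b\<close> are the vector with entries \<open>a\<close>,
  \<open>b\<close> and its image under \<open>E\<close>, so the relation is the Cayley-Hamilton
  theorem. Its determinant is a quadratic form in \<open>a\<close> and \<open>b\<close>; if it
  vanishes at both unit vectors and at their sum, every vector is an eigenvector and
  \<open>E\<close> is scalar.\<close>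

lemma companion_similar:
  fixes E :: "int^2^2"
  assumes "\<And>k. E \<noteq> mat k"
  obtains H :: "int^2^2" where "det H \<noteq> 0"
    "E ** H = H ** vector [vector [0, - det E], vector [1, E$1$1 + E$2$2]]"
proof -
  define H where "H a b = (vector [vector [a, E$1$1 * a + E$1$2 * b], vector [b, E$2$1 * a + E$2$2 * b]] :: int^2^2)" for a b
  have "E ** H a b = H a b ** vector [vector [0, - det E], vector [1, E$1$1 + E$2$2]]" for a b
    by (simp add: vec_eq_iff forall_2 matrix_matrix_mult_def sum_2 H_def det_2 algebra_simps)
  moreover have "\<exists>a b. det (H a b) \<noteq> 0"
  proof (rule ccontr)
    assume "\<not> ?thesis"
    then have "det (H 1 0) = 0" "det (H 0 1) = 0" "det (H 1 1) = 0" by auto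
    then have "E = mat (E$1$1)"
      by (simp add: H_def det_2 vec_eq_iff forall_2 mat_def)
    then show False using assms by blast
  qed
  ultimately show thesis using that by metis
qed

theorem corollary1p1:
  fixes F :: "torus \<Rightarrow> torus"
  assumes "torus_C_k 1 F"
    and "uniformly_expanding F"
    and "torus_degree F > 16"
    and "\<not> homotopic_to_homothety F"
  shows "\<exists>f. torus_smooth f \<and> conservative f \<and> nonuniformly_hyperbolic f \<and> is_factor_of F f"
proof -
  define E where "E = torus_linear_part F"
  obtain G where G: "torus_lift G F" using assms(1) by (auto simp: torus_C_k_def)
  obtain E' where E': "equivariant E' G" using torus_lift_equivariant[OF G] .
  have "E' = E" using torus_linear_part_eq[OF G E'] by (simp add: E_def)
  then have "torus_homotopic F (torus_endo E)" using torus_homotopic_endo[OF G E'] by simp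
  then have "E \<noteq> mat k" for k
    using assms(4) unfolding homotopic_to_homothety_def by blast
  then obtain H where H: "det H \<noteq> 0"
    "E ** H = H ** vector [vector [0, - det E], vector [1, E$1$1 + E$2$2]]"
    by (rule companion_similar)
  have d: "\<bar>det E\<bar> \<ge> 17" using assms(3) by (simp add: torus_degree_def E_def)
  obtain R \<theta> K where const: "R \<ge> 1" "\<theta> > 0" "K > 0"
    "\<forall>a b y. (a, b) \<noteq> (0, 0) \<longrightarrow>
      (\<Sum>k<nat \<bar>det E\<bar>. wnorm R (b + (of_int (E$1$1 + E$2$2) + K * cos (2 * pi * (y + real k / real (nat \<bar>det E\<bar>)))) * a / det E) (- a / det E) powr (- \<theta>))
        \<le> real (nat \<bar>det E\<bar>) * (99 / 100 * wnorm R a b powr (- \<theta>))"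
    using averaged_contraction[OF d, of "of_int (E$1$1 + E$2$2)"] by (elim exE conjE)
  then interpret f: henon_endo "det E" "E$1$1 + E$2$2" K R \<theta>
    using d const by unfold_locales auto
  have "det (rmat H) \<noteq> 0"
  proof -
    have "det (rmat H) = of_int (det H)" by (simp add: det_2)
    then show ?thesis using H(1) by simp
  qed
  then have inv: "invertible (rmat H)" by (simp add: invertible_det_nz)
  have "is_factor_of F f.f"
    by (rule expanding_factor[OF assms(1,2) f.lift_f f.g_equivariant _ inv])
      (simp only: f.A_def E_def[symmetric] H(2))
  then show ?thesis
    using f.smooth_f f.conservative_f f.nonuniformly_hyperbolic_f by (intro exI[of _ f.f] conjI)
qed

end
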